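(* Let $p=p(n)$ and $d=p(n-1)$, and suppose that $d\gg\log^3 n$ and $n-d\gg\log n$. Let $i\ge 0$ be the largest integer such that $d^i=o(n)$, let $c=c(n)=d^{i+1}/n$, and let $$q=\begin{cases}(e^{-c})^2+(1-e^{-c})^2 & \text{if } p=o(1),\\ p^2+(1-p)^2 & \text{if } p=\Theta(1).\end{cases}$$ Let $G=(V,E)\in G(n,p)$. Then the following hold a.a.s. (i) If $c=\Theta(1)$, then $\beta(G)\le(1+o(1))\frac{2\log n}{\log(1/q)}=\Theta(\log n)$. (ii) If $c\to\infty$, then $\beta(G)\le(1+o(1))\left(\frac{d^i}{n}+e^{-c}\right)^{-1}\log n$, and this bound is $\gg\log n$. In particular, $\beta(G)\le(1+o(1))e^c\log n=(1+o(1))\frac{2\log n}{\log(1/q)}$ if $e^{-c}\gg d^i/n$, and $\beta(G)\le(1+o(1))\frac{n\log n}{d^i}$ if $e^{-c}\ll d^i/n$.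
   Context: For a finite connected graph $G=(V,E)$ and $R=\{r_1,\dots,r_k\}\subseteq V$, $d_R(v)$ is the vector of graph distances from $v$ to $r_1,\dots,r_k$; $R$ is resolving if $d_R(v)\ne d_R(w)$ for all distinct $v,w$; the metric dimension $\beta(G)$ is the minimum size of a resolving set. $G(n,p)$ is the binomial random graph on $\{1,\dots,n\}$ with each pair an edge independently with probability $p=p(n)$. Asymptotics are as $n\to\infty$; a.a.s. means with probability tending to $1$; $f\ll g$ means $f=o(g)$, $f\gg g$ means $g=o(f)$. $\log$ is the natural logarithm.
   Formalization: In (i), "2 log n/log(1/q) = Θ(log n)" fails if p→1 (e.g. p = 1−1/log n gives ~log² n); the Θ is stated only when 1−p is bounded away from 0. The bound on β(G) and the Ω(log n) half are unconditional. The exponent i may depend on n. *)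

theory Defs
  imports "HOL-Probability.Probability" "HOL-Library.Landau_Symbols"
begin

text \<open>
  A finite simple graph is given by its vertex set \<open>V\<close> and its set \<open>E\<close> of edges, each edge being a
  two-element subset of \<open>V\<close>.
\<close>

definition pairs_on :: "'a set \<Rightarrow> 'a set set" where
  "pairs_on V = {e. e \<subseteq> V \<and> card e = 2}"

definition adj_rel :: "'a set set \<Rightarrow> ('a \<times> 'a) set" where
  "adj_rel E = {(u, v). {u, v} \<in> E}"

definition graph_connected :: "'a set \<Rightarrow> 'a set set \<Rightarrow> bool" where
  "graph_connected V E \<longleftrightarrow> (\<forall>u\<in>V. \<forall>v\<in>V. (u, v) \<in> (adj_rel E)\<^sup>*)"

text \<open>
  The length of a shortest walk; meaningful only if \<open>u\<close> and \<open>v\<close> lie in the same component.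
\<close>

definition graph_dist :: "'a set set \<Rightarrow> 'a \<Rightarrow> 'a \<Rightarrow> nat" where
  "graph_dist E u v = (LEAST k. (u, v) \<in> adj_rel E ^^ k)"

definition dist_vector :: "'a set set \<Rightarrow> 'a set \<Rightarrow> 'a \<Rightarrow> 'a \<Rightarrow> nat" where
  "dist_vector E R v = (\<lambda>r\<in>R. graph_dist E v r)"

definition resolving :: "'a set \<Rightarrow> 'a set set \<Rightarrow> 'a set \<Rightarrow> bool" where
  "resolving V E R \<longleftrightarrow> R \<subseteq> V \<and>
     (\<forall>v\<in>V. \<forall>w\<in>V. v \<noteq> w \<longrightarrow> dist_vector E R v \<noteq> dist_vector E R w)"

definition metric_dim :: "'a set \<Rightarrow> 'a set set \<Rightarrow> nat" where
  "metric_dim V E = (LEAST k. \<exists>R. resolving V E R \<and> card R = k)"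

definition gnp :: "nat \<Rightarrow> real \<Rightarrow> nat set set pmf" where
  "gnp n p = map_pmf (\<lambda>f. {e \<in> pairs_on {1..n}. f e})
     (Pi_pmf (pairs_on {1..n}) False (\<lambda>_. bernoulli_pmf p))"

definition aas :: "(nat \<Rightarrow> real) \<Rightarrow> (nat \<Rightarrow> nat set set \<Rightarrow> bool) \<Rightarrow> bool" where
  "aas p Q \<longleftrightarrow> (\<lambda>n. measure_pmf.prob (gnp n (p n)) {E. Q n E}) \<longlonglongrightarrow> 1"

text \<open>
  The assertion that a.a.s. the metric dimension of the random graph is at most \<open>(1 + o(1)) f(n)\<close>.
  Since the metric dimension is a notion for connected graphs only, connectedness is part of the
  event, so disconnected outcomes never count as satisfying the bound.
\<close>

definition aas_metric_dim_le :: "(nat \<Rightarrow> real) \<Rightarrow> (nat \<Rightarrow> real) \<Rightarrow> bool" where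
  "aas_metric_dim_le p f \<longleftrightarrow> (\<exists>\<epsilon> :: nat \<Rightarrow> real. \<epsilon> \<longlonglongrightarrow> 0 \<and>
     aas p (\<lambda>n E. graph_connected {1..n} E \<and>
                  real (metric_dim {1..n} E) \<le> (1 + \<epsilon> n) * f n))"

text \<open>
  The largest \<open>i\<close> with \<open>d^i = o(n)\<close>. The exponent may depend on \<open>n\<close>, as it must when \<open>d = n^o(1)\<close>:
  it dominates eventually every sequence of exponents with the same property. Equivalently,
  \<open>d^i = o(n)\<close> and \<open>d^(i+1)/n\<close> is bounded away from 0 (if eventually \<open>d \<ge> 1\<close>).
\<close>

definition largest_exponent :: "(nat \<Rightarrow> real) \<Rightarrow> (nat \<Rightarrow> nat) \<Rightarrow> bool" where
  "largest_exponent d i \<longleftrightarrow>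
     (\<lambda>n. d n ^ i n) \<in> o(\<lambda>n. real n) \<and>
     (\<forall>j. (\<lambda>n. d n ^ j n) \<in> o(\<lambda>n. real n) \<longrightarrow> (\<forall>\<^sub>F n in sequentially. j n \<le> i n))"

end

theory Submission
  imports Defs "HOL-Real_Asymp.Real_Asymp"
begin

text \<open>
  If every pair of vertices is separated by at least \<open>K\<close> of the \<open>n\<close> vertices, a greedy choice gives a
  resolving set of any size \<open>s\<close> with \<open>n\<^sup>2 (1 - K/n)\<^sup>s < 1\<close>. To bound \<open>K\<close> for a pair \<open>u, v\<close>, expose
  the breadth-first layers around \<open>u\<close> and \<open>v\<close> up to distance \<open>i\<close>. The \<open>j\<close>-th layer has size
  \<open>d\<^sup>j\<close> up to a relative error small enough to survive in the exponent of \<open>exp (- c)\<close>: the fluctuation of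
  order \<open>sqrt (ln n / d)\<close> is multiplied there by \<open>c = O(ln n)\<close>, which is where \<open>d \<gg> ln\<^sup>3 n\<close> is needed. The two
  outer layers are nearly disjoint and each of their vertices separates \<open>u\<close> from \<open>v\<close>. A vertex beyond them
  separates \<open>u\<close> from \<open>v\<close> if it is adjacent to exactly one of the two layers; the edges concerned are
  still unexposed, so this happens independently with probability about \<open>2 exp (- c) (1 - exp (- c))\<close>, or
  \<open>2 p (1 - p)\<close> when \<open>i = 0\<close>. Chernoff bounds and a union bound over the pairs conclude.
\<close>

section \<open>Random subsets\<close>

text \<open>The rate \<open>L\<close> in the bound \<open>2 ln n / L\<close> is read off from the
  greedy threshold: each pair has a fraction of about 1 - exp (- L) of the vertices separating it,
  and the 2 comes from the n^2 ordered pairs. For fixed collision probability q this fraction is 1 -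
  q and L = ln (1/q); when it tends to 0, it can serve as L itself. The union bound over the pairs
  needs the number of separating vertices to exceed every multiple of ln n: for sparse p it is at
  least d, for dense p it is at least of order n - d. Two devices carry the probabilistic part.
  Conditioning on layers is replaced by a combinatorial notion, being determined by a set of edges,
  so that expectations factor over disjoint edge sets and no conditional probability is formed. And
  the near-disjointness of the two outer layers is obtained by counting: the growth estimate is
  applied from \<open>{u}\<close>, from \<open>{v}\<close> and from \<open>{u, v}\<close>, and a
  union about twice as large as each part leaves little room for overlap. This is why growth is
  studied from a start set \<open>T\<close> of one or two vertices.\<close>

definition determined_by :: "'a set \<Rightarrow> ('a set \<Rightarrow> 'b) \<Rightarrow> bool" where
  "determined_by K f \<longleftrightarrow> (\<forall>E E'. E \<inter> K = E' \<inter> K \<longrightarrow> f E = f E')"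

lemma determined_byI:
  "(\<And>E E'. E \<inter> K = E' \<inter> K \<Longrightarrow> f E = f E') \<Longrightarrow> determined_by K f"
  unfolding determined_by_def by blast

lemma determined_byD: "determined_by K f \<Longrightarrow> E \<inter> K = E' \<inter> K \<Longrightarrow> f E = f E'"
  unfolding determined_by_def by blast

lemma determined_by_mono:
  assumes "determined_by K f" "K \<subseteq> L"
  shows "determined_by L f"
proof (rule determined_byI)
  fix E E' assume "E \<inter> L = E' \<inter> L"
  then have "E \<inter> K = E' \<inter> K" using assms(2) by blast
  then show "f E = f E'" by (rule determined_byD[OF assms(1)])
qed

lemma determined_by_compose:
  assumes "determined_by K f"
  shows "determined_by K (\<lambda>E. h (f E))"
  by (rule determined_byI, rule arg_cong[where f = h], erule determined_byD[OF assms])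

text \<open>The same model as \<open>gnp\<close> over an arbitrary ground set, so that it can be
  restricted to pieces and recombined from disjoint ones.\<close>

definition random_subset :: "'a set \<Rightarrow> real \<Rightarrow> 'a set pmf" where
  "random_subset P p = map_pmf (\<lambda>f. {e \<in> P. f e}) (Pi_pmf P False (\<lambda>_. bernoulli_pmf p))"

lemma gnp_eq_random_subset: "gnp n p = random_subset (pairs_on {1..n}) p"
  by (simp add: gnp_def random_subset_def)

lemma set_random_subset: "set_pmf (random_subset P p) \<subseteq> Pow P"
  by (auto simp: random_subset_def)

lemma integrable_random_subset [simp, intro]:
  fixes f :: "'a set \<Rightarrow> real"
  assumes "finite P"
  shows "integrable (measure_pmf (random_subset P p)) f"
  by (rule integrable_measure_pmf_finite)
     (use assms finite_subset[OF set_random_subset] in auto)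

lemma expectation_pair_pmf_mult:
  fixes f :: "'a \<Rightarrow> real" and g :: "'b \<Rightarrow> real"
  assumes "finite (set_pmf A)" "finite (set_pmf B)"
  shows "measure_pmf.expectation (pair_pmf A B) (\<lambda>(x, y). f x * g y) =
         measure_pmf.expectation A f * measure_pmf.expectation B g"
proof -
  have "measure_pmf.expectation (pair_pmf A B) (\<lambda>(x, y). f x * g y) =
        (\<Sum>z\<in>set_pmf A \<times> set_pmf B. (case z of (x, y) \<Rightarrow> f x * g y) * pmf (pair_pmf A B) z)"
    by (rule integral_measure_pmf_real) (use assms in auto)
  also have "\<dots> = (\<Sum>x\<in>set_pmf A. \<Sum>y\<in>set_pmf B. (f x * pmf A x) * (g y * pmf B y))"
    by (simp add: sum.cartesian_product pmf_pair case_prod_unfold mult_ac)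
       (auto intro!: sum.cong simp: pmf_pair)
  also have "\<dots> = (\<Sum>x\<in>set_pmf A. f x * pmf A x) * (\<Sum>y\<in>set_pmf B. g y * pmf B y)"
    by (simp add: sum_product)
  also have "\<dots> = measure_pmf.expectation A f * measure_pmf.expectation B g"
    using integral_measure_pmf_real[of "set_pmf A" A f] integral_measure_pmf_real[of "set_pmf B" B g]
      assms by simp
  finally show ?thesis .
qed

lemma random_subset_union:
  assumes "finite K" "finite L" "K \<inter> L = {}"
  shows "random_subset (K \<union> L) p =
         map_pmf (\<lambda>(A, B). A \<union> B) (pair_pmf (random_subset K p) (random_subset L p))"
proof -
  have "pair_pmf (random_subset K p) (random_subset L p) =
     map_pmf (\<lambda>(f, g). ({e \<in> K. f e}, {e \<in> L. g e}))
       (pair_pmf (Pi_pmf K False (\<lambda>_. bernoulli_pmf p)) (Pi_pmf L False (\<lambda>_. bernoulli_pmf p)))"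
    by (simp add: random_subset_def map_pair)
  then show ?thesis
    unfolding random_subset_def[of "K \<union> L"] Pi_pmf_union[OF assms]
    using assms(3) by (simp add: pmf.map_comp o_def case_prod_unfold) (rule map_pmf_cong, auto)
qed

text \<open>The random set is the union of independent random subsets of \<open>K \<inter> P\<close>
  and \<open>P - K\<close>; \<open>f\<close> sees only the first and \<open>g\<close> only the
  second. Taking the complement in the whole type spares side conditions of the form
  \<open>K \<subseteq> P\<close>.\<close>

lemma expectation_random_subset_mult:
  fixes f g :: "'a set \<Rightarrow> real"
  assumes P: "finite P" and f: "determined_by K f" and g: "determined_by (- K) g"
  shows "measure_pmf.expectation (random_subset P p) (\<lambda>E. f E * g E) =
         measure_pmf.expectation (random_subset P p) f * measure_pmf.expectation (random_subset P p) g"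
proof -
  let ?K = "K \<inter> P" and ?L = "P - K"
  have fin: "finite ?K" "finite ?L" using P by auto
  have split: "measure_pmf.expectation (random_subset P p) (\<lambda>E. f' E * g' E) =
         measure_pmf.expectation (random_subset ?K p) f' * measure_pmf.expectation (random_subset ?L p) g'"
    if f': "determined_by K f'" and g': "determined_by (- K) g'" for f' g' :: "'a set \<Rightarrow> real"
  proof -
    have "random_subset P p = random_subset (?K \<union> ?L) p"
      by (rule arg_cong[where f = "\<lambda>P. random_subset P p"]) auto
    also have "\<dots> = map_pmf (\<lambda>(A, B). A \<union> B) (pair_pmf (random_subset ?K p) (random_subset ?L p))"
      by (rule random_subset_union) (use fin in auto)
    finally have "measure_pmf.expectation (random_subset P p) (\<lambda>E. f' E * g' E) =
      measure_pmf.expectation (pair_pmf (random_subset ?K p) (random_subset ?L p))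
        (\<lambda>(A, B). f' (A \<union> B) * g' (A \<union> B))"
      by (simp add: case_prod_unfold)
    also have "\<dots> = measure_pmf.expectation (pair_pmf (random_subset ?K p) (random_subset ?L p))
        (\<lambda>(A, B). f' A * g' B)"
    proof (rule integral_cong_AE)
      show "AE x in measure_pmf (pair_pmf (random_subset ?K p) (random_subset ?L p)).
        (case x of (A, B) \<Rightarrow> f' (A \<union> B) * g' (A \<union> B)) = (case x of (A, B) \<Rightarrow> f' A * g' B)"
      proof (rule AE_pmfI)
        fix x assume "x \<in> set_pmf (pair_pmf (random_subset ?K p) (random_subset ?L p))"
        then obtain A B where x: "x = (A, B)" "A \<subseteq> ?K" "B \<subseteq> ?L"
          using set_random_subset by (cases x) fastforce
        have "f' (A \<union> B) = f' A" by (rule determined_byD[OF f']) (use x in auto)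
        moreover have "g' (A \<union> B) = g' B" by (rule determined_byD[OF g']) (use x in auto)
        ultimately show "(case x of (A, B) \<Rightarrow> f' (A \<union> B) * g' (A \<union> B)) =
            (case x of (A, B) \<Rightarrow> f' A * g' B)" by (simp add: x)
      qed
    qed auto
    also have "\<dots> = measure_pmf.expectation (random_subset ?K p) f' *
                    measure_pmf.expectation (random_subset ?L p) g'"
      by (rule expectation_pair_pmf_mult)
         (use fin finite_subset[OF set_random_subset] in auto)
    finally show ?thesis .
  qed
  \<comment> \<open>Splitting with the constant 1 as the other factor identifies each expectation
    over \<open>P\<close> with the one over its own piece.\<close>
  have one: "determined_by A (\<lambda>_. 1 :: real)" for A :: "'a set"
    by (simp add: determined_by_def)
  have "measure_pmf.expectation (random_subset P p) f = measure_pmf.expectation (random_subset ?K p) f"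
    using split[OF f one] by simp
  moreover have "measure_pmf.expectation (random_subset P p) g = measure_pmf.expectation (random_subset ?L p) g"
    using split[OF one g] by simp
  ultimately show ?thesis using split[OF f g] by (simp only:)
qed

lemma prob_eq_expectation_of_bool:
  "measure_pmf.prob M {x. A x} = measure_pmf.expectation M (\<lambda>x. of_bool (A x))"
proof -
  have "measure_pmf.prob M {x. A x} = measure_pmf.expectation M (indicator {x. A x})"
    by simp
  also have "indicator {x. A x} = (\<lambda>x. of_bool (A x) :: real)"
    by (auto simp: indicator_def)
  finally show ?thesis .
qed

lemma prob_random_subset_inter:
  assumes P: "finite P" and A: "determined_by K A" and B: "determined_by (- K) B"
  shows "measure_pmf.prob (random_subset P p) {E. A E \<and> B E} =
         measure_pmf.prob (random_subset P p) {E. A E} * measure_pmf.prob (random_subset P p) {E. B E}"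
  unfolding prob_eq_expectation_of_bool of_bool_conj
  by (rule expectation_random_subset_mult[OF P])
     (rule determined_by_compose[OF A] determined_by_compose[OF B])+

text \<open>One factor is peeled off at a time: by disjointness the remaining product is determined
  by the complement of \<open>K w\<close>.\<close>

lemma expectation_random_subset_prod:
  fixes g :: "'w \<Rightarrow> 'a set \<Rightarrow> real"
  assumes P: "finite P" and W: "finite W"
    and K: "\<And>w. w \<in> W \<Longrightarrow> determined_by (K w) (g w)"
    and disj: "disjoint_family_on K W"
  shows "measure_pmf.expectation (random_subset P p) (\<lambda>E. \<Prod>w\<in>W. g w E) =
         (\<Prod>w\<in>W. measure_pmf.expectation (random_subset P p) (g w))"
  using W K disj
proof (induction W rule: finite_induct)
  case (insert w W)
  have "measure_pmf.expectation (random_subset P p) (\<lambda>E. \<Prod>w\<in>insert w W. g w E) =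
        measure_pmf.expectation (random_subset P p) (\<lambda>E. g w E * (\<Prod>w\<in>W. g w E))"
    using insert.hyps by simp
  also have "\<dots> = measure_pmf.expectation (random_subset P p) (g w) *
                  measure_pmf.expectation (random_subset P p) (\<lambda>E. \<Prod>w\<in>W. g w E)"
  proof (rule expectation_random_subset_mult[OF P, of "K w"])
    show "determined_by (- K w) (\<lambda>E. \<Prod>w\<in>W. g w E)"
    proof (rule determined_byI)
      fix E E' :: "'a set" assume *: "E \<inter> - K w = E' \<inter> - K w"
      show "(\<Prod>w\<in>W. g w E) = (\<Prod>w\<in>W. g w E')"
      proof (rule prod.cong[OF refl])
        fix v assume v: "v \<in> W"
        then have "K v \<subseteq> - K w"
          using insert.prems(2) insert.hyps by (fastforce simp: disjoint_family_on_def)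
        then have "E \<inter> K v = E' \<inter> K v" using * by blast
        then show "g v E = g v E'" using insert.prems(1)[of v] v by (auto dest: determined_byD)
      qed
    qed
  qed (use insert.prems in auto)
  also have "measure_pmf.expectation (random_subset P p) (\<lambda>E. \<Prod>w\<in>W. g w E) =
             (\<Prod>w\<in>W. measure_pmf.expectation (random_subset P p) (g w))"
    by (rule insert.IH) (use insert.prems in \<open>auto simp: disjoint_family_on_def\<close>)
  finally show ?case using insert.hyps by simp
qed simp

lemma prob_mem_random_subset:
  assumes "finite P" "e \<in> P" "0 \<le> p" "p \<le> 1"
  shows "measure_pmf.prob (random_subset P p) {E. e \<notin> E} = 1 - p"
proof -
  have "measure_pmf.prob (random_subset P p) {E. e \<notin> E} =
        measure_pmf.prob (map_pmf (\<lambda>f. f e) (Pi_pmf P False (\<lambda>_. bernoulli_pmf p))) {False}"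
    using assms(2) by (simp add: random_subset_def vimage_def)
  also have "\<dots> = 1 - p"
    using assms by (simp add: Pi_pmf_component measure_pmf_single)
  finally show ?thesis .
qed

lemma prob_random_subset_avoid:
  assumes P: "finite P" and "K \<subseteq> P" "0 \<le> p" "p \<le> 1"
  shows "measure_pmf.prob (random_subset P p) {E. E \<inter> K = {}} = (1 - p) ^ card K"
proof -
  have K: "finite K" using P \<open>K \<subseteq> P\<close> finite_subset by auto
  have "measure_pmf.prob (random_subset P p) {E. E \<inter> K = {}} =
        measure_pmf.expectation (random_subset P p) (\<lambda>E. of_bool (E \<inter> K = {}))"
    by (rule prob_eq_expectation_of_bool)
  also have "(\<lambda>E. of_bool (E \<inter> K = {}) :: real) = (\<lambda>E. \<Prod>e\<in>K. of_bool (e \<notin> E))"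
  proof
    fix E
    show "(of_bool (E \<inter> K = {}) :: real) = (\<Prod>e\<in>K. of_bool (e \<notin> E))"
    proof (cases "E \<inter> K = {}")
      case True
      then have "(\<Prod>e\<in>K. of_bool (e \<notin> E)) = (1 :: real)"
        by (intro prod.neutral) auto
      with True show ?thesis by simp
    next
      case False
      then have "(\<Prod>e\<in>K. of_bool (e \<notin> E)) = (0 :: real)"
        using K by (intro prod_zero) auto
      with False show ?thesis by simp
    qed
  qed
  also have "measure_pmf.expectation (random_subset P p) \<dots> =
             (\<Prod>e\<in>K. measure_pmf.expectation (random_subset P p) (\<lambda>E. of_bool (e \<notin> E)))"
    by (rule expectation_random_subset_prod[OF P K, of "\<lambda>e. {e}"])
       (auto simp: determined_by_def disjoint_family_on_def)
  also have "\<dots> = (\<Prod>e\<in>K. 1 - p)"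
    using assms prob_mem_random_subset[OF P, of _ p]
    by (intro prod.cong[OF refl]) (auto simp: prob_eq_expectation_of_bool)
  finally show ?thesis by simp
qed

text \<open>
  Exposing the random set in stages: if \<open>X E = h\<close> can be decided by looking at \<open>K h\<close> only, then
  conditionally on \<open>X E = h\<close> the rest of the set is still unexposed.
\<close>

lemma prob_random_subset_exposed:
  fixes X :: "'a set \<Rightarrow> 'h"
  assumes P: "finite P" and "0 \<le> \<epsilon>"
    and X: "\<And>E E'. E \<inter> K (X E) = E' \<inter> K (X E) \<Longrightarrow> X E' = X E"
    and B: "\<And>h. h \<in> G \<Longrightarrow> determined_by (- K h) (B h)"
    and le: "\<And>h. h \<in> G \<Longrightarrow> measure_pmf.prob (random_subset P p) {E. B h E} \<le> \<epsilon>"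
  shows "measure_pmf.prob (random_subset P p) {E. X E \<in> G \<and> B (X E) E} \<le> \<epsilon>"
proof -
  let ?M = "random_subset P p"
  let ?H = "(X ` Pow P) \<inter> G"
  have finH: "finite ?H" using P by auto
  have "measure_pmf.prob ?M {E. X E \<in> G \<and> B (X E) E} =
        measure_pmf.prob ?M (\<Union>h\<in>?H. {E. X E = h \<and> B h E})"
    by (rule measure_pmf.finite_measure_eq_AE)
       (use set_random_subset in \<open>fastforce simp: AE_measure_pmf_iff\<close>)+
  also have "\<dots> \<le> (\<Sum>h\<in>?H. measure_pmf.prob ?M {E. X E = h \<and> B h E})"
    by (rule measure_pmf.finite_measure_subadditive_finite) (use finH in auto)
  also have "\<dots> = (\<Sum>h\<in>?H. measure_pmf.prob ?M {E. X E = h} * measure_pmf.prob ?M {E. B h E})"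
  proof (rule sum.cong[OF refl])
    fix h assume h: "h \<in> ?H"
    show "measure_pmf.prob ?M {E. X E = h \<and> B h E} =
          measure_pmf.prob ?M {E. X E = h} * measure_pmf.prob ?M {E. B h E}"
    proof (rule prob_random_subset_inter[OF P, of "K h"])
      \<comment> \<open>Hypothesis \<open>X\<close> refers to the observed value itself; once the
        value is fixed to \<open>h\<close>, it says exactly that the event \<open>X E = h\<close>
        can be decided on \<open>K h\<close>.\<close>
      show "determined_by (K h) (\<lambda>E. X E = h)"
        by (rule determined_byI) (metis X)
    qed (use h B in auto)
  qed
  also have "\<dots> \<le> (\<Sum>h\<in>?H. measure_pmf.prob ?M {E. X E = h} * \<epsilon>)"
    by (intro sum_mono mult_left_mono) (use le in auto)
  also have "\<dots> = measure_pmf.prob ?M (\<Union>h\<in>?H. {E. X E = h}) * \<epsilon>"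
    by (subst measure_pmf.finite_measure_finite_Union)
       (use finH in \<open>auto simp: disjoint_family_on_def sum_distrib_right\<close>)
  also have "\<dots> \<le> 1 * \<epsilon>"
    by (intro mult_right_mono) (use \<open>0 \<le> \<epsilon>\<close> in auto)
  finally show ?thesis by simp
qed

section \<open>Chernoff bounds\<close>

text \<open>Reciprocal of the quadratic Taylor lower bound for exp x, since (1 - x + x^2/2) (1 + x +
  x^2/2) = 1 + x^4/4 is at least 1. It holds for all x >= 0, so the lower tail below needs no upper
  limit on the deviation.\<close>

lemma exp_minus_le_quadratic:
  fixes x :: real assumes "0 \<le> x" shows "exp (- x) \<le> 1 - x + x\<^sup>2 / 2"
proof -
  have lower: "1 + x + x\<^sup>2 / 2 \<le> exp x"
    using exp_lower_Taylor_quadratic[OF assms] by simp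
  have pos: "0 < 1 + x + x\<^sup>2 / 2" using assms by (simp add: add_pos_nonneg)
  have nn: "0 \<le> 1 - x + x\<^sup>2 / 2"
    using zero_le_power2[of "1 - x"] by (simp add: power2_eq_square algebra_simps)
  have "1 \<le> 1 + (x\<^sup>2)\<^sup>2 / 4" by simp
  also have "\<dots> = (1 - x + x\<^sup>2 / 2) * (1 + x + x\<^sup>2 / 2)"
    by (simp add: power2_eq_square field_simps)
  also have "\<dots> \<le> (1 - x + x\<^sup>2 / 2) * exp x"
    by (rule mult_left_mono[OF lower nn])
  finally have "1 / exp x \<le> 1 - x + x\<^sup>2 / 2" by (simp add: field_simps)
  then show ?thesis by (simp add: exp_minus inverse_eq_divide)
qed

lemma markov_random_subset:
  fixes u :: "'a set \<Rightarrow> real"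
  assumes "finite P" "0 < c" "\<And>E. 0 \<le> u E"
  shows "measure_pmf.prob (random_subset P p) {E. c \<le> u E} \<le>
         measure_pmf.expectation (random_subset P p) u / c"
  using integral_Markov_inequality_measure[of "measure_pmf (random_subset P p)" u "{}" c] assms by auto

text \<open>Independence is encoded by pairwise disjoint determining sets, the form in which
  \<open>expectation_random_subset_prod\<close> applies and in which it is visible for edges of a
  graph.\<close>

locale independent_events =
  fixes P :: "'a set" and p :: real and W :: "'w set" and K :: "'w \<Rightarrow> 'a set"
    and B :: "'w \<Rightarrow> 'a set \<Rightarrow> bool" and r :: real
  assumes fin_P: "finite P" and fin_W: "finite W"
    and determined: "\<And>w. w \<in> W \<Longrightarrow> determined_by (K w) (B w)"
    and disjoint: "disjoint_family_on K W"
    and prob: "\<And>w. w \<in> W \<Longrightarrow> measure_pmf.prob (random_subset P p) {E. B w E} = r"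
begin

definition occurring :: "'a set \<Rightarrow> nat" where
  "occurring E = card {w \<in> W. B w E}"

text \<open>The moment generating function, written with base \<open>y\<close> as a product of the
  factors \<open>1 + (y - 1) * of_bool (B w E)\<close> and bounded by 1 + x \<le> exp x. Both y > 1
  and y < 1 are needed, one for each tail.\<close>

lemma expectation_power_occurring:
  assumes "0 < y"
  shows "measure_pmf.expectation (random_subset P p) (\<lambda>E. y ^ occurring E) \<le>
         exp (real (card W) * r * (y - 1))"
proof -
  have "(\<lambda>E. y ^ occurring E) = (\<lambda>E. \<Prod>w\<in>W. 1 + (y - 1) * of_bool (B w E))"
  proof
    fix E
    have "(\<Prod>w\<in>W. 1 + (y - 1) * of_bool (B w E)) = (\<Prod>w\<in>W. if B w E then y else 1)"
      by (rule prod.cong) auto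
    also have "\<dots> = y ^ card (W \<inter> Collect (\<lambda>w. B w E))"
      using fin_W by (subst prod.If_cases) auto
    also have "W \<inter> Collect (\<lambda>w. B w E) = {w \<in> W. B w E}" by auto
    finally show "y ^ occurring E = (\<Prod>w\<in>W. 1 + (y - 1) * of_bool (B w E))"
      by (simp add: occurring_def)
  qed
  then have "measure_pmf.expectation (random_subset P p) (\<lambda>E. y ^ occurring E) =
        measure_pmf.expectation (random_subset P p) (\<lambda>E. \<Prod>w\<in>W. 1 + (y - 1) * of_bool (B w E))"
    by simp
  also have "\<dots> = (\<Prod>w\<in>W. measure_pmf.expectation (random_subset P p) (\<lambda>E. 1 + (y - 1) * of_bool (B w E)))"
    by (rule expectation_random_subset_prod[OF fin_P fin_W _ disjoint])
       (rule determined_by_compose[OF determined])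
  also have "\<dots> = (\<Prod>w\<in>W. 1 + (y - 1) * r)"
    by (intro prod.cong refl) (simp add: fin_P prob[symmetric] prob_eq_expectation_of_bool)
  also have "\<dots> \<le> (\<Prod>w\<in>W. exp ((y - 1) * r))"
  proof (rule prod_mono)
    fix w assume "w \<in> W"
    then have "0 \<le> r" "r \<le> 1" using prob[symmetric, of w] by auto
    then have "0 \<le> (1 - r) + y * r" using assms by (intro add_nonneg_nonneg) auto
    then have "0 \<le> 1 + (y - 1) * r" by (simp add: algebra_simps)
    then show "0 \<le> 1 + (y - 1) * r \<and> 1 + (y - 1) * r \<le> exp ((y - 1) * r)" by simp
  qed
  also have "\<dots> = exp (real (card W) * r * (y - 1))"
    by (simp add: exp_of_nat_mult[symmetric] mult_ac)
  finally show ?thesis .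
qed

text \<open>Exponential Markov inequality with a multiplier \<open>l\<close> of either sign:
  positive for the upper tail, negative for the lower one.\<close>

lemma prob_power_occurring:
  assumes "\<And>E. Q E \<Longrightarrow> a \<le> l * real (occurring E)"
  shows "measure_pmf.prob (random_subset P p) {E. Q E} \<le> exp (real (card W) * r * (exp l - 1) - a)"
proof -
  have "measure_pmf.prob (random_subset P p) {E. Q E} \<le>
        measure_pmf.prob (random_subset P p) {E. exp a \<le> exp l ^ occurring E}"
    by (rule measure_pmf.finite_measure_mono)
       (use assms in \<open>auto simp: exp_of_nat_mult[symmetric] mult.commute\<close>)
  also have "\<dots> \<le> measure_pmf.expectation (random_subset P p) (\<lambda>E. exp l ^ occurring E) / exp a"
    by (rule markov_random_subset) (auto simp: fin_P)
  also have "\<dots> \<le> exp (real (card W) * r * (exp l - 1)) / exp a"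
    by (intro divide_right_mono expectation_power_occurring) auto
  finally show ?thesis by (simp add: exp_diff)
qed

lemma mean_nonneg: "0 \<le> real (card W) * r"
proof (cases "W = {}")
  case False
  then obtain w where "w \<in> W" by auto
  then have "0 \<le> r" using prob[of w] by (metis measure_nonneg)
  then show ?thesis by simp
qed simp

text \<open>Multiplier \<open>l = e / 2\<close>; the bound exp x \<le> 1 + x + x^2 for x \<le> 1 is
  the origin of \<open>e \<le> 2\<close>. The deviation is measured in an upper bound
  \<open>M\<close> for the mean, so that a small mean does not spoil the exponent.\<close>

lemma chernoff_upper:
  assumes M: "real (card W) * r \<le> M" and e: "0 \<le> e" "e \<le> 2"
  shows "measure_pmf.prob (random_subset P p) {E. real (card W) * r + e * M \<le> real (occurring E)}
         \<le> exp (- (e\<^sup>2 * M / 4))"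
proof -
  let ?m = "real (card W) * r"
  have "measure_pmf.prob (random_subset P p) {E. ?m + e * M \<le> real (occurring E)}
        \<le> exp (?m * (exp (e / 2) - 1) - e / 2 * (?m + e * M))"
    by (rule prob_power_occurring) (rule mult_left_mono, use e in auto)
  also have "\<dots> \<le> exp (?m * (e / 2 + (e / 2)\<^sup>2) - e / 2 * (?m + e * M))"
    using exp_bound[of "e / 2"] e mean_nonneg by (auto intro!: mult_left_mono)
  also have "\<dots> = exp (e\<^sup>2 / 4 * ?m - e\<^sup>2 / 2 * M)"
    by (simp add: algebra_simps power2_eq_square)
  also have "\<dots> \<le> exp (- (e\<^sup>2 * M / 4))"
    using mult_left_mono[OF M, of "e\<^sup>2 / 4"] by (simp add: algebra_simps)
  finally show ?thesis .
qed

text \<open>Multiplier \<open>l = - e\<close>. Again \<open>M\<close> may exceed the mean, which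
  later allows it to include a deterministic number of separating vertices.\<close>

lemma chernoff_lower:
  assumes M: "real (card W) * r \<le> M" and e: "0 \<le> e"
  shows "measure_pmf.prob (random_subset P p) {E. real (occurring E) \<le> real (card W) * r - e * M}
         \<le> exp (- (e\<^sup>2 * M / 2))"
proof -
  let ?m = "real (card W) * r"
  have "measure_pmf.prob (random_subset P p) {E. real (occurring E) \<le> ?m - e * M}
        \<le> exp (?m * (exp (- e) - 1) - (- e) * (?m - e * M))"
    by (rule prob_power_occurring) (rule mult_left_mono_neg, use e in auto)
  also have "\<dots> \<le> exp (?m * (- e + e\<^sup>2 / 2) + e * (?m - e * M))"
    using exp_minus_le_quadratic[OF e] mean_nonneg by (auto intro!: mult_left_mono)
  also have "\<dots> = exp (e\<^sup>2 / 2 * ?m - e\<^sup>2 * M)"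
    by (simp add: algebra_simps power2_eq_square)
  also have "\<dots> \<le> exp (- (e\<^sup>2 * M / 2))"
    using mult_left_mono[OF M, of "e\<^sup>2 / 2"] by (simp add: algebra_simps)
  finally show ?thesis .
qed

end

section \<open>Breadth-first layers\<close>

definition nbhd :: "'a set set \<Rightarrow> 'a set \<Rightarrow> 'a set" where
  "nbhd E S = {w. \<exists>x\<in>S. {x, w} \<in> E}"

text \<open>
  The inequality is strict: \<open>near E T k\<close> consists of the vertices at distance less than \<open>k\<close> from \<open>T\<close>.
\<close>

primrec near :: "'a set set \<Rightarrow> 'a set \<Rightarrow> nat \<Rightarrow> 'a set" where
  "near E T 0 = {}"
| "near E T (Suc k) = T \<union> nbhd E (near E T k)"

lemma nbhd_mono: "S \<subseteq> T \<Longrightarrow> nbhd E S \<subseteq> nbhd E T"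
  by (auto simp: nbhd_def)

lemma nbhd_Un: "nbhd E (S \<union> T) = nbhd E S \<union> nbhd E T"
  by (auto simp: nbhd_def)

lemma nbhd_subset: "E \<subseteq> pairs_on V \<Longrightarrow> nbhd E S \<subseteq> V"
  by (force simp: nbhd_def pairs_on_def)

lemma near_Suc_mono: "near E T k \<subseteq> near E T (Suc k)"
proof (induction k)
  case (Suc k)
  show ?case using nbhd_mono[OF Suc] by auto
qed simp

lemma near_mono: "j \<le> k \<Longrightarrow> near E T j \<subseteq> near E T k"
  by (rule lift_Suc_mono_le[of "near E T"]) (rule near_Suc_mono)

lemma near_Un: "near E (S \<union> T) k = near E S k \<union> near E T k"
  by (induction k) (auto simp: nbhd_Un)

lemma near_subset: "E \<subseteq> pairs_on V \<Longrightarrow> T \<subseteq> V \<Longrightarrow> near E T k \<subseteq> V"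
  by (cases k) (auto dest: nbhd_subset)

text \<open>The edges inspected by a breadth-first search that has expanded exactly the vertices of
  \<open>I\<close>.\<close>

definition meeting :: "'a set \<Rightarrow> 'a set set" where
  "meeting I = {e. e \<inter> I \<noteq> {}}"

lemma nbhd_cong_meeting:
  assumes "E \<inter> meeting I = E' \<inter> meeting I" "S \<subseteq> I"
  shows "nbhd E' S = nbhd E S"
proof -
  have "{x, w} \<in> E \<longleftrightarrow> {x, w} \<in> E'" if "x \<in> S" for x w
    using assms that unfolding meeting_def by blast
  then show ?thesis by (auto simp: nbhd_def)
qed

text \<open>The edges at the ball \<open>near E T k\<close> determine the ball one step larger,
  hence the index \<open>Suc k\<close>. This off-by-one keeps the edges from the outermost layer to
  the outside unexposed.\<close>

lemma near_cong_meeting: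
  assumes "E \<inter> meeting I = E' \<inter> meeting I" "near E T k \<subseteq> I" "j \<le> Suc k"
  shows "near E' T j = near E T j"
  using assms(3)
proof (induction j)
  case (Suc j)
  then have "near E T j \<subseteq> I" using near_mono[of j k E T] assms(2) by auto
  with Suc nbhd_cong_meeting[OF assms(1)] show ?case by simp
qed simp

lemma mem_near_Suc_iff: "w \<in> near E {u} (Suc k) \<longleftrightarrow> (\<exists>m\<le>k. (u, w) \<in> adj_rel E ^^ m)"
proof (induction k arbitrary: w)
  case 0
  show ?case by (auto simp: nbhd_def)
next
  case (Suc k)
  have "w \<in> near E {u} (Suc (Suc k)) \<longleftrightarrow> w = u \<or> (\<exists>x\<in>near E {u} (Suc k). {x, w} \<in> E)"
    by (simp add: nbhd_def)
  also have "(\<exists>x\<in>near E {u} (Suc k). {x, w} \<in> E) \<longleftrightarrow>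
             (\<exists>x. (\<exists>m\<le>k. (u, x) \<in> adj_rel E ^^ m) \<and> (x, w) \<in> adj_rel E)"
    by (simp only: Bex_def Suc.IH) (simp add: adj_rel_def)
  also have "\<dots> \<longleftrightarrow> (\<exists>m\<le>k. (u, w) \<in> adj_rel E ^^ Suc m)"
    by (simp only: relpow.simps relcomp_unfold) blast
  also have "(w = u \<or> (\<exists>m\<le>k. (u, w) \<in> adj_rel E ^^ Suc m)) \<longleftrightarrow> (\<exists>m\<le>Suc k. (u, w) \<in> adj_rel E ^^ m)"
  proof
    assume "w = u \<or> (\<exists>m\<le>k. (u, w) \<in> adj_rel E ^^ Suc m)"
    then show "\<exists>m\<le>Suc k. (u, w) \<in> adj_rel E ^^ m"
    proof
      assume "w = u"
      then have "(u, w) \<in> adj_rel E ^^ 0" by simp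
      then show ?thesis by blast
    next
      assume "\<exists>m\<le>k. (u, w) \<in> adj_rel E ^^ Suc m"
      then show ?thesis using Suc_le_mono by blast
    qed
  next
    assume "\<exists>m\<le>Suc k. (u, w) \<in> adj_rel E ^^ m"
    then obtain m where m: "m \<le> Suc k" "(u, w) \<in> adj_rel E ^^ m" by blast
    show "w = u \<or> (\<exists>m\<le>k. (u, w) \<in> adj_rel E ^^ Suc m)"
      by (cases m) (use m in \<open>auto simp del: relpow.simps(2)\<close>)
  qed
  finally show ?case .
qed

text \<open>Connectedness makes the \<open>LEAST\<close> in \<open>graph_dist\<close> range over a
  nonempty set of walk lengths.\<close>

lemma graph_dist_le_iff:
  assumes "graph_connected V E" "u \<in> V" "w \<in> V"
  shows "graph_dist E u w \<le> k \<longleftrightarrow> w \<in> near E {u} (Suc k)"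
proof -
  have "\<exists>m. (u, w) \<in> adj_rel E ^^ m"
    using assms unfolding graph_connected_def rtrancl_power by blast
  then have ex: "(u, w) \<in> adj_rel E ^^ graph_dist E u w"
    unfolding graph_dist_def by (rule LeastI_ex)
  show ?thesis
    unfolding mem_near_Suc_iff using ex by (auto simp: graph_dist_def intro: Least_le le_trans)
qed

text \<open>The edges that decide whether \<open>w\<close> has a neighbour in \<open>S\<close>. For
  different \<open>w\<close> outside \<open>S\<close> these sets are disjoint, which is the source
  of independence throughout.\<close>

definition star_edges :: "'a set \<Rightarrow> 'a \<Rightarrow> 'a set set" where
  "star_edges S w = (\<lambda>x. {x, w}) ` S"

lemma star_edges_subset: "S \<subseteq> V \<Longrightarrow> w \<in> V \<Longrightarrow> w \<notin> S \<Longrightarrow> star_edges S w \<subseteq> pairs_on V"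
  by (auto simp: star_edges_def pairs_on_def card_2_iff)

lemma card_star_edges: "card (star_edges S w) = card S"
  unfolding star_edges_def by (rule card_image) (auto simp: inj_on_def doubleton_eq_iff)

lemma disjoint_star_edges: "S \<inter> W = {} \<Longrightarrow> disjoint_family_on (star_edges S) W"
  by (auto simp: disjoint_family_on_def star_edges_def doubleton_eq_iff)

lemma mem_nbhd_iff_star: "w \<in> nbhd E S \<longleftrightarrow> E \<inter> star_edges S w \<noteq> {}"
  by (auto simp: nbhd_def star_edges_def)

lemma determined_by_star: "determined_by (star_edges S w) (\<lambda>E. w \<in> nbhd E S)"
  unfolding mem_nbhd_iff_star by (rule determined_byI) simp

lemma finite_pairs_on: "finite V \<Longrightarrow> finite (pairs_on V)"
  by (simp add: pairs_on_def)

lemma prob_mem_nbhd: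
  assumes "finite V" "S \<subseteq> V" "w \<in> V - S" "0 \<le> p" "p \<le> 1"
  shows "measure_pmf.prob (random_subset (pairs_on V) p) {E. w \<notin> nbhd E S} = (1 - p) ^ card S"
    and "measure_pmf.prob (random_subset (pairs_on V) p) {E. w \<in> nbhd E S} = 1 - (1 - p) ^ card S"
proof -
  let ?M = "random_subset (pairs_on V) p"
  show *: "measure_pmf.prob ?M {E. w \<notin> nbhd E S} = (1 - p) ^ card S"
    using prob_random_subset_avoid[OF finite_pairs_on, of V "star_edges S w" p] assms
    by (simp add: mem_nbhd_iff_star card_star_edges star_edges_subset)
  have "measure_pmf.prob ?M {E. w \<in> nbhd E S} = measure_pmf.prob ?M (space (measure_pmf ?M) - {E. w \<notin> nbhd E S})"
    by (rule arg_cong[where f = "measure_pmf.prob ?M"]) auto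
  also have "\<dots> = 1 - (1 - p) ^ card S"
    by (subst measure_pmf.prob_compl) (auto simp: *)
  finally show "measure_pmf.prob ?M {E. w \<in> nbhd E S} = 1 - (1 - p) ^ card S" .
qed

text \<open>\<open>A\<close> and \<open>B\<close> may overlap. Adjacency to \<open>A\<close> but not
  to \<open>B\<close> means no edge to \<open>B\<close> and some edge to \<open>A - B\<close>; these
  edge sets are disjoint, so the probabilities multiply, and the symmetric event excludes this
  one.\<close>

lemma prob_adjacent_exactly_one:
  assumes V: "finite V" and A: "A \<subseteq> V" and B: "B \<subseteq> V" and w: "w \<in> V - (A \<union> B)"
    and p: "0 \<le> p" "p \<le> 1"
  shows "measure_pmf.prob (random_subset (pairs_on V) p) {E. w \<in> nbhd E A \<longleftrightarrow> w \<notin> nbhd E B} =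
         (1 - (1 - p) ^ card (A - B)) * (1 - p) ^ card B + (1 - (1 - p) ^ card (B - A)) * (1 - p) ^ card A"
proof -
  let ?M = "random_subset (pairs_on V) p"
  have one: "measure_pmf.prob ?M {E. w \<notin> nbhd E B \<and> w \<in> nbhd E (A - B)} =
      (1 - p) ^ card B * (1 - (1 - p) ^ card (A - B))"
    if "A \<subseteq> V" "B \<subseteq> V" "w \<in> V - (A \<union> B)" for A B
  proof -
    have "measure_pmf.prob ?M {E. w \<notin> nbhd E B \<and> w \<in> nbhd E (A - B)} =
        measure_pmf.prob ?M {E. w \<notin> nbhd E B} * measure_pmf.prob ?M {E. w \<in> nbhd E (A - B)}"
    proof (rule prob_random_subset_inter[OF finite_pairs_on[OF V]])
      show "determined_by (star_edges B w) (\<lambda>E. w \<notin> nbhd E B)"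
        by (rule determined_by_compose[OF determined_by_star])
      show "determined_by (- star_edges B w) (\<lambda>E. w \<in> nbhd E (A - B))"
        by (rule determined_by_mono[OF determined_by_star])
           (auto simp: star_edges_def doubleton_eq_iff)
    qed
    then show ?thesis
      using prob_mem_nbhd(1)[OF V, of B w p] prob_mem_nbhd(2)[OF V, of "A - B" w p] that p by auto
  qed
  have "{E. w \<in> nbhd E A \<longleftrightarrow> w \<notin> nbhd E B} =
        {E. w \<notin> nbhd E B \<and> w \<in> nbhd E (A - B)} \<union> {E. w \<notin> nbhd E A \<and> w \<in> nbhd E (B - A)}"
    by (auto simp: nbhd_def)
  then have "measure_pmf.prob ?M {E. w \<in> nbhd E A \<longleftrightarrow> w \<notin> nbhd E B} =
        measure_pmf.prob ?M {E. w \<notin> nbhd E B \<and> w \<in> nbhd E (A - B)} +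
        measure_pmf.prob ?M {E. w \<notin> nbhd E A \<and> w \<in> nbhd E (B - A)}"
    by (simp only:) (rule measure_pmf.finite_measure_Union, auto simp: nbhd_def)
  then show ?thesis using one[OF A B w] one[OF B A] w by (simp add: mult.commute Un_commute)
qed

lemma independent_events_nbhd:
  assumes V: "finite V" and S: "S \<subseteq> V" and W: "W \<subseteq> V" "S \<inter> W = {}" and p: "0 \<le> p" "p \<le> 1"
  shows "independent_events (pairs_on V) p W (star_edges S) (\<lambda>w E. w \<in> nbhd E S) (1 - (1 - p) ^ card S)"
proof
  show "finite (pairs_on V)" "finite W" using V W finite_subset finite_pairs_on by auto
  show "determined_by (star_edges S w) (\<lambda>E. w \<in> nbhd E S)" for w
    by (rule determined_by_star)
  show "disjoint_family_on (star_edges S) W" using W by (intro disjoint_star_edges)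
  show "measure_pmf.prob (random_subset (pairs_on V) p) {E. w \<in> nbhd E S} = 1 - (1 - p) ^ card S"
    if "w \<in> W" for w using that W by (intro prob_mem_nbhd V S p) auto
qed

lemma independent_events_exactly_one:
  assumes V: "finite V" and A: "A \<subseteq> V" and B: "B \<subseteq> V" and W: "W \<subseteq> V" "(A \<union> B) \<inter> W = {}"
    and p: "0 \<le> p" "p \<le> 1"
  shows "independent_events (pairs_on V) p W (star_edges (A \<union> B))
    (\<lambda>w E. w \<in> nbhd E A \<longleftrightarrow> w \<notin> nbhd E B)
    ((1 - (1 - p) ^ card (A - B)) * (1 - p) ^ card B + (1 - (1 - p) ^ card (B - A)) * (1 - p) ^ card A)"
proof
  show "finite (pairs_on V)" "finite W" using V W finite_subset finite_pairs_on by auto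
  show "determined_by (star_edges (A \<union> B) w) (\<lambda>E. w \<in> nbhd E A \<longleftrightarrow> w \<notin> nbhd E B)" for w
  proof (rule determined_byI)
    fix E E' :: "'a set set" assume *: "E \<inter> star_edges (A \<union> B) w = E' \<inter> star_edges (A \<union> B) w"
    have "E \<inter> star_edges S w = E' \<inter> star_edges S w" if "S \<subseteq> A \<union> B" for S
    proof -
      have "star_edges S w \<subseteq> star_edges (A \<union> B) w" using that by (auto simp: star_edges_def)
      then show ?thesis using * by blast
    qed
    then show "(w \<in> nbhd E A \<longleftrightarrow> w \<notin> nbhd E B) = (w \<in> nbhd E' A \<longleftrightarrow> w \<notin> nbhd E' B)"
      by (simp add: mem_nbhd_iff_star)
  qed
  show "disjoint_family_on (star_edges (A \<union> B)) W" using W by (intro disjoint_star_edges)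
qed (use W in \<open>intro prob_adjacent_exactly_one V A B p, auto\<close>)

text \<open>Vertices before the last layer have all their neighbours in the current ball already, so
  the new layer depends only on edges leaving the last layer.\<close>

lemma near_Suc_Suc_diff:
  assumes "E \<subseteq> pairs_on V"
  shows "near E T (Suc (Suc k)) - near E T (Suc k) =
         {w \<in> V - near E T (Suc k). w \<in> nbhd E (near E T (Suc k) - near E T k)}"
proof -
  have "near E T (Suc k) = (near E T (Suc k) - near E T k) \<union> near E T k"
    using near_Suc_mono[of E T k] by auto
  then have "near E T (Suc (Suc k)) = T \<union> nbhd E (near E T (Suc k) - near E T k) \<union> nbhd E (near E T k)"
    by (metis near.simps(2) nbhd_Un Un_assoc)
  then show ?thesis using nbhd_subset[OF assms] by auto
qed

section \<open>Growth of the layers\<close>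

lemma one_minus_power_le: "0 \<le> p \<Longrightarrow> p \<le> 1 \<Longrightarrow> 1 - (1 - p) ^ s \<le> real s * (p :: real)"
  using Bernoulli_inequality[of "- p" s] by simp

lemma one_minus_power_ge:
  fixes p :: real assumes "0 \<le> p" "p \<le> 1"
  shows "real s * p * (1 - real s * p) \<le> 1 - (1 - p) ^ s"
proof -
  have "(1 - p) ^ s \<le> exp (- p) ^ s"
    by (rule power_mono) (use assms exp_ge_add_one_self[of "- p"] in auto)
  also have "\<dots> = exp (- (real s * p))" by (simp add: exp_of_nat_mult[symmetric])
  also have "\<dots> \<le> 1 - real s * p + (real s * p)\<^sup>2 / 2"
    by (rule exp_minus_le_quadratic) (use assms in auto)
  also have "\<dots> \<le> 1 - real s * p + (real s * p)\<^sup>2" by simp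
  finally show ?thesis by (simp add: power2_eq_square algebra_simps)
qed

text \<open>Real arithmetic of one growth step: \<open>D\<close> stands for \<open>d ^ j\<close>,
  \<open>s\<close> for the size of the current layer, \<open>N\<close> for that of the ball,
  \<open>s'\<close> for that of the next layer, and \<open>t\<close> for the number of start
  vertices. The deviation is a multiple of \<open>2 * d * s\<close>, which bounds the mean of
  \<open>s'\<close>.\<close>

lemma growth_step_numeric:
  fixes n d p D t \<delta> e s N s' :: real and k :: nat
  assumes n: "2 \<le> n" and p: "0 \<le> p" "p \<le> 1" and d: "d = p * (n - 1)" "4 \<le> d"
    and D: "1 \<le> D" and t: "1 \<le> t" "t \<le> 2" and \<delta>: "0 \<le> \<delta>" "\<delta> \<le> 1 / 2"
    and s: "s = real k" "(1 - \<delta>) * (t * D) \<le> s" "s \<le> (1 + \<delta>) * (t * D)"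
    and N: "0 \<le> N" "N \<le> n" "N \<le> 4 * (t * D)" and e: "0 \<le> e"
    and s': "0 \<le> s'"
    and lower: "(n - N) * (1 - (1 - p) ^ k) - e * (2 * d * s) \<le> s'"
    and upper: "s' \<le> (n - N) * (1 - (1 - p) ^ k) + e * (2 * d * s)"
  shows "(1 - (\<delta> + 4 * e + 16 * (D * d) / n)) * (t * (D * d)) \<le> s'"
    and "s' \<le> (1 + (\<delta> + 4 * e + 16 * (D * d) / n)) * (t * (D * d))"
proof -
  \<comment> \<open>Relative error of this step against \<open>d * s\<close>: \<open>2 * e\<close>
    from the deviation, and 6 + 2 = 8 multiples of \<open>D * d / n\<close> from
    \<open>s * p\<close> and \<open>N / n\<close>. Since \<delta> \<le> 1, combining it with the old
    error \<delta> costs at most \<open>\<delta> + 2 * e'\<close>.\<close>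
  define e' where "e' = 2 * e + 8 * (D * d) / n"
  have e': "0 \<le> e'" using e D d n by (auto simp: e'_def)
  have s0: "0 \<le> s" using s by simp
  have r_le: "1 - (1 - p) ^ k \<le> s * p" using one_minus_power_le[OF p, of k] s by simp
  have r_ge: "s * p * (1 - s * p) \<le> 1 - (1 - p) ^ k" using one_minus_power_ge[OF p, of k] s by simp
  have r0: "0 \<le> 1 - (1 - p) ^ k" using p by (simp add: power_le_one)
  have np: "d \<le> n * p" using d p by (simp add: algebra_simps)
  have np': "n * p \<le> d * (1 + 2 / n)"
  proof -
    have "d * (1 + 2 / n) - n * p = p * (1 - 2 / n)"
      using n by (simp add: d field_simps)
    moreover have "0 \<le> p * (1 - 2 / n)" using p n by (intro mult_nonneg_nonneg) (auto simp: field_simps)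
    ultimately show ?thesis by linarith
  qed
  have p_le: "p \<le> 2 * d / n"
  proof -
    have "n * p \<le> 2 * d" using n p mult_left_mono[of 2 n p] by (simp add: d algebra_simps)
    then show ?thesis using n by (simp add: field_simps)
  qed
  have "s \<le> (3 / 2) * (2 * D)"
  proof -
    have "(1 + \<delta>) * (t * D) \<le> (3 / 2) * (2 * D)"
      by (intro mult_mono) (use \<delta> t D in auto)
    then show ?thesis using s by linarith
  qed
  then have "s * p \<le> (3 / 2) * (2 * D) * (2 * d / n)"
    by (intro mult_mono p_le) (use D p s0 in auto)
  then have sp: "s * p \<le> 6 * (D * d) / n" by simp
  have Nn: "N / n \<le> 2 * (D * d) / n"
  proof -
    have "t * D \<le> 2 * D" using t D by (intro mult_right_mono) auto
    then have "N \<le> 8 * D" using N by linarith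
    also have "\<dots> \<le> 2 * (D * d)" using d D by simp
    finally show ?thesis using n by (intro divide_right_mono) auto
  qed
  have "2 / n \<le> 8 * (D * d) / n"
  proof -
    have "1 * 1 \<le> D * d" using D d by (intro mult_mono) auto
    then show ?thesis using n by (intro divide_right_mono) auto
  qed
  then have up: "s' \<le> (1 + e') * (d * s)"
  proof -
    have "(n - N) * (1 - (1 - p) ^ k) \<le> n * (s * p)"
      by (intro mult_mono r_le) (use N n p r0 s0 in auto)
    also have "\<dots> = s * (n * p)" by simp
    also have "\<dots> \<le> s * (d * (1 + 2 / n))" by (intro mult_left_mono np' s0)
    finally have "s' \<le> (1 + (2 / n + 2 * e)) * (d * s)" using upper by (simp add: algebra_simps)
    also have "\<dots> \<le> (1 + e') * (d * s)"
      using \<open>2 / n \<le> _\<close> d s0 by (intro mult_right_mono) (auto simp: e'_def)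
    finally show ?thesis .
  qed
  have lo: "(1 - e') * (d * s) \<le> s'"
  proof -
    have "(1 - N / n - s * p) * (d * s) \<le> (n - N) * (1 - (1 - p) ^ k)"
    \<comment> \<open>Replacing \<open>d\<close> by \<open>n * p\<close> needs a nonnegative factor
      \<open>1 - s * p\<close>; if it is negative, the left-hand side is at most 0 anyway.\<close>
    proof (cases "s * p \<le> 1")
      case True
      have "1 - N / n - s * p \<le> (1 - N / n) * (1 - s * p)"
        using N n p s0 by (simp add: algebra_simps)
      then have "(1 - N / n - s * p) * (d * s) \<le> (1 - N / n) * (1 - s * p) * (d * s)"
        by (rule mult_right_mono) (use d s0 in auto)
      also have "\<dots> \<le> (1 - N / n) * (1 - s * p) * (n * p * s)"
        by (intro mult_left_mono mult_right_mono np mult_nonneg_nonneg) (use True N n s0 in auto)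
      also have "\<dots> = (n - N) * (s * p * (1 - s * p))" using n by (simp add: field_simps)
      also have "\<dots> \<le> (n - N) * (1 - (1 - p) ^ k)" by (intro mult_left_mono r_ge) (use N in auto)
      finally show ?thesis .
    next
      case False
      have "0 \<le> N / n" using N n by simp
      then have "(1 - N / n - s * p) * (d * s) \<le> 0"
        using False d s0 by (intro mult_nonpos_nonneg) auto
      also have "0 \<le> (n - N) * (1 - (1 - p) ^ k)" using N r0 by simp
      finally show ?thesis .
    qed
    then have "(1 - (N / n + s * p + 2 * e)) * (d * s) \<le> s'" using lower by (simp add: algebra_simps)
    moreover have "(1 - e') * (d * s) \<le> (1 - (N / n + s * p + 2 * e)) * (d * s)"
      using Nn sp d s0 by (intro mult_right_mono) (auto simp: e'_def)
    ultimately show ?thesis by linarith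
  qed
  have tDd: "0 \<le> t * (D * d)" using t D d by simp
  have "(1 + e') * (d * s) \<le> (1 + e') * (d * ((1 + \<delta>) * (t * D)))"
    using s e' d by (intro mult_left_mono) auto
  also have "\<dots> = (1 + \<delta> + e' + e' * \<delta>) * (t * (D * d))" by (simp add: algebra_simps)
  also have "\<dots> \<le> (1 + \<delta> + e' + e' * 1) * (t * (D * d))"
    by (intro mult_right_mono add_left_mono mult_left_mono) (use \<delta> e' tDd in auto)
  finally show "s' \<le> (1 + (\<delta> + 4 * e + 16 * (D * d) / n)) * (t * (D * d))"
    using up by (simp add: e'_def algebra_simps)
  show "(1 - (\<delta> + 4 * e + 16 * (D * d) / n)) * (t * (D * d)) \<le> s'"
  proof (cases "e' \<le> 1")
    case True
    have "(1 - (\<delta> + 4 * e + 16 * (D * d) / n)) * (t * (D * d)) \<le> ((1 - e') * (1 - \<delta>)) * (t * (D * d))"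
    proof (rule mult_right_mono[OF _ tDd])
      have "\<delta> + 4 * e + 16 * (D * d) / n = \<delta> + 2 * e'" by (simp add: e'_def)
      then show "1 - (\<delta> + 4 * e + 16 * (D * d) / n) \<le> (1 - e') * (1 - \<delta>)"
        using e' \<delta> mult_nonneg_nonneg[of e' \<delta>] by (simp only:) (simp add: algebra_simps)
    qed
    also have "\<dots> = (1 - e') * (d * ((1 - \<delta>) * (t * D)))" by (simp add: algebra_simps)
    also have "\<dots> \<le> (1 - e') * (d * s)"
      using s True d by (intro mult_left_mono) auto
    finally show ?thesis using lo by linarith
  next
    case False
    have "2 * e' = 4 * e + 16 * (D * d) / n" by (simp add: e'_def)
    with False \<delta> have "(1 - (\<delta> + 4 * e + 16 * (D * d) / n)) * (t * (D * d)) \<le> 0"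
      by (intro mult_nonpos_nonneg tDd) auto
    with s' show ?thesis by linarith
  qed
qed

text \<open>Applied with \<open>I = near E T j\<close> and \<open>N = near E T (Suc j)\<close>, so that \<open>N - I\<close> is the \<open>j\<close>-th layer.\<close>

definition growth_ok :: "'a set \<Rightarrow> real \<Rightarrow> real \<Rightarrow> real \<Rightarrow> nat \<Rightarrow> 'a set \<times> 'a set \<Rightarrow> bool" where
  "growth_ok V d t \<delta> j = (\<lambda>(I, N). I \<subseteq> N \<and> N \<subseteq> V \<and>
     (1 - \<delta>) * (t * d ^ j) \<le> real (card (N - I)) \<and> real (card (N - I)) \<le> (1 + \<delta>) * (t * d ^ j) \<and>
     real (card N) \<le> 4 * (t * d ^ j))"

text \<open>Once the edges meeting \<open>near E T j\<close> are exposed, the next layer counts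
  outside vertices hit by fresh edges from the current layer, so both Chernoff bounds apply to its
  size.\<close>

lemma prob_growth_step:
  fixes p d t \<delta> \<delta>' e :: real and j :: nat
  assumes \<delta>'_def: "\<delta>' = \<delta> + 4 * e + 16 * d ^ Suc j / real (card V)"
    and V: "finite V" "2 \<le> card V" and p: "0 \<le> p" "p \<le> 1" and d: "d = p * (real (card V) - 1)" "4 \<le> d"
    and t: "1 \<le> t" "t \<le> 2" and \<delta>: "0 \<le> \<delta>" "\<delta> \<le> 1 / 2" and e: "0 \<le> e" "e \<le> 2" and T: "T \<subseteq> V"
    and \<delta>': "\<delta>' \<le> 1"
  shows "measure_pmf.prob (random_subset (pairs_on V) p)
     {E. growth_ok V d t \<delta> j (near E T j, near E T (Suc j)) \<and>
         \<not> growth_ok V d t \<delta>' (Suc j) (near E T (Suc j), near E T (Suc (Suc j)))}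
     \<le> 2 * exp (- (e\<^sup>2 * d ^ Suc j / 4))"
proof -
  let ?M = "random_subset (pairs_on V) p" and ?n = "real (card V)"
  define \<mu> where "\<mu> = (\<lambda>(I, N). (?n - real (card N)) * (1 - (1 - p) ^ card (N - I :: 'a set)))"
  define s where "s = (\<lambda>(I :: 'a set, N :: 'a set). real (card (N - I)))"
  define occ where "occ = (\<lambda>(I :: 'a set, N) E. real (card {w \<in> V - N. w \<in> nbhd E (N - I)}))"
  define B where "B = (\<lambda>h E. occ h E < \<mu> h - e * (2 * d * s h) \<or> \<mu> h + e * (2 * d * s h) < occ h E)"
  define X where "X = (\<lambda>E. (near E T j, near E T (Suc j)))"
  define G where "G = {h. growth_ok V d t \<delta> j h}"
  have Dj: "1 \<le> d ^ j" using d by simp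
  have "measure_pmf.prob ?M {E. growth_ok V d t \<delta> j (near E T j, near E T (Suc j)) \<and>
         \<not> growth_ok V d t \<delta>' (Suc j) (near E T (Suc j), near E T (Suc (Suc j)))}
     \<le> measure_pmf.prob ?M {E. X E \<in> G \<and> B (X E) E}"
  proof (rule measure_pmf.finite_measure_mono_AE)
    show "AE E in measure_pmf ?M. E \<in> {E. growth_ok V d t \<delta> j (near E T j, near E T (Suc j)) \<and>
         \<not> growth_ok V d t \<delta>' (Suc j) (near E T (Suc j), near E T (Suc (Suc j)))} \<longrightarrow>
         E \<in> {E. X E \<in> G \<and> B (X E) E}"
    proof (rule AE_pmfI, rule impI)
      fix E assume "E \<in> set_pmf ?M" and bad: "E \<in> {E. growth_ok V d t \<delta> j (near E T j, near E T (Suc j)) \<and>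
         \<not> growth_ok V d t \<delta>' (Suc j) (near E T (Suc j), near E T (Suc (Suc j)))}"
      then have E: "E \<subseteq> pairs_on V" using set_random_subset by fast
      define I where "I = near E T j"
      define N where "N = near E T (Suc j)"
      define N' where "N' = near E T (Suc (Suc j))"
      have ok: "growth_ok V d t \<delta> j (I, N)" and nok: "\<not> growth_ok V d t \<delta>' (Suc j) (N, N')"
        using bad by (auto simp: I_def N_def N'_def simp del: near.simps)
      have NV: "N \<subseteq> V" "N' \<subseteq> V" "N \<subseteq> N'"
        unfolding N_def N'_def by (rule near_subset[OF E T] near_Suc_mono)+
      have fresh: "N' - N = {w \<in> V - N. w \<in> nbhd E (N - I)}"
        unfolding N'_def N_def I_def by (rule near_Suc_Suc_diff[OF E])
      have "B (I, N) E"
      proof (rule ccontr)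
        assume "\<not> B (I, N) E"
        then have lo: "(?n - real (card N)) * (1 - (1 - p) ^ card (N - I)) - e * (2 * d * real (card (N - I)))
              \<le> real (card (N' - N))"
          and up: "real (card (N' - N)) \<le>
             (?n - real (card N)) * (1 - (1 - p) ^ card (N - I)) + e * (2 * d * real (card (N - I)))"
          by (auto simp: B_def \<mu>_def s_def occ_def fresh)
        have cN: "real (card N) \<le> ?n" using NV V by (simp add: card_mono)
        note step = growth_step_numeric[where n = ?n and D = "d ^ j" and k = "card (N - I)" and N = "real (card N)"
            and s' = "real (card (N' - N))" and e = e and \<delta> = \<delta> and t = t, OF _ p d Dj t \<delta> refl _ _ _ cN _ e(1) _ lo up]
        define y where "y = t * d ^ Suc j"
        have "card N' \<le> card N + card (N' - N)"
          using NV V by (metis card_Un_le Un_Diff_cancel Un_absorb1)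
        then have "real (card N') \<le> real (card N) + real (card (N' - N))" by linarith
        moreover have "real (card N) \<le> 4 * (t * d ^ j)" using ok by (simp add: growth_ok_def)
        \<comment> \<open>From d >= 4: the old ball costs at most \<open>y\<close>, the new layer at
          most \<open>2 * y\<close>, so the constant 4 in the bound on the ball reproduces
          itself.\<close>
        moreover have "4 * (t * d ^ j) \<le> y"
          using d t Dj by (simp add: mult_ac y_def)
        moreover have "real (card (N' - N)) \<le> 2 * y"
        proof -
          have "real (card (N' - N)) \<le> (1 + \<delta>') * (t * d ^ Suc j)"
            using step(2) ok V by (simp add: growth_ok_def \<delta>'_def mult_ac)
          also have "\<dots> \<le> (1 + 1) * (t * d ^ Suc j)"
            by (intro mult_right_mono) (use \<delta>' t d in auto)
          finally show ?thesis by (simp add: y_def)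
        qed
        moreover have "0 \<le> y" using d t by (simp add: y_def)
        ultimately have "real (card N') \<le> 4 * y" by linarith
        then have "growth_ok V d t \<delta>' (Suc j) (N, N')"
          using step ok V NV by (simp add: growth_ok_def \<delta>'_def y_def mult_ac)
        then show False using nok by simp
      qed
      then show "E \<in> {E. X E \<in> G \<and> B (X E) E}"
        using ok by (simp add: X_def G_def I_def N_def del: near.simps)
    qed
  qed auto
  \<comment> \<open>The exposed edges are those meeting \<open>I\<close>; the stars from
    \<open>N - I\<close> to vertices outside \<open>N\<close> avoid them.\<close>
  also have "\<dots> \<le> 2 * exp (- (e\<^sup>2 * d ^ Suc j / 4))"
  proof (rule prob_random_subset_exposed[where K = "\<lambda>h. meeting (fst h)"])
    show "finite (pairs_on V)" using V by (intro finite_pairs_on)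
    show "X E' = X E" if "E \<inter> meeting (fst (X E)) = E' \<inter> meeting (fst (X E))" for E E'
    proof -
      have "near E' T k = near E T k" if "k \<le> Suc j" for k
        by (rule near_cong_meeting[OF \<open>E \<inter> _ = E' \<inter> _\<close> _ that]) (simp add: X_def)
      then show ?thesis by (simp add: X_def del: near.simps)
    qed
  next
    fix h assume "h \<in> G"
    moreover obtain I N where h: "h = (I, N)" by (cases h)
    ultimately have ok: "I \<subseteq> N" "N \<subseteq> V" "(1 - \<delta>) * (t * d ^ j) \<le> real (card (N - I))"
      by (auto simp: G_def growth_ok_def)
    show "determined_by (- meeting (fst h)) (B h)"
    proof (rule determined_byI)
      fix E E' :: "'a set set"
      assume *: "E \<inter> - meeting (fst h) = E' \<inter> - meeting (fst h)"
      have "w \<in> nbhd E (N - I) \<longleftrightarrow> w \<in> nbhd E' (N - I)" if "w \<in> V - N" for w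
      proof -
        have "star_edges (N - I) w \<subseteq> - meeting (fst h)"
          using ok that by (auto simp: star_edges_def meeting_def h)
        then have "E \<inter> star_edges (N - I) w = E' \<inter> star_edges (N - I) w" using * by blast
        then show ?thesis by (simp add: mem_nbhd_iff_star)
      qed
      then have "{w \<in> V - N. w \<in> nbhd E (N - I)} = {w \<in> V - N. w \<in> nbhd E' (N - I)}" by auto
      then show "B h E = B h E'" by (simp add: B_def occ_def h)
    qed
    interpret independent_events "pairs_on V" p "V - N" "star_edges (N - I)" "\<lambda>w E. w \<in> nbhd E (N - I)"
        "1 - (1 - p) ^ card (N - I)"
      by (rule independent_events_nbhd) (use V ok p in auto)
    have cW: "real (card (V - N)) = ?n - real (card N)"
      using ok V by (subst card_Diff_subset) (auto simp: card_mono finite_subset of_nat_diff)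
    have \<mu>: "real (card (V - N)) * (1 - (1 - p) ^ card (N - I)) = \<mu> h" by (simp add: \<mu>_def h cW)
    have occ: "occ h E = real (occurring E)" for E by (simp add: occ_def occurring_def h)
    have M: "\<mu> h \<le> 2 * d * s h"
    proof -
      have "\<mu> h \<le> ?n * (s h * p)"
        unfolding \<mu>_def h s_def prod.case
        by (intro mult_mono one_minus_power_le) (use p in \<open>auto simp: power_le_one\<close>)
      also have "\<dots> = s h * (?n * p)" by simp
      also have "\<dots> \<le> s h * (2 * d)"
        using V p mult_left_mono[of 2 ?n p] by (intro mult_left_mono) (auto simp: s_def h d algebra_simps)
      finally show ?thesis by (simp add: mult_ac)
    qed
    \<comment> \<open>As \<delta> \<le> 1/2 and t >= 1, the layer has at least
      \<open>d ^ j / 2\<close> vertices, which makes the failure bound independent of the exposed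
      history.\<close>
    have s_ge: "d ^ Suc j \<le> 2 * d * s h"
    proof -
      have "(1 / 2) * (1 * d ^ j) \<le> (1 - \<delta>) * (t * d ^ j)"
        by (intro mult_mono) (use \<delta> t d in auto)
      then have "d ^ j \<le> 2 * s h" using ok by (simp add: s_def h)
      then have "d * d ^ j \<le> d * (2 * s h)" by (rule mult_left_mono) (use d(2) in auto)
      then show ?thesis by (simp add: mult_ac)
    qed
    have "measure_pmf.prob ?M {E. B h E} \<le>
        measure_pmf.prob ?M ({E. real (occurring E) \<le> \<mu> h - e * (2 * d * s h)} \<union>
          {E. \<mu> h + e * (2 * d * s h) \<le> real (occurring E)})"
      by (rule measure_pmf.finite_measure_mono) (auto simp: B_def occ)
    also have "\<dots> \<le> measure_pmf.prob ?M {E. real (occurring E) \<le> \<mu> h - e * (2 * d * s h)} +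
        measure_pmf.prob ?M {E. \<mu> h + e * (2 * d * s h) \<le> real (occurring E)}"
      by (rule measure_Un_le) auto
    also have "\<dots> \<le> exp (- (e\<^sup>2 * (2 * d * s h) / 2)) + exp (- (e\<^sup>2 * (2 * d * s h) / 4))"
      using chernoff_lower[of "2 * d * s h" e] chernoff_upper[of "2 * d * s h" e] M e unfolding \<mu>
      by (intro add_mono) auto
    also have "\<dots> \<le> exp (- (e\<^sup>2 * d ^ Suc j / 4)) + exp (- (e\<^sup>2 * d ^ Suc j / 4))"
    proof -
      define x where "x = e\<^sup>2 * d ^ Suc j"
      define y where "y = e\<^sup>2 * (2 * d * s h)"
      have "x \<le> y" unfolding x_def y_def by (intro mult_left_mono s_ge) auto
      moreover have "0 \<le> x" using d by (simp add: x_def)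
      ultimately have "exp (- (y / 2)) + exp (- (y / 4)) \<le> exp (- (x / 4)) + exp (- (x / 4))"
        by (intro add_mono) simp_all
      then show ?thesis by (simp only: x_def y_def)
    qed
    finally show "measure_pmf.prob ?M {E. B h E} \<le> 2 * exp (- (e\<^sup>2 * d ^ Suc j / 4))" by simp
  qed auto
  finally show ?thesis .
qed

lemma growth_ok_mono:
  assumes "growth_ok V d t \<delta> j h" "\<delta> \<le> \<delta>'" "0 \<le> d" "0 \<le> t"
  shows "growth_ok V d t \<delta>' j h"
proof -
  have "(1 - \<delta>') * (t * d ^ j) \<le> (1 - \<delta>) * (t * d ^ j)" "(1 + \<delta>) * (t * d ^ j) \<le> (1 + \<delta>') * (t * d ^ j)"
    using assms by (auto intro!: mult_right_mono)
  then show ?thesis using assms(1) by (fastforce simp: growth_ok_def)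
qed

text \<open>Origin of the two 32s: the deviations \<open>\<alpha> / 2 ^ j\<close> enter with a
  factor 4 and sum to at most 8 \<alpha>, which is \<open>32 * sqrt (ln n / d)\<close>; the terms
  \<open>16 * d ^ Suc j / n\<close> are dominated by twice the last one because d >= 2.\<close>

lemma prob_growth:
  fixes p d :: real and i :: nat
  assumes \<delta>: "\<delta> = 32 * sqrt (ln (real (card V)) / d) + 32 * d ^ i / real (card V)" "\<delta> \<le> 1 / 2"
    and V: "finite V" "2 \<le> card V" and p: "0 \<le> p" "p \<le> 1" and d: "d = p * (real (card V) - 1)" "4 \<le> d"
    and T: "T \<subseteq> V" "1 \<le> card T" "card T \<le> 2"
  shows "measure_pmf.prob (random_subset (pairs_on V) p)
     {E. \<not> growth_ok V d (real (card T)) \<delta> i (near E T i, near E T (Suc i))}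
     \<le> 2 * real i / real (card V) ^ 4"
proof -
  let ?M = "random_subset (pairs_on V) p" and ?n = "real (card V)" and ?t = "real (card T)"
  \<comment> \<open>The factor 4 makes the exponent in step \<open>j\<close> equal to
    \<open>4 * ln n * (d / 4) ^ j\<close>. A failure probability of order n^-4 survives at most n
    steps and n^2 pairs.\<close>
  define \<alpha> where "\<alpha> = 4 * sqrt (ln ?n / d)"
  \<comment> \<open>The deviation allowed in step \<open>j\<close> is \<open>\<alpha> / 2 ^ j\<close>: as the layers grow by a factor \<open>d \<ge> 4\<close>,
    the failure probability stays below \<open>1 / n ^ 4\<close>, and the errors add up to a geometric series.\<close>
  define D where "D = (\<lambda>j. 8 * \<alpha> * (1 - 1 / 2 ^ j) + 32 * d ^ j / ?n)"
  have ln0: "0 \<le> ln ?n / d" using V d by simp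
  have \<alpha>0: "0 \<le> \<alpha>" using ln0 by (simp add: \<alpha>_def)
  have D0: "0 \<le> D j" for j
    unfolding D_def using \<alpha>0 d by (intro add_nonneg_nonneg mult_nonneg_nonneg) auto
  have D_le: "D j \<le> \<delta>" if "j \<le> i" for j
  proof -
    have "8 * \<alpha> * (1 - 1 / 2 ^ j) \<le> 8 * \<alpha> * 1" using \<alpha>0 by (intro mult_left_mono) auto
    moreover have "32 * d ^ j / ?n \<le> 32 * d ^ i / ?n"
      using that d V by (intro divide_right_mono mult_left_mono power_increasing) auto
    ultimately show ?thesis by (simp add: D_def \<delta> \<alpha>_def)
  qed
  have \<alpha>2: "\<alpha> \<le> 1"
  proof -
    have "0 \<le> 32 * d ^ i / ?n" using d by simp
    then show ?thesis using \<delta> by (simp add: \<alpha>_def)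
  qed
  have D_step: "D j + 4 * (\<alpha> / 2 ^ j) + 16 * d ^ Suc j / ?n \<le> D (Suc j)" for j
  proof -
    have "2 * d ^ j \<le> d ^ Suc j" using d by simp
    then have "(32 * d ^ j + 16 * d ^ Suc j) / ?n \<le> 32 * d ^ Suc j / ?n"
      by (intro divide_right_mono) (linarith, simp)
    then have "32 * d ^ j / ?n + 16 * d ^ Suc j / ?n \<le> 32 * d ^ Suc j / ?n" by (simp only: add_divide_distrib)
    then show ?thesis by (simp add: D_def algebra_simps)
  qed
  have "measure_pmf.prob ?M {E. \<not> growth_ok V d ?t (D j) j (near E T j, near E T (Suc j))} \<le> 2 * real j / ?n ^ 4"
    if "j \<le> i" for j
    using that
  proof (induction j)
    case 0
    have "growth_ok V d ?t (D 0) 0 (near E T 0, near E T (Suc 0))" for E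
      using T V D0[of 0] by (auto simp: growth_ok_def nbhd_def mult_le_cancel_right2 mult_le_cancel_right1)
    then show ?case by simp
  next
    case (Suc j)
    let ?ok = "\<lambda>\<delta> j E. growth_ok V d ?t \<delta> j (near E T j, near E T (Suc j))"
    let ?\<delta>' = "D j + 4 * (\<alpha> / 2 ^ j) + 16 * d ^ Suc j / ?n"
    have "\<alpha> / 2 ^ j \<le> \<alpha> / 1" using \<alpha>0 by (intro divide_left_mono) auto
    then have e: "0 \<le> \<alpha> / 2 ^ j" "\<alpha> / 2 ^ j \<le> 2" using \<alpha>0 \<alpha>2 by auto
    have \<delta>'1: "?\<delta>' \<le> 1" using D_step[of j] D_le[of "Suc j"] Suc.prems \<delta> by linarith
    have "measure_pmf.prob ?M {E. \<not> ?ok (D (Suc j)) (Suc j) E} \<le>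
          measure_pmf.prob ?M ({E. \<not> ?ok (D j) j E} \<union> {E. ?ok (D j) j E \<and> \<not> ?ok ?\<delta>' (Suc j) E})"
      by (rule measure_pmf.finite_measure_mono) (use growth_ok_mono D_step[of j] d in fastforce)+
    also have "\<dots> \<le> measure_pmf.prob ?M {E. \<not> ?ok (D j) j E} +
          measure_pmf.prob ?M {E. ?ok (D j) j E \<and> \<not> ?ok ?\<delta>' (Suc j) E}"
      by (rule measure_Un_le) auto
    also have "\<dots> \<le> 2 * real j / ?n ^ 4 + 2 * exp (- ((\<alpha> / 2 ^ j)\<^sup>2 * d ^ Suc j / 4))"
      using Suc D_le[of j] \<delta> T
      by (intro add_mono prob_growth_step refl V p d D0 e \<delta>'1 Suc.IH) auto
    also have "\<dots> \<le> 2 * real j / ?n ^ 4 + 2 * (1 / ?n ^ 4)"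
    proof -
      have "(\<alpha> / 2 ^ j)\<^sup>2 * d ^ Suc j / 4 = 4 * ln ?n * (d / 4) ^ j"
        using ln0 d by (simp add: \<alpha>_def power_divide power_mult_distrib power2_eq_square[of "2 ^ j"]
            power_mult_distrib[symmetric] field_simps)
      moreover have "4 * ln ?n * 1 \<le> 4 * ln ?n * (d / 4) ^ j"
        using V d by (intro mult_left_mono one_le_power) auto
      ultimately have "exp (- ((\<alpha> / 2 ^ j)\<^sup>2 * d ^ Suc j / 4)) \<le> exp (- (4 * ln ?n))" by simp
      also have "\<dots> = 1 / ?n ^ 4"
        using V by (simp add: exp_minus exp_of_nat_mult[of 4, simplified] inverse_eq_divide)
      finally show ?thesis by simp
    qed
    finally show ?case by (simp add: add_divide_distrib)
  qed
  from this[of i] have "measure_pmf.prob ?M {E. \<not> growth_ok V d ?t (D i) i (near E T i, near E T (Suc i))}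
     \<le> 2 * real i / ?n ^ 4" by simp
  moreover have "measure_pmf.prob ?M {E. \<not> growth_ok V d ?t \<delta> i (near E T i, near E T (Suc i))} \<le>
      measure_pmf.prob ?M {E. \<not> growth_ok V d ?t (D i) i (near E T i, near E T (Suc i))}"
    using growth_ok_mono[OF _ D_le[OF order_refl], of V d ?t i] \<open>4 \<le> d\<close>
    by (intro measure_pmf.finite_measure_mono) (auto simp del: near.simps)
  ultimately show ?thesis by linarith
qed

section \<open>Separating vertices of a pair\<close>

text \<open>\<open>near\<close> is strict, so these are the balls of radius \<open>i\<close> and
  \<open>i + 1\<close>. Comparing balls instead of distances keeps the notion meaningful for
  disconnected outcomes; in a connected graph every such vertex has different distances to
  \<open>u\<close> and \<open>v\<close>.\<close>

definition separating :: "'a set \<Rightarrow> 'a set set \<Rightarrow> nat \<Rightarrow> 'a \<Rightarrow> 'a \<Rightarrow> 'a set" where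
  "separating V E i u v = {w \<in> V. \<exists>k\<in>{Suc i, Suc (Suc i)}. (w \<in> near E {u} k) \<noteq> (w \<in> near E {v} k)}"

definition exactly_one_prob :: "real \<Rightarrow> 'a set \<Rightarrow> 'a set \<Rightarrow> real" where
  "exactly_one_prob p A B =
     (1 - (1 - p) ^ card (A - B)) * (1 - p) ^ card B + (1 - (1 - p) ^ card (B - A)) * (1 - p) ^ card A"

text \<open>
  The expected number of vertices separating two vertices whose neighbourhoods \<open>A\<close>, \<open>B\<close> up to
  distance \<open>i\<close> are known, together with all edges meeting the set \<open>I\<close> of vertices at distance
  less than \<open>i\<close>.
\<close>

definition expected_separating :: "'a set \<Rightarrow> real \<Rightarrow> 'a set \<times> 'a set \<times> 'a set \<Rightarrow> real" where
  "expected_separating V p = (\<lambda>(I, A, B). real (card (A - B - I)) + real (card (B - A - I)) +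
     real (card (V - (A \<union> B))) * exactly_one_prob p (A - I) (B - I))"

text \<open>The first component is the expanded set: the edges meeting it determine all three
  components, and only those edges count as exposed.\<close>

definition exposure :: "'a set set \<Rightarrow> nat \<Rightarrow> 'a \<Rightarrow> 'a \<Rightarrow> 'a set \<times> 'a set \<times> 'a set" where
  "exposure E i u v = (near E {u, v} i, near E {u} (Suc i), near E {v} (Suc i))"

lemma near_pair: "near E {u, v} k = near E {u} k \<union> near E {v} k"
  using near_Un[of E "{u}" "{v}" k] by (simp add: insert_commute)

text \<open>The first two sets separate at radius \<open>i\<close>, the third at radius
  \<open>i + 1\<close>. For \<open>w\<close> outside \<open>A \<union> B\<close>, adjacency to
  \<open>A\<close> is adjacency to \<open>A - I\<close>, since every neighbour of \<open>I\<close>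
  lies in \<open>A \<union> B\<close>; hence only fresh edges matter.\<close>

lemma card_separating_ge:
  assumes V: "finite V" and E: "E \<subseteq> pairs_on V" and uv: "u \<in> V" "v \<in> V"
    and X: "exposure E i u v = (I, A, B)"
  shows "card (A - B - I) + card (B - A - I) +
           card {w \<in> V - (A \<union> B). w \<in> nbhd E (A - I) \<longleftrightarrow> w \<notin> nbhd E (B - I)}
         \<le> card (separating V E i u v)"
proof -
  let ?W = "{w \<in> V - (A \<union> B). w \<in> nbhd E (A - I) \<longleftrightarrow> w \<notin> nbhd E (B - I)}"
  have I: "I = near E {u, v} i" and A: "A = near E {u} (Suc i)" and B: "B = near E {v} (Suc i)"
    using X by (auto simp: exposure_def)
  have AV: "A \<subseteq> V" "B \<subseteq> V" unfolding A B by (rule near_subset[OF E], use uv in simp)+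
  have nI: "nbhd E I \<subseteq> A \<union> B"
    using near_pair[of E u v "Suc i"] by (auto simp: I A B)
  have ww: "w \<in> nbhd E (S - I) \<longleftrightarrow> w \<in> nbhd E S" if "w \<notin> A \<union> B" for w S
  proof -
    have "nbhd E S \<subseteq> nbhd E (S - I) \<union> nbhd E I" by (auto simp: nbhd_def)
    moreover have "nbhd E (S - I) \<subseteq> nbhd E S" by (rule nbhd_mono) auto
    ultimately show ?thesis using nI that by blast
  qed
  have "?W \<subseteq> separating V E i u v"
  proof
    fix w assume w: "w \<in> ?W"
    then have "w \<noteq> u" "w \<noteq> v" by (auto simp: A B)
    then have "w \<in> near E {u} (Suc (Suc i)) \<longleftrightarrow> w \<in> nbhd E A" "w \<in> near E {v} (Suc (Suc i)) \<longleftrightarrow> w \<in> nbhd E B"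
      by (auto simp: A B)
    then have "(w \<in> near E {u} (Suc (Suc i))) \<noteq> (w \<in> near E {v} (Suc (Suc i)))"
      using w ww by blast
    then show "w \<in> separating V E i u v" using w by (auto simp: separating_def simp del: near.simps)
  qed
  moreover have "A - B - I \<subseteq> separating V E i u v" "B - A - I \<subseteq> separating V E i u v"
    using AV by (auto simp: separating_def A B simp del: near.simps)
  ultimately have "(A - B - I) \<union> (B - A - I) \<union> ?W \<subseteq> separating V E i u v" by blast
  moreover have "finite (separating V E i u v)" using V by (simp add: separating_def)
  ultimately have "card ((A - B - I) \<union> (B - A - I) \<union> ?W) \<le> card (separating V E i u v)"
    by (rule card_mono[rotated])
  moreover have "card ((A - B - I) \<union> (B - A - I) \<union> ?W) = card (A - B - I) + card (B - A - I) + card ?W"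
  proof -
    have fin: "finite A" "finite B" "finite ?W" using V AV finite_subset by auto
    have "card ((A - B - I) \<union> (B - A - I) \<union> ?W) = card ((A - B - I) \<union> (B - A - I)) + card ?W"
      by (rule card_Un_disjoint) (use fin in auto)
    moreover have "card ((A - B - I) \<union> (B - A - I)) = card (A - B - I) + card (B - A - I)"
      by (rule card_Un_disjoint) (use fin in auto)
    ultimately show ?thesis by simp
  qed
  ultimately show ?thesis by simp
qed

text \<open>Given the exposure, only the third summand of \<open>expected_separating\<close> is
  random. The Chernoff bound is used with \<open>M\<close> the whole sum, so it works whichever
  summand dominates, and no case distinction between the layers and the outside vertices
  arises.\<close>

lemma prob_few_separating:
  assumes V: "finite V" and uv: "u \<in> V" "v \<in> V" and p: "0 \<le> p" "p \<le> 1"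
    and \<epsilon>: "0 \<le> \<epsilon>" "\<epsilon> \<le> 1"
  shows "measure_pmf.prob (random_subset (pairs_on V) p)
     {E. D \<le> expected_separating V p (exposure E i u v) \<and> real (card (separating V E i u v)) < (1 - \<epsilon>) * D}
     \<le> exp (- (\<epsilon>\<^sup>2 * D / 2))"
proof -
  let ?M = "random_subset (pairs_on V) p"
  define G where "G = {(I, A, B). A \<subseteq> V \<and> B \<subseteq> V \<and> I \<subseteq> A \<union> B \<and> D \<le> expected_separating V p (I, A, B)}"
  define Q where "Q = (\<lambda>(I :: 'a set, A, B) E. real (card {w \<in> V - (A \<union> B). w \<in> nbhd E (A - I) \<longleftrightarrow> w \<notin> nbhd E (B - I)})
      \<le> real (card (V - (A \<union> B))) * exactly_one_prob p (A - I) (B - I) - \<epsilon> * expected_separating V p (I, A, B))"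
  have "measure_pmf.prob ?M {E. D \<le> expected_separating V p (exposure E i u v) \<and>
            real (card (separating V E i u v)) < (1 - \<epsilon>) * D}
      \<le> measure_pmf.prob ?M {E. exposure E i u v \<in> G \<and> Q (exposure E i u v) E}"
  proof (rule measure_pmf.finite_measure_mono_AE)
    show "AE E in measure_pmf ?M. E \<in> {E. D \<le> expected_separating V p (exposure E i u v) \<and>
            real (card (separating V E i u v)) < (1 - \<epsilon>) * D} \<longrightarrow>
         E \<in> {E. exposure E i u v \<in> G \<and> Q (exposure E i u v) E}"
    proof (rule AE_pmfI, rule impI)
      fix E assume "E \<in> set_pmf ?M" and few: "E \<in> {E. D \<le> expected_separating V p (exposure E i u v) \<and>
            real (card (separating V E i u v)) < (1 - \<epsilon>) * D}"
      then have E: "E \<subseteq> pairs_on V" using set_random_subset by fast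
      obtain I A B where X: "exposure E i u v = (I, A, B)" by (cases "exposure E i u v")
      have I: "I = near E {u, v} i" and A: "A = near E {u} (Suc i)" and B: "B = near E {v} (Suc i)"
        using X by (auto simp: exposure_def)
      have "A \<subseteq> V" "B \<subseteq> V" unfolding A B by (rule near_subset[OF E], use uv in simp)+
      moreover have "I \<subseteq> A \<union> B"
        using near_Suc_mono[of E "{u, v}" i] near_pair[of E u v "Suc i"] unfolding I A B by blast
      moreover have M: "D \<le> expected_separating V p (I, A, B)" using few X by simp
      ultimately have "(I, A, B) \<in> G" by (simp add: G_def)
      moreover have "Q (I, A, B) E"
      proof -
        have "(1 - \<epsilon>) * D \<le> (1 - \<epsilon>) * expected_separating V p (I, A, B)"
          using M \<epsilon> by (intro mult_left_mono) auto
        with few card_separating_ge[OF V E uv X]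
        have "real (card (A - B - I) + card (B - A - I) +
           card {w \<in> V - (A \<union> B). w \<in> nbhd E (A - I) \<longleftrightarrow> w \<notin> nbhd E (B - I)}) \<le>
           (1 - \<epsilon>) * expected_separating V p (I, A, B)" by simp
        then have "real (card {w \<in> V - (A \<union> B). w \<in> nbhd E (A - I) \<longleftrightarrow> w \<notin> nbhd E (B - I)}) \<le>
           expected_separating V p (I, A, B) - real (card (A - B - I)) - real (card (B - A - I))
            - \<epsilon> * expected_separating V p (I, A, B)" by (simp add: left_diff_distrib)
        then show ?thesis by (simp add: Q_def) (simp add: expected_separating_def)
      qed
      ultimately show "E \<in> {E. exposure E i u v \<in> G \<and> Q (exposure E i u v) E}" by (simp add: X)
    qed
  qed auto
  also have "\<dots> \<le> exp (- (\<epsilon>\<^sup>2 * D / 2))"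
  proof (rule prob_random_subset_exposed[where K = "\<lambda>h. meeting (fst h)"])
    show "finite (pairs_on V)" using V by (intro finite_pairs_on)
    show "exposure E' i u v = exposure E i u v"
      if agree: "E \<inter> meeting (fst (exposure E i u v)) = E' \<inter> meeting (fst (exposure E i u v))" for E E'
    proof -
      have "near E' T k = near E T k" if "k \<le> Suc i" "T \<subseteq> {u, v}" for k T
      proof (rule near_cong_meeting[OF agree _ that(1)])
        have "near E T i \<subseteq> near E (T \<union> {u, v}) i" unfolding near_Un by simp
        also have "T \<union> {u, v} = {u, v}" using that by auto
        finally show "near E T i \<subseteq> fst (exposure E i u v)" by (simp add: exposure_def)
      qed
      then show ?thesis by (simp add: exposure_def del: near.simps)
    qed
  next
    fix h assume "h \<in> G"
    moreover obtain I A B where h: "h = (I, A, B)" by (cases h)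
    ultimately have ok: "A \<subseteq> V" "B \<subseteq> V" "I \<subseteq> A \<union> B" and D: "D \<le> expected_separating V p (I, A, B)"
      by (auto simp: G_def)
    show "determined_by (- meeting (fst h)) (Q h)"
    proof (rule determined_byI)
      fix E E' :: "'a set set"
      assume *: "E \<inter> - meeting (fst h) = E' \<inter> - meeting (fst h)"
      have "w \<in> nbhd E (S - I) \<longleftrightarrow> w \<in> nbhd E' (S - I)" if "w \<in> V - (A \<union> B)" for w S
      proof -
        have "star_edges (S - I) w \<subseteq> - meeting (fst h)"
          using ok that by (auto simp: star_edges_def meeting_def h)
        then have "E \<inter> star_edges (S - I) w = E' \<inter> star_edges (S - I) w" using * by blast
        then show ?thesis by (simp add: mem_nbhd_iff_star)
      qed
      then have "{w \<in> V - (A \<union> B). w \<in> nbhd E (A - I) \<longleftrightarrow> w \<notin> nbhd E (B - I)} =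
          {w \<in> V - (A \<union> B). w \<in> nbhd E' (A - I) \<longleftrightarrow> w \<notin> nbhd E' (B - I)}" by auto
      then show "Q h E = Q h E'" by (simp add: Q_def h)
    qed
    interpret independent_events "pairs_on V" p "V - (A \<union> B)" "star_edges ((A - I) \<union> (B - I))"
      "\<lambda>w E. w \<in> nbhd E (A - I) \<longleftrightarrow> w \<notin> nbhd E (B - I)" "exactly_one_prob p (A - I) (B - I)"
      unfolding exactly_one_prob_def by (rule independent_events_exactly_one) (use V ok p in auto)
    have "measure_pmf.prob ?M {E. Q h E} \<le> exp (- (\<epsilon>\<^sup>2 * expected_separating V p (I, A, B) / 2))"
      using chernoff_lower[of "expected_separating V p (I, A, B)" \<epsilon>] \<epsilon>
      by (simp add: Q_def h occurring_def expected_separating_def)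
    also have "\<dots> \<le> exp (- (\<epsilon>\<^sup>2 * D / 2))"
      using mult_left_mono[OF D, of "\<epsilon>\<^sup>2"] by simp
    finally show "measure_pmf.prob ?M {E. Q h E} \<le> exp (- (\<epsilon>\<^sup>2 * D / 2))" .
  qed auto
  finally show ?thesis .
qed

text \<open>Instance with an empty expanded set and layers \<open>{u}\<close>, \<open>{v}\<close>:
  another vertex separates if it is adjacent to exactly one of the two. \<open>D\<close> leaves out
  \<open>u\<close> and \<open>v\<close> themselves.\<close>

lemma prob_few_separating_dense:
  assumes V: "finite V" and uv: "u \<in> V" "v \<in> V" "u \<noteq> v" and p: "0 \<le> p" "p \<le> 1"
    and \<epsilon>: "0 \<le> \<epsilon>" "\<epsilon> \<le> 1" and D: "D = (real (card V) - 2) * (2 * p * (1 - p))"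
  shows "measure_pmf.prob (random_subset (pairs_on V) p)
     {E. real (card (separating V E 0 u v)) < (1 - \<epsilon>) * D} \<le> exp (- (\<epsilon>\<^sup>2 * D / 2))"
proof -
  have card2: "card {u, v} = 2" using uv by simp
  have sub: "{u, v} \<subseteq> V" using uv by auto
  have "2 \<le> card V" using card_mono[OF V sub] card2 by simp
  moreover have "card (V - {u, v}) = card V - 2" using sub by (subst card_Diff_subset) (auto simp: card2)
  ultimately have "real (card (V - {u, v})) = real (card V) - 2" by (simp add: of_nat_diff)
  then have "D \<le> expected_separating V p (exposure E 0 u v)" for E
    using uv by (simp add: exposure_def expected_separating_def exactly_one_prob_def nbhd_def D
        insert_Diff_if insert_commute)
  with prob_few_separating[OF V uv(1,2) p \<epsilon>, of D 0] show ?thesis by simp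
qed

text \<open>From ln (1 - p) >= - p - 2 p^2 for p \<le> 1/2.\<close>

lemma exp_le_one_minus_power:
  assumes "0 \<le> p" "p \<le> 1 / 2" "real k \<le> a"
  shows "exp (- (a * (p * (1 + 2 * p)))) \<le> (1 - p) ^ k"
proof -
  have "- p - 2 * p\<^sup>2 \<le> ln (1 - p)" by (rule ln_one_minus_pos_lower_bound) (use assms in auto)
  then have "exp (- (p * (1 + 2 * p))) \<le> 1 - p"
    using assms by (subst ln_ge_iff[symmetric]) (auto simp: power2_eq_square algebra_simps)
  then have "exp (- (p * (1 + 2 * p))) ^ k \<le> (1 - p) ^ k" by (intro power_mono) auto
  moreover have "exp (- (a * (p * (1 + 2 * p)))) \<le> exp (- (p * (1 + 2 * p))) ^ k"
    using assms by (auto simp: exp_of_nat_mult[symmetric] intro!: mult_right_mono mult_nonneg_nonneg)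
  ultimately show ?thesis by linarith
qed

lemma one_minus_power_le_exp:
  assumes "0 \<le> p" "p \<le> (1 :: real)" "a \<le> real k"
  shows "(1 - p) ^ k \<le> exp (- (a * p))"
proof -
  have "(1 - p) ^ k \<le> exp (- p) ^ k"
    by (rule power_mono) (use assms exp_ge_add_one_self[of "- p"] in auto)
  also have "\<dots> \<le> exp (- (a * p))"
    using assms by (auto simp: exp_of_nat_mult[symmetric] intro!: mult_right_mono)
  finally show ?thesis .
qed

text \<open>Growth from \<open>{u}\<close>, \<open>{v}\<close> and \<open>{u, v}\<close> fails with
  probability at most \<open>2 * i / n ^ 4\<close> each, whence the 6. The term
  \<open>8 * d ^ i\<close> is the bound \<open>4 * t * d ^ i\<close> on the ball around both
  vertices, with t = 2.\<close>

lemma prob_few_separating_sparse: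
  fixes p d :: real and i :: nat
  assumes \<delta>: "\<delta> = 32 * sqrt (ln (real (card V)) / d) + 32 * d ^ i / real (card V)" "\<delta> \<le> 1 / 32"
    and V: "finite V" "2 \<le> card V" and p: "0 \<le> p" "p \<le> 1 / 2" and d: "d = p * (real (card V) - 1)" "4 \<le> d"
    and uv: "u \<in> V" "v \<in> V" "u \<noteq> v" and \<epsilon>: "0 \<le> \<epsilon>" "\<epsilon> \<le> 1"
    and D: "D = 2 * (1 - 3 * \<delta>) * d ^ i + (real (card V) - 8 * d ^ i) *
      (2 * (1 - exp (- ((1 - 3 * \<delta>) * d ^ i * p))) * exp (- ((1 + \<delta>) * d ^ i * (p * (1 + 2 * p)))))"
  shows "measure_pmf.prob (random_subset (pairs_on V) p)
     {E. real (card (separating V E i u v)) < (1 - \<epsilon>) * D}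
     \<le> 6 * real i / real (card V) ^ 4 + exp (- (\<epsilon>\<^sup>2 * D / 2))"
proof -
  let ?M = "random_subset (pairs_on V) p" and ?n = "real (card V)"
  let ?ok = "\<lambda>T E. growth_ok V d (real (card T)) \<delta> i (near E T i, near E T (Suc i))"
  have \<delta>0: "0 \<le> \<delta>" using V d by (simp add: \<delta>)
  have expected: "D \<le> expected_separating V p (exposure E i u v)"
    if u: "?ok {u} E" and v: "?ok {v} E" and uv': "?ok {u, v} E" for E
  proof -
    obtain I A B where X: "exposure E i u v = (I, A, B)" by (cases "exposure E i u v")
    have I: "I = near E {u, v} i" and A: "A = near E {u} (Suc i)" and B: "B = near E {v} (Suc i)"
      using X by (auto simp: exposure_def)
    have AB: "A \<union> B = near E {u, v} (Suc i)" unfolding A B by (rule near_pair[symmetric])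
    have sub: "A \<subseteq> V" "B \<subseteq> V" "finite A" "finite B"
      using u v V finite_subset by (auto simp: growth_ok_def A B simp del: near.simps)
    have up: "real (card (S - I)) \<le> (1 + \<delta>) * d ^ i" if "?ok {x} E" "S = near E {x} (Suc i)" "x \<in> {u, v}" for S x
    proof -
      have "finite S" using that V finite_subset by (auto simp: growth_ok_def simp del: near.simps)
      then have "card (S - I) \<le> card (S - near E {x} i)"
        using that by (intro card_mono) (auto simp: I near_pair simp del: near.simps)
      then show ?thesis using that by (simp add: growth_ok_def del: near.simps)
    qed
    have a: "real (card (A - I)) \<le> (1 + \<delta>) * d ^ i" by (rule up[OF u A]) simp
    have b: "real (card (B - I)) \<le> (1 + \<delta>) * d ^ i" by (rule up[OF v B]) simp
    have joint: "(1 - \<delta>) * (2 * d ^ i) \<le> real (card (A \<union> B - I))" and tot: "real (card (A \<union> B)) \<le> 8 * d ^ i"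
      using uv' uv by (auto simp: growth_ok_def AB I card_insert_if simp del: near.simps)
    have split: "card (A \<union> B - I) = card (S - R - I) + card (R - I)" if "S \<union> R = A \<union> B" for S R
    proof -
      have fin: "finite S" "finite R" using sub that by (metis finite_Un)+
      have "A \<union> B - I = (S - R - I) \<union> (R - I)" using that by auto
      then show ?thesis using fin by (simp only:) (rule card_Un_disjoint, auto)
    qed
    \<comment> \<open>Disjointness by counting: the joint layer has at least
      \<open>2 * (1 - \<delta>) * d ^ i\<close> vertices and \<open>B - I\<close> at most
      \<open>(1 + \<delta>) * d ^ i\<close>.\<close>
    have a1: "(1 - 3 * \<delta>) * d ^ i \<le> real (card (A - B - I))"
      using joint b split[of A B] by (simp add: algebra_simps)
    have b1: "(1 - 3 * \<delta>) * d ^ i \<le> real (card (B - A - I))"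
      using joint a split[of B A] by (simp add: algebra_simps Un_commute)
    let ?r = "(1 - exp (- ((1 - 3 * \<delta>) * d ^ i * p))) * exp (- ((1 + \<delta>) * d ^ i * (p * (1 + 2 * p))))"
    have r: "?r \<le> (1 - (1 - p) ^ card (S - I - (R - I))) * (1 - p) ^ card (R - I)"
      if "(1 - 3 * \<delta>) * d ^ i \<le> real (card (S - R - I))" "real (card (R - I)) \<le> (1 + \<delta>) * d ^ i" for S R
    proof -
      have "S - I - (R - I) = S - R - I" by auto
      then have "(1 - p) ^ card (S - I - (R - I)) \<le> exp (- ((1 - 3 * \<delta>) * d ^ i * p))"
        using that p by (simp only:) (rule one_minus_power_le_exp, auto)
      moreover have "exp (- ((1 + \<delta>) * d ^ i * (p * (1 + 2 * p)))) \<le> (1 - p) ^ card (R - I)"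
        by (rule exp_le_one_minus_power) (use p that in auto)
      ultimately show ?thesis using p by (intro mult_mono) (auto simp: power_le_one)
    qed
    have r2: "2 * ?r \<le> exactly_one_prob p (A - I) (B - I)"
      using r[OF a1 b] r[OF b1 a] by (simp add: exactly_one_prob_def)
    have cW: "real (card (V - (A \<union> B))) = ?n - real (card (A \<union> B))"
      using sub V by (subst card_Diff_subset) (auto simp: card_mono of_nat_diff)
    have r0: "0 \<le> ?r"
    proof -
      have "0 \<le> (1 - 3 * \<delta>) * d ^ i * p" using \<delta> d p by (intro mult_nonneg_nonneg) auto
      then show ?thesis by (intro mult_nonneg_nonneg) auto
    qed
    have "(?n - 8 * d ^ i) * (2 * ?r) \<le> real (card (V - (A \<union> B))) * (2 * ?r)"
      using tot r0 by (intro mult_right_mono) (auto simp: cW)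
    also have "\<dots> \<le> real (card (V - (A \<union> B))) * exactly_one_prob p (A - I) (B - I)"
      by (intro mult_left_mono r2) auto
    finally show ?thesis using a1 b1 by (simp add: X expected_separating_def D algebra_simps)
  qed
  have grow: "measure_pmf.prob ?M {E. \<not> ?ok T E} \<le> 2 * real i / ?n ^ 4"
    if "T \<subseteq> {u, v}" "T \<noteq> {}" for T
  proof (rule prob_growth[OF \<delta>(1) _ V p(1) _ d])
    have fin: "finite T" using that finite_subset by auto
    then show "1 \<le> card T" using that by (simp add: Suc_leI card_gt_0_iff)
    show "card T \<le> 2" using card_mono[OF _ that(1)] uv by simp
  qed (use \<delta> p that uv in auto)
  have "measure_pmf.prob ?M {E. real (card (separating V E i u v)) < (1 - \<epsilon>) * D} \<le>
        measure_pmf.prob ?M (({E. \<not> ?ok {u} E} \<union> {E. \<not> ?ok {v} E}) \<union> ({E. \<not> ?ok {u, v} E} \<union>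
          {E. D \<le> expected_separating V p (exposure E i u v) \<and> real (card (separating V E i u v)) < (1 - \<epsilon>) * D}))"
    using expected by (intro measure_pmf.finite_measure_mono) auto
  also have "\<dots> \<le> (measure_pmf.prob ?M {E. \<not> ?ok {u} E} + measure_pmf.prob ?M {E. \<not> ?ok {v} E}) +
     (measure_pmf.prob ?M {E. \<not> ?ok {u, v} E} + measure_pmf.prob ?M {E. D \<le> expected_separating V p (exposure E i u v) \<and>
            real (card (separating V E i u v)) < (1 - \<epsilon>) * D})"
    by (intro order_trans[OF measure_Un_le] add_mono order_refl) auto
  also have "\<dots> \<le> (2 * real i / ?n ^ 4 + 2 * real i / ?n ^ 4) + (2 * real i / ?n ^ 4 + exp (- (\<epsilon>\<^sup>2 * D / 2)))"
    by (intro add_mono grow prob_few_separating V uv p \<epsilon>) (use p in auto)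
  finally show ?thesis by (simp add: add_divide_distrib)
qed

section \<open>Greedy resolving sets\<close>

lemma greedy_hitting_set:
  fixes Sep :: "'b \<Rightarrow> 'a set" and K :: real
  assumes V: "finite V" "V \<noteq> {}" and U: "finite U"
    and K: "\<And>\<pi>. \<pi> \<in> U \<Longrightarrow> K \<le> real (card (V \<inter> Sep \<pi>))"
  shows "\<exists>R\<subseteq>V. card R \<le> s \<and>
    real (card {\<pi> \<in> U. R \<inter> Sep \<pi> = {}}) \<le> real (card U) * (1 - K / real (card V)) ^ s"
proof (induction s)
  case 0
  show ?case by (rule exI[of _ "{}"]) simp
next
  case (Suc s)
  then obtain R where R: "R \<subseteq> V" "card R \<le> s"
    and le: "real (card {\<pi> \<in> U. R \<inter> Sep \<pi> = {}}) \<le> real (card U) * (1 - K / real (card V)) ^ s"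
    by blast
  define U' where "U' = {\<pi> \<in> U. R \<inter> Sep \<pi> = {}}"
  have U': "finite U'" "U' \<subseteq> U" using U by (auto simp: U'_def)
  have n: "0 < real (card V)" using V by (simp add: card_gt_0_iff)
  show ?case
  proof (cases "U = {}")
    case True
    then show ?thesis by (intro exI[of _ "{}"]) simp
  next
    case False
    then obtain \<pi> where "\<pi> \<in> U" by auto
    then have "K \<le> real (card (V \<inter> Sep \<pi>))" by (rule K)
    also have "\<dots> \<le> real (card V)" using V by (simp add: card_mono)
    finally have q: "0 \<le> 1 - K / real (card V)" using n by (simp add: field_simps)
    \<comment> \<open>Averaging: double counting the incidences between vertices and pairs not yet
      separated shows that some vertex separates at least the mean number of them.\<close>
    have "\<exists>w\<in>V. K * real (card U') / real (card V) \<le> real (card {\<pi> \<in> U'. w \<in> Sep \<pi>})"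
    proof (rule ccontr)
      assume "\<not> ?thesis"
      then have "(\<Sum>w\<in>V. real (card {\<pi> \<in> U'. w \<in> Sep \<pi>})) < (\<Sum>w\<in>V. K * real (card U') / real (card V))"
        using V by (intro sum_strict_mono) auto
      also have "\<dots> = (\<Sum>\<pi>\<in>U'. K)" using n by simp
      also have "\<dots> \<le> (\<Sum>\<pi>\<in>U'. real (card (V \<inter> Sep \<pi>)))"
        using K U' by (intro sum_mono) auto
      also have "\<dots> = (\<Sum>\<pi>\<in>U'. \<Sum>w\<in>V. of_bool (w \<in> Sep \<pi>))"
        using V by (intro sum.cong refl) (simp add: Int_def)
      also have "\<dots> = (\<Sum>w\<in>V. \<Sum>\<pi>\<in>U'. of_bool (w \<in> Sep \<pi>))" by (rule sum.swap)
      also have "\<dots> = (\<Sum>w\<in>V. real (card {\<pi> \<in> U'. w \<in> Sep \<pi>}))"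
        using U' by (intro sum.cong refl) (simp add: Int_def)
      finally show False by simp
    qed
    then obtain w where w: "w \<in> V" "K * real (card U') / real (card V) \<le> real (card {\<pi> \<in> U'. w \<in> Sep \<pi>})"
      by blast
    have "card U' = card {\<pi> \<in> U'. w \<in> Sep \<pi>} + card {\<pi> \<in> U'. w \<notin> Sep \<pi>}"
      using U' by (subst card_Un_disjoint[symmetric]) (auto intro: arg_cong[where f = card])
    then have "real (card {\<pi> \<in> U'. w \<notin> Sep \<pi>}) = real (card U') - real (card {\<pi> \<in> U'. w \<in> Sep \<pi>})"
      by linarith
    also have "\<dots> \<le> real (card U') * (1 - K / real (card V))"
      using w(2) by (simp add: right_diff_distrib mult.commute)
    also have "\<dots> \<le> (real (card U) * (1 - K / real (card V)) ^ s) * (1 - K / real (card V))"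
      using le q by (intro mult_right_mono) (auto simp: U'_def)
    finally have "real (card {\<pi> \<in> U'. w \<notin> Sep \<pi>}) \<le> real (card U) * (1 - K / real (card V)) ^ Suc s"
      by (simp add: mult_ac)
    moreover have "{\<pi> \<in> U'. w \<notin> Sep \<pi>} = {\<pi> \<in> U. insert w R \<inter> Sep \<pi> = {}}" by (auto simp: U'_def)
    moreover have "card (insert w R) \<le> Suc s"
      using R by (intro order_trans[OF card_insert_le_m1]) (auto simp: card_insert_if)
    ultimately show ?thesis using w R by (intro exI[of _ "insert w R"]) auto
  qed
qed

text \<open>The number of unseparated ordered pairs is an integer bounded by a number below 1, hence
  0. Connectedness turns membership in balls into statements about distances.\<close>

lemma metric_dim_le_of_separating:
  fixes V :: "'a set" and K :: real
  assumes V: "finite V" "V \<noteq> {}" and conn: "graph_connected V E"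
    and K: "\<And>u v. u \<in> V \<Longrightarrow> v \<in> V \<Longrightarrow> u \<noteq> v \<Longrightarrow> K \<le> real (card (separating V E i u v))"
    and s: "real (card V) ^ 2 * (1 - K / real (card V)) ^ s < 1"
  shows "metric_dim V E \<le> s"
proof -
  define U where "U = {(u, v). u \<in> V \<and> v \<in> V \<and> u \<noteq> v}"
  define Sep where "Sep = (\<lambda>(u, v). {w. graph_dist E u w \<noteq> graph_dist E v w})"
  have UV: "U \<subseteq> V \<times> V" by (auto simp: U_def)
  have finU: "finite U" using UV V finite_subset by blast
  have Kle: "K \<le> real (card (V \<inter> Sep \<pi>))" if \<pi>: "\<pi> \<in> U" for \<pi>
  proof -
    obtain u v where uv: "\<pi> = (u, v)" "u \<in> V" "v \<in> V" "u \<noteq> v" using \<pi> by (auto simp: U_def)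
    have "separating V E i u v \<subseteq> V \<inter> Sep \<pi>"
    proof
      fix w assume w: "w \<in> separating V E i u v"
      then obtain k where "w \<in> V" and k: "(w \<in> near E {u} (Suc k)) \<noteq> (w \<in> near E {v} (Suc k))"
        unfolding separating_def by blast
      then show "w \<in> V \<inter> Sep \<pi>"
        using graph_dist_le_iff[OF conn uv(2) \<open>w \<in> V\<close>, of k] graph_dist_le_iff[OF conn uv(3) \<open>w \<in> V\<close>, of k]
        by (auto simp: Sep_def uv(1) simp del: near.simps)
    qed
    then have "card (separating V E i u v) \<le> card (V \<inter> Sep \<pi>)" using V by (intro card_mono) auto
    then show ?thesis using K[OF uv(2-4)] by linarith
  qed
  have "\<exists>R\<subseteq>V. card R \<le> s \<and>
      real (card {\<pi> \<in> U. R \<inter> Sep \<pi> = {}}) \<le> real (card U) * (1 - K / real (card V)) ^ s"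
    by (rule greedy_hitting_set[OF V finU Kle])
  then obtain R where R: "R \<subseteq> V" "card R \<le> s"
    and le: "real (card {\<pi> \<in> U. R \<inter> Sep \<pi> = {}}) \<le> real (card U) * (1 - K / real (card V)) ^ s"
    by (elim exE conjE)
  have "{\<pi> \<in> U. R \<inter> Sep \<pi> = {}} = {}"
  proof (rule ccontr)
    assume ne: "{\<pi> \<in> U. R \<inter> Sep \<pi> = {}} \<noteq> {}"
    then obtain \<pi> where "\<pi> \<in> U" by auto
    then have "K \<le> real (card (V \<inter> Sep \<pi>))" by (rule Kle)
    also have "\<dots> \<le> real (card V)" using V by (simp add: card_mono)
    finally have q: "0 \<le> 1 - K / real (card V)" using V by (simp add: field_simps card_gt_0_iff)
    have "card U \<le> card V ^ 2"
      using card_mono[OF _ UV] V by (simp add: card_cartesian_product power2_eq_square)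
    then have "real (card U) \<le> real (card V) ^ 2" by (metis of_nat_le_iff of_nat_power)
    then have "real (card U) * (1 - K / real (card V)) ^ s \<le> real (card V) ^ 2 * (1 - K / real (card V)) ^ s"
      using q by (intro mult_right_mono) auto
    then have "real (card {\<pi> \<in> U. R \<inter> Sep \<pi> = {}}) < 1" using le s by linarith
    then show False using ne finU by simp
  qed
  then have "resolving V E R"
    unfolding resolving_def
  proof (intro conjI ballI impI R(1))
    fix v w assume "v \<in> V" "w \<in> V" "v \<noteq> w"
    then have "(v, w) \<in> U" by (simp add: U_def)
    then obtain r where r: "r \<in> R" "graph_dist E v r \<noteq> graph_dist E w r"
      using \<open>{\<pi> \<in> U. R \<inter> Sep \<pi> = {}} = {}\<close> by (fastforce simp: Sep_def)
    then have "dist_vector E R v r \<noteq> dist_vector E R w r" by (simp add: dist_vector_def)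
    then show "dist_vector E R v \<noteq> dist_vector E R w" by metis
  qed
  then have "metric_dim V E \<le> card R" unfolding metric_dim_def by (intro Least_le) auto
  then show ?thesis using R by simp
qed

section \<open>Connectivity\<close>

definition cut_edges :: "'a set \<Rightarrow> 'a set \<Rightarrow> 'a set set" where
  "cut_edges V S = (\<lambda>(x, y). {x, y}) ` (S \<times> (V - S))"

text \<open>Take the component of a vertex or its complement, whichever is smaller; both define the
  same cut.\<close>

lemma disconnected_cut:
  assumes V: "finite V" and E: "E \<subseteq> pairs_on V" and nc: "\<not> graph_connected V E"
  shows "\<exists>S\<subseteq>V. S \<noteq> {} \<and> 2 * card S \<le> card V \<and> E \<inter> cut_edges V S = {}"
proof -
  obtain u v where uv: "u \<in> V" "v \<in> V" "(u, v) \<notin> (adj_rel E)\<^sup>*"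
    using nc by (auto simp: graph_connected_def)
  define S where "S = {w \<in> V. (u, w) \<in> (adj_rel E)\<^sup>*}"
  have S: "S \<subseteq> V" "u \<in> S" "v \<in> V - S" using uv by (auto simp: S_def)
  have "{x, y} \<notin> E" if "x \<in> S" "y \<in> V - S" for x y
  proof
    assume "{x, y} \<in> E"
    then have "(u, y) \<in> (adj_rel E)\<^sup>*"
      using that by (auto simp: S_def adj_rel_def intro: rtrancl_into_rtrancl)
    then show False using that by (simp add: S_def)
  qed
  then have cut: "E \<inter> cut_edges V S = {}" by (auto simp: cut_edges_def)
  have "cut_edges V (V - S) = (\<lambda>(x, y). {x, y}) ` prod.swap ` (S \<times> (V - S))"
    using S(1) by (simp add: cut_edges_def double_diff product_swap)
  also have "\<dots> = cut_edges V S"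
    unfolding cut_edges_def image_image by (rule image_cong) (auto simp: insert_commute)
  finally have "cut_edges V (V - S) = cut_edges V S" .
  moreover have "card V = card S + card (V - S)"
    using S V by (metis card_Diff_subset card_mono finite_subset le_add_diff_inverse)
  ultimately show ?thesis
  proof (cases "2 * card S \<le> card V")
    case True
    then show ?thesis using S cut by blast
  next
    case False
    then have "2 * card (V - S) \<le> card V" using \<open>card V = _\<close> by linarith
    then show ?thesis using S cut \<open>cut_edges V (V - S) = cut_edges V S\<close> by (intro exI[of _ "V - S"]) auto
  qed
qed

lemma sum_Pow_power_card:
  fixes y :: "'b :: comm_semiring_1"
  assumes "finite V"
  shows "(\<Sum>S\<in>Pow V. y ^ card S) = (1 + y) ^ card V"
  using prod_add[OF assms, of "\<lambda>_. y" "\<lambda>_. 1"] by (simp add: add.commute)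

text \<open>Union bound over cuts: the smaller side \<open>S\<close> has at least |S| n/2 potential
  edges across, so the cut is empty with probability at most y^|S|, where y = exp (- p n / 2).
  Summing over all nonempty subsets gives (1 + y)^n - 1, which tends to 0 as soon as n y
  does.\<close>

lemma prob_disconnected:
  assumes V: "finite V" and p: "0 \<le> p" "p \<le> 1"
  shows "measure_pmf.prob (random_subset (pairs_on V) p) {E. \<not> graph_connected V E}
    \<le> exp (real (card V) * exp (- (p * real (card V) / 2))) - 1"
proof -
  let ?M = "random_subset (pairs_on V) p" and ?n = "real (card V)"
  define y where "y = exp (- (p * ?n / 2))"
  define F where "F = {S \<in> Pow V - {{}}. 2 * card S \<le> card V}"
  have finF: "finite F" using V by (simp add: F_def)
  have "measure_pmf.prob ?M {E. \<not> graph_connected V E} \<le>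
        measure_pmf.prob ?M (\<Union>S\<in>F. {E. E \<inter> cut_edges V S = {}})"
  proof (rule measure_pmf.finite_measure_mono_AE)
    show "AE E in measure_pmf ?M. E \<in> {E. \<not> graph_connected V E} \<longrightarrow> E \<in> (\<Union>S\<in>F. {E. E \<inter> cut_edges V S = {}})"
    proof (rule AE_pmfI, rule impI)
      fix E assume "E \<in> set_pmf ?M" "E \<in> {E. \<not> graph_connected V E}"
      then have "E \<subseteq> pairs_on V" "\<not> graph_connected V E" using set_random_subset by fast+
      from disconnected_cut[OF V this] show "E \<in> (\<Union>S\<in>F. {E. E \<inter> cut_edges V S = {}})"
        by (auto simp: F_def)
    qed
  qed auto
  also have "\<dots> \<le> (\<Sum>S\<in>F. measure_pmf.prob ?M {E. E \<inter> cut_edges V S = {}})"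
    by (rule measure_pmf.finite_measure_subadditive_finite) (use finF in auto)
  also have "\<dots> \<le> (\<Sum>S\<in>F. y ^ card S)"
  proof (rule sum_mono)
    fix S assume "S \<in> F"
    then have S: "S \<subseteq> V" "2 * card S \<le> card V" by (auto simp: F_def)
    have "inj_on (\<lambda>(x, y). {x, y}) (S \<times> (V - S))" by (auto simp: inj_on_def doubleton_eq_iff)
    then have "card (cut_edges V S) = card S * card (V - S)"
      by (simp add: cut_edges_def card_image card_cartesian_product)
    moreover have "cut_edges V S \<subseteq> pairs_on V" using S by (auto simp: cut_edges_def pairs_on_def card_2_iff)
    ultimately have "measure_pmf.prob ?M {E. E \<inter> cut_edges V S = {}} = (1 - p) ^ (card S * card (V - S))"
      using prob_random_subset_avoid[OF finite_pairs_on[OF V], of "cut_edges V S" p] p by simp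
    also have "\<dots> = ((1 - p) ^ card (V - S)) ^ card S" by (simp add: power_mult[symmetric] mult.commute)
    also have "\<dots> \<le> y ^ card S"
    proof (rule power_mono)
      have "card (V - S) = card V - card S" using S V by (simp add: card_Diff_subset finite_subset)
      then have "?n / 2 \<le> real (card (V - S))" using S(2) by linarith
      then have "(1 - p) ^ card (V - S) \<le> exp (- (?n / 2 * p))" by (rule one_minus_power_le_exp[OF p])
      then show "(1 - p) ^ card (V - S) \<le> y" by (simp add: y_def mult.commute)
    qed (use p in auto)
    finally show "measure_pmf.prob ?M {E. E \<inter> cut_edges V S = {}} \<le> y ^ card S" .
  qed
  also have "\<dots> \<le> (\<Sum>S\<in>Pow V - {{}}. y ^ card S)"
    by (rule sum_mono2) (use V in \<open>auto simp: F_def y_def\<close>)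
  also have "\<dots> = (1 + y) ^ card V - 1"
    using sum_Pow_power_card[OF V, of y] V by (simp add: sum_diff1)
  also have "\<dots> \<le> exp y ^ card V - 1"
    by (intro diff_right_mono power_mono) (auto simp: y_def)
  also have "\<dots> = exp (?n * y) - 1" by (simp add: exp_of_nat_mult)
  finally show ?thesis by (simp add: y_def)
qed

section \<open>Asymptotic bounds from separating vertices\<close>

text \<open>The diagonal error is the infimum of all \<open>\<epsilon>\<close> for which the event has probability at least \<open>1 - \<epsilon>\<close>.\<close>

lemma aas_metric_dim_le_diagonal:
  assumes f: "\<forall>\<^sub>F n in sequentially. 0 \<le> f n"
    and le: "\<And>\<epsilon>. 0 < \<epsilon> \<Longrightarrow> aas p (\<lambda>n E. graph_connected {1..n} E \<and>
                  real (metric_dim {1..n} E) \<le> (1 + \<epsilon>) * f n)"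
  shows "aas_metric_dim_le p f"
proof -
  define P where "P = (\<lambda>\<epsilon> n. measure_pmf.prob (gnp n (p n))
    {E. graph_connected {1..n} E \<and> real (metric_dim {1..n} E) \<le> (1 + \<epsilon>) * f n})"
  define A where "A = (\<lambda>n. {\<epsilon>. 0 < \<epsilon> \<and> 1 - \<epsilon> \<le> P \<epsilon> n})"
  \<comment> \<open>The infimum need not be attained; the summand \<open>1 / real (Suc n)\<close>
    guarantees a member of \<open>A n\<close> below \<open>e n\<close>.\<close>
  define e where "e = (\<lambda>n. Inf (A n) + 1 / real (Suc n))"
  have A1: "1 \<in> A n" for n by (simp add: A_def P_def)
  have bdd: "bdd_below (A n)" for n by (rule bdd_belowI[of _ 0]) (simp add: A_def)
  have Inf0: "0 \<le> Inf (A n)" for n by (rule cInf_greatest) (use A1[of n] in blast, simp add: A_def)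
  have e0: "e \<longlonglongrightarrow> 0"
  proof (rule tendstoI)
    fix \<eta> :: real assume \<eta>: "0 < \<eta>"
    have "P (\<eta> / 2) \<longlonglongrightarrow> 1" using le[of "\<eta> / 2"] \<eta> by (simp add: aas_def P_def)
    then have "\<forall>\<^sub>F n in sequentially. 1 - \<eta> / 2 < P (\<eta> / 2) n"
      by (rule order_tendstoD) (use \<eta> in simp)
    moreover have "\<forall>\<^sub>F n in sequentially. 1 / real (Suc n) < \<eta> / 2"
      by (rule order_tendstoD[OF LIMSEQ_Suc[OF lim_1_over_n]]) (use \<eta> in simp)
    ultimately show "\<forall>\<^sub>F n in sequentially. dist (e n) 0 < \<eta>"
    proof eventually_elim
      case (elim n)
      have "\<eta> / 2 \<in> A n" using elim \<eta> by (simp add: A_def)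
      then have "Inf (A n) \<le> \<eta> / 2" by (rule cInf_lower[OF _ bdd])
      then show ?case using elim Inf0[of n] by (simp add: e_def dist_real_def)
    qed
  qed
  have "(\<lambda>n. P (e n) n) \<longlonglongrightarrow> 1"
  proof (rule tendsto_sandwich)
    show "\<forall>\<^sub>F n in sequentially. 1 - e n \<le> P (e n) n"
      using f
    proof eventually_elim
      case (elim n)
      have "Inf (A n) < e n" by (simp add: e_def)
      then obtain a where a: "a \<in> A n" "a < e n" using cInf_lessD[of "A n" "e n"] A1 by auto
      have "(1 + a) * f n \<le> (1 + e n) * f n" using a elim by (intro mult_right_mono) auto
      then have "P a n \<le> P (e n) n"
        unfolding P_def by (intro measure_pmf.finite_measure_mono) auto
      then show ?case using a by (simp add: A_def)
    qed
    show "\<forall>\<^sub>F n in sequentially. P (e n) n \<le> 1" by (simp add: P_def)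
    show "(\<lambda>n. 1 - e n) \<longlonglongrightarrow> 1" using tendsto_diff[OF tendsto_const e0, of 1] by simp
  qed simp
  then show ?thesis using e0 unfolding aas_metric_dim_le_def aas_def P_def by blast
qed

lemma metric_dim_bound:
  fixes L K \<epsilon> :: real
  assumes n: "2 \<le> n" and conn: "graph_connected {1..n} E" and L: "0 < L" and \<epsilon>: "0 < \<epsilon>" "\<epsilon> < 1"
    and K: "\<And>u v. u \<in> {1..n} \<Longrightarrow> v \<in> {1..n} \<Longrightarrow> u \<noteq> v \<Longrightarrow> K \<le> real (card (separating {1..n} E i u v))"
    and KL: "1 - K / real n \<le> exp (- ((1 - \<epsilon>) * L))"
  shows "real (metric_dim {1..n} E) \<le> 2 * ln (real n) / ((1 - \<epsilon>) * L) + 1"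
proof -
  define z where "z = 2 * ln (real n) / ((1 - \<epsilon>) * L)"
  \<comment> \<open>The least natural number strictly above \<open>z\<close>; strictness is what
    makes the remaining count smaller than 1.\<close>
  define s where "s = nat \<lfloor>z\<rfloor> + 1"
  have z0: "0 \<le> z" using n L \<epsilon> by (simp add: z_def)
  have zs: "z < real s" "real s \<le> z + 1" using z0 by (auto simp: s_def) linarith+
  have "K \<le> real (card (separating {1..n} E i 1 2))" by (rule K) (use n in auto)
  also have "\<dots> \<le> real (card {1..n})" by (intro of_nat_mono card_mono) (auto simp: separating_def)
  finally have "K \<le> real n" by simp
  then have q: "0 \<le> 1 - K / real n" using n by simp
  have "(1 - K / real n) ^ s \<le> exp (- ((1 - \<epsilon>) * L)) ^ s" by (rule power_mono[OF KL q])
  also have "\<dots> = exp (- (real s * ((1 - \<epsilon>) * L)))" by (simp add: exp_of_nat_mult[symmetric])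
  also have "\<dots> < exp (- (z * ((1 - \<epsilon>) * L)))" using zs L \<epsilon> by simp
  also have "z * ((1 - \<epsilon>) * L) = 2 * ln (real n)" using L \<epsilon> by (simp add: z_def)
  also have "exp (- (2 * ln (real n))) = 1 / real n ^ 2"
    using n by (simp add: exp_minus exp_of_nat_mult[of 2, simplified] inverse_eq_divide)
  finally have "real n ^ 2 * (1 - K / real n) ^ s < 1" using n by (simp add: field_simps)
  then have "metric_dim {1..n} E \<le> s"
    using n by (intro metric_dim_le_of_separating[where K = K and i = i] conn K) auto
  then show ?thesis using zs by (simp add: z_def)
qed

lemma prob_connected_separating:
  fixes \<beta> K p :: real
  assumes p: "0 \<le> p" "p \<le> 1" and \<beta>0: "0 \<le> \<beta>"
    and \<beta>: "\<And>u v. u \<in> {1..n} \<Longrightarrow> v \<in> {1..n} \<Longrightarrow> u \<noteq> v \<Longrightarrow>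
      measure_pmf.prob (gnp n p) {E. real (card (separating {1..n} E i u v)) < K} \<le> \<beta>"
  shows "1 - (exp (real n * exp (- (p * real n / 2))) - 1 + real n ^ 2 * \<beta>) \<le>
    measure_pmf.prob (gnp n p) {E. graph_connected {1..n} E \<and>
      (\<forall>u\<in>{1..n}. \<forall>v\<in>{1..n}. u \<noteq> v \<longrightarrow> K \<le> real (card (separating {1..n} E i u v)))}"
proof -
  let ?M = "gnp n p" and ?V = "{1..n}"
  let ?U = "{(u, v). u \<in> ?V \<and> v \<in> ?V \<and> u \<noteq> v}"
  let ?good = "{E. graph_connected ?V E \<and>
      (\<forall>u\<in>?V. \<forall>v\<in>?V. u \<noteq> v \<longrightarrow> K \<le> real (card (separating ?V E i u v)))}"
  have sub: "?U \<subseteq> ?V \<times> ?V" by auto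
  then have finU: "finite ?U" by (rule finite_subset) auto
  have "card ?U \<le> n ^ 2" using card_mono[OF _ sub] by (simp add: card_cartesian_product power2_eq_square)
  then have cU: "real (card ?U) \<le> real n ^ 2"
    unfolding of_nat_power[symmetric] by (rule of_nat_mono)
  have "1 - measure_pmf.prob ?M ?good = measure_pmf.prob ?M (- ?good)"
    using measure_pmf.prob_compl[of ?good ?M] by (simp add: Compl_eq_Diff_UNIV)
  also have "\<dots> \<le> measure_pmf.prob ?M ({E. \<not> graph_connected ?V E} \<union>
      (\<Union>\<pi>\<in>?U. {E. real (card (separating ?V E i (fst \<pi>) (snd \<pi>))) < K}))"
  proof (rule measure_pmf.finite_measure_mono, rule subsetI)
    fix E assume "E \<in> - ?good"
    then consider "\<not> graph_connected ?V E"
      | u v where "u \<in> ?V" "v \<in> ?V" "u \<noteq> v" "\<not> K \<le> real (card (separating ?V E i u v))"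
      by blast
    then show "E \<in> {E. \<not> graph_connected ?V E} \<union>
      (\<Union>\<pi>\<in>?U. {E. real (card (separating ?V E i (fst \<pi>) (snd \<pi>))) < K})"
    proof cases
      case (2 u v)
      then have "E \<in> (\<Union>\<pi>\<in>?U. {E. real (card (separating ?V E i (fst \<pi>) (snd \<pi>))) < K})"
        by (intro UN_I[of "(u, v)"]) (auto simp: not_le)
      then show ?thesis by blast
    qed simp
  qed simp
  also have "\<dots> \<le> measure_pmf.prob ?M {E. \<not> graph_connected ?V E} +
      measure_pmf.prob ?M (\<Union>\<pi>\<in>?U. {E. real (card (separating ?V E i (fst \<pi>) (snd \<pi>))) < K})"
    by (rule measure_Un_le) auto
  also have "\<dots> \<le> (exp (real n * exp (- (p * real n / 2))) - 1) + real n ^ 2 * \<beta>"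
  proof (rule add_mono)
    show "measure_pmf.prob ?M {E. \<not> graph_connected ?V E} \<le> exp (real n * exp (- (p * real n / 2))) - 1"
      using prob_disconnected[of ?V p] p by (simp add: gnp_eq_random_subset)
    have "measure_pmf.prob ?M (\<Union>\<pi>\<in>?U. {E. real (card (separating ?V E i (fst \<pi>) (snd \<pi>))) < K})
      \<le> (\<Sum>\<pi>\<in>?U. measure_pmf.prob ?M {E. real (card (separating ?V E i (fst \<pi>) (snd \<pi>))) < K})"
      by (rule measure_pmf.finite_measure_subadditive_finite[OF finU]) auto
    also have "\<dots> \<le> (\<Sum>\<pi>\<in>?U. \<beta>)" by (intro sum_mono) (use \<beta> in auto)
    also have "\<dots> \<le> real n ^ 2 * \<beta>" using cU \<beta>0 by (simp add: mult_right_mono)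
    finally show "measure_pmf.prob ?M (\<Union>\<pi>\<in>?U. {E. real (card (separating ?V E i (fst \<pi>) (snd \<pi>))) < K})
      \<le> real n ^ 2 * \<beta>" .
  qed
  finally show ?thesis by linarith
qed

text \<open>Common endgame of both regimes. \<open>D n\<close> bounds the conditional mean number of
  separating vertices, \<open>D0 n\<close> is its proportion and \<open>L n\<close> the resulting
  rate; the doubling from \<kappa> to 2 \<kappa> in \<open>D0_L\<close> accommodates L = ln (1/q) as
  well as L = D0. The bound \<open>L n \<le> 2\<close> makes the result tend to infinity, so that
  rounding up costs nothing asymptotically.\<close>

lemma aas_metric_dim_le_of_separating:
  fixes p d D D0 L :: "nat \<Rightarrow> real" and i :: "nat \<Rightarrow> nat"
  assumes p: "\<And>n. 0 \<le> p n \<and> p n \<le> 1"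
    and pair: "\<forall>\<^sub>F n in sequentially. \<forall>\<kappa>\<in>{0..1}. \<forall>u\<in>{1..n}. \<forall>v\<in>{1..n}. u \<noteq> v \<longrightarrow>
      measure_pmf.prob (gnp n (p n)) {E. real (card (separating {1..n} E (i n) u v)) < (1 - \<kappa>) * D n}
      \<le> 6 * real (i n) / real n ^ 4 + exp (- (\<kappa>\<^sup>2 * D n / 2))"
    and D_large: "(\<lambda>n. ln (real n)) \<in> o(D)"
    and D_nonneg: "\<forall>\<^sub>F n in sequentially. 0 \<le> D n"
    and D_ge: "\<And>\<kappa>. 0 < \<kappa> \<Longrightarrow> \<forall>\<^sub>F n in sequentially. (1 - \<kappa>) * (real n * D0 n) \<le> D n"
    and D0: "\<forall>\<^sub>F n in sequentially. 0 \<le> D0 n"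
    and D0_L: "\<forall>\<^sub>F n in sequentially. \<forall>\<kappa>\<in>{0..1/2}. 1 - (1 - \<kappa>) * D0 n \<le> exp (- ((1 - 2 * \<kappa>) * L n))"
    and L: "\<forall>\<^sub>F n in sequentially. 0 < L n \<and> L n \<le> 2"
    and i: "\<forall>\<^sub>F n in sequentially. i n \<le> n"
    and pn: "(\<lambda>n. ln (real n)) \<in> o(\<lambda>n. p n * real n)"
  shows "aas_metric_dim_le p (\<lambda>n. 2 * ln (real n) / L n)"
proof (rule aas_metric_dim_le_diagonal)
  show "\<forall>\<^sub>F n in sequentially. 0 \<le> 2 * ln (real n) / L n"
    using L eventually_ge_at_top[of 1] by eventually_elim auto
next
  fix \<eta> :: real assume \<eta>: "0 < \<eta>"
  \<comment> \<open>Half of \<eta> pays for 1 / (1 - \<epsilon>), the other half for the rounding by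
    1. With \<kappa> = \<epsilon>/4, the Chernoff bound and \<open>D_ge\<close> each lose a factor 1
    - \<kappa>, together at most 2 \<kappa>, and \<open>D0_L\<close> doubles this to
    \<epsilon>.\<close>
  define \<epsilon> where "\<epsilon> = (\<eta> / 2) / (1 + \<eta> / 2)"
  define \<kappa> where "\<kappa> = \<epsilon> / 4"
  have \<epsilon>: "0 < \<epsilon>" "\<epsilon> < 1" "1 / (1 - \<epsilon>) = 1 + \<eta> / 2" using \<eta> by (auto simp: \<epsilon>_def field_simps)
  have \<kappa>: "0 < \<kappa>" "\<kappa> < 1 / 4" using \<epsilon> by (auto simp: \<kappa>_def)
  define \<beta> where "\<beta> = (\<lambda>n. 6 * real (i n) / real n ^ 4 + exp (- (\<kappa>\<^sup>2 * D n / 2)))"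
  let ?P = "\<lambda>n. measure_pmf.prob (gnp n (p n)) {E. graph_connected {1..n} E \<and>
             real (metric_dim {1..n} E) \<le> (1 + \<eta>) * (2 * ln (real n) / L n)}"
  have ln_large: "\<forall>\<^sub>F n in sequentially. 2 / \<eta> \<le> ln (real n)"
    by (rule filterlim_at_top[THEN iffD1, rule_format])
       (rule filterlim_compose[OF ln_at_top filterlim_real_sequentially])
  have low: "\<forall>\<^sub>F n in sequentially. 1 - (exp (real n * exp (- (p n * real n / 2))) - 1 + real n ^ 2 * \<beta> n) \<le> ?P n"
    using pair D_nonneg D_ge[OF \<kappa>(1)] D0 D0_L L ln_large eventually_ge_at_top[of 2]
  proof eventually_elim
    case (elim n)
    have n: "2 \<le> n" by (rule elim)
    let ?K = "(1 - \<kappa>) * D n"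
    let ?good = "{E. graph_connected {1..n} E \<and>
      (\<forall>u\<in>{1..n}. \<forall>v\<in>{1..n}. u \<noteq> v \<longrightarrow> ?K \<le> real (card (separating {1..n} E (i n) u v)))}"
    have "1 - (exp (real n * exp (- (p n * real n / 2))) - 1 + real n ^ 2 * \<beta> n)
       \<le> measure_pmf.prob (gnp n (p n)) ?good"
      by (rule prob_connected_separating) (use p elim \<kappa> in \<open>auto simp: \<beta>_def\<close>)
    also have "\<dots> \<le> ?P n"
    proof (rule measure_pmf.finite_measure_mono, rule subsetI)
      fix E assume E: "E \<in> ?good"
      have "(1 - 2 * \<kappa>) * (real n * D0 n) \<le> ((1 - \<kappa>) * (1 - \<kappa>)) * (real n * D0 n)"
        using elim by (intro mult_right_mono) (auto simp: algebra_simps)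
      also have "\<dots> \<le> ?K" using elim \<kappa> by (simp only: mult.assoc) (rule mult_left_mono, auto)
      finally have "(1 - 2 * \<kappa>) * D0 n \<le> ?K / real n" using n by (simp add: field_simps)
      then have "1 - ?K / real n \<le> 1 - (1 - 2 * \<kappa>) * D0 n" by simp
      also have "\<dots> \<le> exp (- ((1 - 2 * (2 * \<kappa>)) * L n))"
        by (rule bspec[OF elim(5)]) (use \<kappa> in auto)
      finally have "1 - ?K / real n \<le> exp (- ((1 - \<epsilon>) * L n))" by (simp add: \<kappa>_def)
      then have "real (metric_dim {1..n} E) \<le> 2 * ln (real n) / ((1 - \<epsilon>) * L n) + 1"
        using E elim \<epsilon> n by (intro metric_dim_bound[where K = ?K and i = "i n"]) auto
      also have "2 * ln (real n) / ((1 - \<epsilon>) * L n) = (1 / (1 - \<epsilon>)) * (2 * ln (real n) / L n)" by simp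
      also have "\<dots> = (1 + \<eta> / 2) * (2 * ln (real n) / L n)" by (simp only: \<epsilon>)
      finally have 1: "real (metric_dim {1..n} E) \<le> (1 + \<eta> / 2) * (2 * ln (real n) / L n) + 1" .
      define f where "f = 2 * ln (real n) / L n"
      have "L n \<le> \<eta> * ln (real n)" using elim \<eta> by (auto simp: field_simps)
      then have "1 \<le> (\<eta> / 2) * f" using elim by (simp add: f_def field_simps)
      with 1[folded f_def] have "real (metric_dim {1..n} E) \<le> (1 + \<eta>) * f"
        by (simp add: algebra_simps)
      then have "real (metric_dim {1..n} E) \<le> (1 + \<eta>) * (2 * ln (real n) / L n)"
        by (simp only: f_def)
      then show "E \<in> {E. graph_connected {1..n} E \<and>
             real (metric_dim {1..n} E) \<le> (1 + \<eta>) * (2 * ln (real n) / L n)}" using E by simp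
    qed auto
    finally show ?case .
  qed
  have conn0: "(\<lambda>n. real n * exp (- (p n * real n / 2))) \<longlonglongrightarrow> 0"
  proof (rule tendsto_sandwich)
    have "\<forall>\<^sub>F n in sequentially. norm (ln (real n)) \<le> 1 / 4 * norm (p n * real n)"
      by (rule landau_o.smallD[OF pn]) simp
    then show "\<forall>\<^sub>F n in sequentially. real n * exp (- (p n * real n / 2)) \<le> 1 / real n"
      using eventually_ge_at_top[of 1]
    proof eventually_elim
      case (elim n)
      then have "exp (- (p n * real n / 2)) \<le> exp (- (2 * ln (real n)))" using p[of n] by simp
      also have "\<dots> = 1 / real n ^ 2"
        using elim by (simp add: exp_minus exp_of_nat_mult[of 2, simplified] inverse_eq_divide)
      finally show ?case using elim by (simp add: field_simps power2_eq_square)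
    qed
  qed (auto simp: lim_1_over_n)
  have \<beta>0: "(\<lambda>n. real n ^ 2 * \<beta> n) \<longlonglongrightarrow> 0"
  proof (rule tendsto_sandwich[where f = "\<lambda>_. 0"])
    \<comment> \<open>With the constant \<open>\<kappa>\<^sup>2 / 6\<close> the Chernoff term is at
      most n^-3, and i \<le> n brings the growth term to the same order; both beat the n^2
      pairs.\<close>
    have "\<forall>\<^sub>F n in sequentially. norm (ln (real n)) \<le> \<kappa>\<^sup>2 / 6 * norm (D n)"
      by (rule landau_o.smallD[OF D_large]) (use \<kappa> in simp)
    then show "\<forall>\<^sub>F n in sequentially. real n ^ 2 * \<beta> n \<le> 7 * (1 / real n)"
      using i D_nonneg eventually_ge_at_top[of 1]
    proof eventually_elim
      case (elim n)
      then have "exp (- (\<kappa>\<^sup>2 * D n / 2)) \<le> exp (- (3 * ln (real n)))" by simp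
      also have "\<dots> = 1 / real n ^ 3"
        using elim by (simp add: exp_minus exp_of_nat_mult[of 3, simplified] inverse_eq_divide)
      finally have "\<beta> n \<le> 6 * real n / real n ^ 4 + 1 / real n ^ 3"
        unfolding \<beta>_def using elim by (intro add_mono divide_right_mono) auto
      also have "\<dots> = 7 / real n ^ 3" using elim by (simp add: field_simps eval_nat_numeral)
      finally have "real n ^ 2 * \<beta> n \<le> real n ^ 2 * (7 / real n ^ 3)" by (intro mult_left_mono) auto
      also have "\<dots> = 7 * (1 / real n)" using elim by (simp add: field_simps eval_nat_numeral)
      finally show ?case .
    qed
    show "(\<lambda>n. 7 * (1 / real n)) \<longlonglongrightarrow> 0" by (intro tendsto_mult_right_zero lim_1_over_n)
    show "\<forall>\<^sub>F n in sequentially. 0 \<le> real n ^ 2 * \<beta> n" by (simp add: \<beta>_def)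
  qed simp
  have "(\<lambda>n. 1 - (exp (real n * exp (- (p n * real n / 2))) - 1 + real n ^ 2 * \<beta> n)) \<longlonglongrightarrow> 1 - (exp 0 - 1 + 0)"
    by (intro tendsto_intros conn0 \<beta>0)
  then have "(\<lambda>n. 1 - (exp (real n * exp (- (p n * real n / 2))) - 1 + real n ^ 2 * \<beta> n)) \<longlonglongrightarrow> 1"
    by simp
  then have "?P \<longlonglongrightarrow> 1"
    by (rule tendsto_sandwich[OF low _ _ tendsto_const, rotated]) simp
  then show "aas p (\<lambda>n E. graph_connected {1..n} E \<and>
      real (metric_dim {1..n} E) \<le> (1 + \<eta>) * (2 * ln (real n) / L n))" by (simp add: aas_def)
qed

lemma aas_metric_dim_le_cong_asymp:
  assumes le: "aas_metric_dim_le p f" and lim: "(\<lambda>n. f n / g n) \<longlonglongrightarrow> 1"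
    and g: "\<forall>\<^sub>F n in sequentially. g n \<noteq> 0"
  shows "aas_metric_dim_le p g"
proof -
  obtain \<epsilon> where \<epsilon>: "\<epsilon> \<longlonglongrightarrow> 0"
    and aas: "aas p (\<lambda>n E. graph_connected {1..n} E \<and> real (metric_dim {1..n} E) \<le> (1 + \<epsilon> n) * f n)"
    using le unfolding aas_metric_dim_le_def by blast
  define \<epsilon>' where "\<epsilon>' = (\<lambda>n. (1 + \<epsilon> n) * (f n / g n) - 1)"
  have "\<epsilon>' \<longlonglongrightarrow> (1 + 0) * 1 - 1" unfolding \<epsilon>'_def by (intro tendsto_intros \<epsilon> lim)
  then have "\<epsilon>' \<longlonglongrightarrow> 0" by simp
  moreover have "aas p (\<lambda>n E. graph_connected {1..n} E \<and> real (metric_dim {1..n} E) \<le> (1 + \<epsilon>' n) * g n)"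
    unfolding aas_def
  proof (rule Lim_transform_eventually[OF aas[unfolded aas_def]])
    show "\<forall>\<^sub>F n in sequentially.
      measure_pmf.prob (gnp n (p n)) {E. graph_connected {1..n} E \<and> real (metric_dim {1..n} E) \<le> (1 + \<epsilon> n) * f n} =
      measure_pmf.prob (gnp n (p n)) {E. graph_connected {1..n} E \<and> real (metric_dim {1..n} E) \<le> (1 + \<epsilon>' n) * g n}"
      using g
    proof eventually_elim
      case (elim n)
      have "(1 + \<epsilon>' n) * g n = (1 + \<epsilon> n) * f n" using elim by (simp add: \<epsilon>'_def)
      then show ?case by simp
    qed
  qed
  ultimately show ?thesis unfolding aas_metric_dim_le_def by blast
qed

section \<open>The dense case\<close>

text \<open>The left-hand side is q (1 + \<kappa> (1 - q) / q), and q >= 1/2 gives (1 - q) / q \<le>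
  2 (1 - q) \<le> 2 ln (1/q).\<close>

lemma collision_prob_exp_bound:
  fixes q \<kappa> :: real
  assumes "1 / 2 \<le> q" "q < 1" "0 \<le> \<kappa>"
  shows "1 - (1 - \<kappa>) * (1 - q) \<le> exp (- ((1 - 2 * \<kappa>) * ln (1 / q)))"
proof -
  have q0: "0 < q" using assms by simp
  have "1 - (1 - \<kappa>) * (1 - q) = q * (1 + \<kappa> * (1 - q) / q)" using q0 by (simp add: field_simps)
  also have "\<dots> \<le> exp (ln q) * exp (\<kappa> * (1 - q) / q)"
    using q0 exp_ge_add_one_self[of "\<kappa> * (1 - q) / q"] by (simp add: mult_left_mono)
  also have "\<dots> = exp (ln q + \<kappa> * ((1 - q) / q))" by (simp add: exp_add)
  also have "\<dots> \<le> exp (ln q + \<kappa> * (2 * - ln q))"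
  proof -
    have "(1 - q) / q \<le> (1 - q) / (1 / 2)" using assms by (intro divide_left_mono) auto
    also have "\<dots> \<le> 2 * - ln q" using ln_le_minus_one[OF q0] by simp
    finally have "\<kappa> * ((1 - q) / q) \<le> \<kappa> * (2 * - ln q)" using assms(3) by (rule mult_left_mono)
    then show ?thesis by (simp only: exp_le_cancel_iff add_le_cancel_left)
  qed
  also have "ln q + \<kappa> * (2 * - ln q) = - ((1 - 2 * \<kappa>) * ln (1 / q))"
    using q0 by (simp add: ln_div algebra_simps)
  finally show ?thesis .
qed

text \<open>Both forms of q are the probability that two independent events of probability a agree,
  with a = p or a = exp (- c); such a probability is at least 1/2.\<close>

lemma collision_prob_bounds:
  fixes a :: real
  shows "1 / 2 \<le> a\<^sup>2 + (1 - a)\<^sup>2" and "1 - (a\<^sup>2 + (1 - a)\<^sup>2) = 2 * a * (1 - a)"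
proof -
  have "a\<^sup>2 + (1 - a)\<^sup>2 - 1 / 2 = 2 * (a - 1 / 2)\<^sup>2" by (simp add: power2_eq_square algebra_simps)
  then have "0 \<le> a\<^sup>2 + (1 - a)\<^sup>2 - 1 / 2" by simp
  then show "1 / 2 \<le> a\<^sup>2 + (1 - a)\<^sup>2" by linarith
  show "1 - (a\<^sup>2 + (1 - a)\<^sup>2) = 2 * a * (1 - a)" by (simp add: power2_eq_square algebra_simps)
qed

lemma ln_inverse_collision_prob:
  fixes q :: real
  assumes "1 / 2 \<le> q" "q < 1"
  shows "0 < ln (1 / q)" "ln (1 / q) \<le> 2" "1 - q \<le> ln (1 / q)"
proof -
  have q0: "0 < q" using assms by simp
  show "0 < ln (1 / q)" using assms by (intro ln_gt_zero) (simp add: field_simps)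
  have "1 / q \<le> 2" using assms by (simp add: field_simps)
  then have "ln (1 / q) \<le> 2 - 1" using ln_le_minus_one[of "1 / q"] q0 by simp
  then show "ln (1 / q) \<le> 2" by simp
  show "1 - q \<le> ln (1 / q)" using ln_le_minus_one[OF q0] q0 by (simp add: ln_div)
qed

lemma ln_real_at_top: "filterlim (\<lambda>n. ln (real n)) at_top sequentially"
  by (rule filterlim_compose[OF ln_at_top filterlim_real_sequentially])

lemma ln_smallo_of_ge:
  assumes "(\<lambda>n. ln (real n)) \<in> o(f)" "\<forall>\<^sub>F n in sequentially. 0 \<le> f n \<and> f n \<le> C * g n"
  shows "(\<lambda>n. ln (real n)) \<in> o(g)"
proof (rule landau_o.small_big_trans[OF assms(1)])
  show "f \<in> O(g)"
  proof (rule bigoI)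
    show "\<forall>\<^sub>F n in sequentially. norm (f n) \<le> \<bar>C\<bar> * norm (g n)"
      using assms(2) by eventually_elim (simp add: abs_mult[symmetric])
  qed
qed

text \<open>As q >= 1/2, ln (1/q) is bounded, which gives \<Omega>; the upper order needs q bounded
  away from 1.\<close>

lemma log_bound_theta:
  fixes q :: "nat \<Rightarrow> real"
  assumes q: "\<forall>\<^sub>F n in sequentially. 1 / 2 \<le> q n \<and> q n < 1"
  shows "(\<lambda>n. 2 * ln (real n) / ln (1 / q n)) \<in> \<Omega>(\<lambda>n. ln (real n))"
    and "0 < b \<Longrightarrow> \<forall>\<^sub>F n in sequentially. b \<le> 1 - q n \<Longrightarrow>
      (\<lambda>n. 2 * ln (real n) / ln (1 / q n)) \<in> \<Theta>(\<lambda>n. ln (real n))"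
proof -
  show *: "(\<lambda>n. 2 * ln (real n) / ln (1 / q n)) \<in> \<Omega>(\<lambda>n. ln (real n))"
    unfolding bigomega_iff_bigo
  proof (rule bigoI[of _ 1])
    show "\<forall>\<^sub>F n in sequentially. norm (ln (real n)) \<le> 1 * norm (2 * ln (real n) / ln (1 / q n))"
      using q eventually_ge_at_top[of 1]
    proof eventually_elim
      case (elim n)
      note L = ln_inverse_collision_prob[of "q n"]
      have "ln (real n) * ln (1 / q n) \<le> ln (real n) * 2"
        using L elim by (intro mult_left_mono) auto
      then have "ln (real n) \<le> 2 * ln (real n) / ln (1 / q n)"
        using L elim by (subst pos_le_divide_eq) (auto simp: mult.commute)
      then show ?case using elim by simp
    qed
  qed
  assume b: "0 < b" "\<forall>\<^sub>F n in sequentially. b \<le> 1 - q n"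
  have "(\<lambda>n. 2 * ln (real n) / ln (1 / q n)) \<in> O(\<lambda>n. ln (real n))"
  proof (rule bigoI[of _ "2 / b"])
    show "\<forall>\<^sub>F n in sequentially. norm (2 * ln (real n) / ln (1 / q n)) \<le> 2 / b * norm (ln (real n))"
      using q b(2) eventually_ge_at_top[of 1]
    proof eventually_elim
      case (elim n)
      note L = ln_inverse_collision_prob[of "q n"]
      have "2 * ln (real n) / ln (1 / q n) \<le> 2 * ln (real n) / b"
        using L elim b(1) by (intro divide_left_mono) auto
      then show ?case using L elim by simp
    qed
  qed
  then show "(\<lambda>n. 2 * ln (real n) / ln (1 / q n)) \<in> \<Theta>(\<lambda>n. ln (real n))" using * by (rule bigthetaI)
qed

lemma pn_large:
  fixes p d :: "nat \<Rightarrow> real"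
  assumes p: "\<And>n. 0 \<le> p n \<and> p n \<le> 1" and d: "\<And>n. d n = p n * (real n - 1)"
    and d_large: "(\<lambda>n. ln (real n) ^ 3) \<in> o(d)"
  shows "(\<lambda>n. ln (real n)) \<in> o(d)" and "(\<lambda>n. ln (real n)) \<in> o(\<lambda>n. p n * real n)"
    and "filterlim d at_top sequentially"
proof -
  have ln1: "\<forall>\<^sub>F n in sequentially. 1 \<le> ln (real n)"
    using ln_real_at_top by (simp add: filterlim_at_top)
  have "(\<lambda>n. ln (real n)) \<in> O(\<lambda>n. ln (real n) ^ 3)"
  proof (rule bigoI[of _ 1])
    show "\<forall>\<^sub>F n in sequentially. norm (ln (real n)) \<le> 1 * norm (ln (real n) ^ 3)"
      using ln1
    proof eventually_elim
      case (elim n)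
      then have "ln (real n) ^ 1 \<le> ln (real n) ^ 3" by (intro power_increasing) auto
      then show ?case using elim by simp
    qed
  qed
  then show *: "(\<lambda>n. ln (real n)) \<in> o(d)" using d_large by (rule landau_o.big_small_trans)
  show "(\<lambda>n. ln (real n)) \<in> o(\<lambda>n. p n * real n)"
  proof (rule ln_smallo_of_ge[OF *, of 1])
    show "\<forall>\<^sub>F n in sequentially. 0 \<le> d n \<and> d n \<le> 1 * (p n * real n)"
      using eventually_ge_at_top[of 1]
    proof eventually_elim
      case (elim n)
      have "0 \<le> d n" using elim p[of n] by (simp add: d)
      moreover have "d n \<le> p n * real n" unfolding d using p[of n] by (intro mult_left_mono) auto
      ultimately show ?case by simp
    qed
  qed
  show "filterlim d at_top sequentially"
  proof (rule filterlim_at_top_mono[OF ln_real_at_top])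
    have "\<forall>\<^sub>F n in sequentially. norm (ln (real n)) \<le> 1 * norm (d n)"
      by (rule landau_o.smallD[OF *]) simp
    then show "\<forall>\<^sub>F n in sequentially. ln (real n) \<le> d n"
      using eventually_ge_at_top[of 1] by eventually_elim (use p in \<open>simp add: d\<close>)
  qed
qed

text \<open>For p of constant order, comparing balls of radius 0 and 1 suffices. The assumption on n
  - d enters through \<open>D\<close>: up to a constant, \<open>D\<close> is at least n - d and
  hence of larger order than ln n.\<close>

lemma metric_dim_dense:
  fixes p d q :: "nat \<Rightarrow> real"
  assumes p: "\<And>n. 0 \<le> p n \<and> p n \<le> 1" and d: "\<And>n. d n = p n * (real n - 1)"
    and d_large: "(\<lambda>n. ln (real n) ^ 3) \<in> o(d)"
    and nd: "(\<lambda>n. ln (real n)) \<in> o(\<lambda>n. real n - d n)"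
    and theta: "p \<in> \<Theta>(\<lambda>_. 1)" and q: "\<And>n. q n = (p n)\<^sup>2 + (1 - p n)\<^sup>2"
  shows "\<forall>\<^sub>F n in sequentially. 1 / 2 \<le> q n \<and> q n < 1"
    and "aas_metric_dim_le p (\<lambda>n. 2 * ln (real n) / ln (1 / q n))"
proof -
  obtain p0 where p0: "0 < p0" "\<forall>\<^sub>F n in sequentially. p0 \<le> p n"
  proof -
    have "p \<in> \<Omega>(\<lambda>_. 1)" using theta by blast
    then obtain b where "0 < b" "\<forall>\<^sub>F n in sequentially. b * norm (1 :: real) \<le> norm (p n)"
      by (auto elim: landau_omega.bigE)
    then show ?thesis using that[of b] p by (auto simp: abs_of_nonneg elim: eventually_mono)
  qed
  have ln1: "\<forall>\<^sub>F n in sequentially. 1 \<le> ln (real n)"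
    using ln_real_at_top by (simp add: filterlim_at_top)
  \<comment> \<open>Since n - d = n (1 - p) + p, eventually n (1 - p) is at least 1: the extra p is
    negligible and p < 1.\<close>
  have gap: "\<forall>\<^sub>F n in sequentially. real n - d n \<le> 2 * (real n * (1 - p n)) \<and> 0 \<le> real n - d n \<and> p n < 1"
    using landau_o.smallD[OF nd half_gt_zero[OF zero_less_one]] ln1 eventually_ge_at_top[of 1]
  proof eventually_elim
    case (elim n)
    have eq: "real n - d n = real n * (1 - p n) + p n" by (simp add: d algebra_simps)
    have "0 \<le> real n * (1 - p n)" using p[of n] by simp
    then have nn: "0 \<le> real n - d n" using eq p[of n] by linarith
    then have "2 \<le> real n - d n" using elim by simp
    then have 1: "1 \<le> real n * (1 - p n)" using eq p[of n] by linarith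
    then have "p n < 1" using p[of n] by (cases "p n = 1") auto
    then show ?case using eq p[of n] nn 1 by auto
  qed
  show q1: "\<forall>\<^sub>F n in sequentially. 1 / 2 \<le> q n \<and> q n < 1"
    using gap p0(2)
  proof eventually_elim
    case (elim n)
    have "0 < 2 * p n * (1 - p n)" using elim p0 by simp
    then show ?case using collision_prob_bounds[of "p n"] by (simp add: q)
  qed
  define D where "D = (\<lambda>n. (real n - 2) * (2 * p n * (1 - p n)))"
  show "aas_metric_dim_le p (\<lambda>n. 2 * ln (real n) / ln (1 / q n))"
  proof (rule aas_metric_dim_le_of_separating[OF p, where i = "\<lambda>_. 0" and D = D and D0 = "\<lambda>n. 1 - q n"])
    show "\<forall>\<^sub>F n in sequentially. \<forall>\<kappa>\<in>{0..1}. \<forall>u\<in>{1..n}. \<forall>v\<in>{1..n}. u \<noteq> v \<longrightarrow>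
      measure_pmf.prob (gnp n (p n)) {E. real (card (separating {1..n} E 0 u v)) < (1 - \<kappa>) * D n}
      \<le> 6 * real 0 / real n ^ 4 + exp (- (\<kappa>\<^sup>2 * D n / 2))"
    proof (intro always_eventually allI ballI impI)
      fix n u v :: nat and \<kappa> :: real
      assume "\<kappa> \<in> {0..1}" "u \<in> {1..n}" "v \<in> {1..n}" "u \<noteq> v"
      then show "measure_pmf.prob (gnp n (p n)) {E. real (card (separating {1..n} E 0 u v)) < (1 - \<kappa>) * D n}
        \<le> 6 * real 0 / real n ^ 4 + exp (- (\<kappa>\<^sup>2 * D n / 2))"
        using prob_few_separating_dense[of "{1..n}" u v "p n" \<kappa> "D n"] p[of n]
        by (simp add: gnp_eq_random_subset D_def)
    qed
    show "(\<lambda>n. ln (real n)) \<in> o(D)"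
    proof (rule ln_smallo_of_ge[OF nd, of "2 / p0"])
      show "\<forall>\<^sub>F n in sequentially. 0 \<le> real n - d n \<and> real n - d n \<le> 2 / p0 * D n"
        using gap p0(2) eventually_ge_at_top[of 4]
      proof eventually_elim
        case (elim n)
        have "(real n * (1 - p n)) * p0 \<le> (real n * (1 - p n)) * p n"
          using elim p[of n] by (intro mult_left_mono) auto
        also have "\<dots> \<le> (2 * (real n - 2) * (1 - p n)) * p n"
          using elim p[of n] by (intro mult_right_mono) auto
        also have "\<dots> = D n" by (simp add: D_def)
        finally have "2 * (real n * (1 - p n)) \<le> 2 / p0 * D n" using p0 by (simp add: field_simps)
        then show ?case using elim by linarith
      qed
    qed
    show "\<forall>\<^sub>F n in sequentially. 0 \<le> D n"
      using eventually_ge_at_top[of 2] by eventually_elim (use p in \<open>simp add: D_def\<close>)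
    show "\<forall>\<^sub>F n in sequentially. (1 - \<kappa>) * (real n * (1 - q n)) \<le> D n" if "0 < \<kappa>" for \<kappa>
    proof -
      have "\<forall>\<^sub>F n in sequentially. 2 / \<kappa> \<le> real n"
        using filterlim_real_sequentially by (simp add: filterlim_at_top)
      then show ?thesis
      proof eventually_elim
        case (elim n)
        then have "(1 - \<kappa>) * real n \<le> real n - 2" using that by (simp add: field_simps)
        then have "(1 - \<kappa>) * real n * (2 * p n * (1 - p n)) \<le> D n"
          unfolding D_def using p[of n] by (intro mult_right_mono) auto
        then show ?case using collision_prob_bounds(2)[of "p n"] by (simp add: q mult.assoc)
      qed
    qed
    show "\<forall>\<^sub>F n in sequentially. 0 \<le> 1 - q n" using q1 by eventually_elim simp
    show "\<forall>\<^sub>F n in sequentially. \<forall>\<kappa>\<in>{0..1/2}.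
        1 - (1 - \<kappa>) * (1 - q n) \<le> exp (- ((1 - 2 * \<kappa>) * ln (1 / q n)))"
      using q1 by eventually_elim (intro ballI collision_prob_exp_bound, auto)
    show "\<forall>\<^sub>F n in sequentially. 0 < ln (1 / q n) \<and> ln (1 / q n) \<le> 2"
      using q1 by eventually_elim (intro conjI ln_inverse_collision_prob, auto)
    show "(\<lambda>n. ln (real n)) \<in> o(\<lambda>n. p n * real n)" by (rule pn_large[OF p d d_large])
  qed simp
qed

section \<open>The sparse case\<close>

lemma one_minus_exp_concave:
  fixes c t :: real
  assumes "0 \<le> t" "t \<le> 1"
  shows "t * (1 - exp (- c)) \<le> 1 - exp (- (t * c))"
  using convex_onD[OF exp_convex, of t 0 "- c"] assms by (simp add: algebra_simps)

text \<open>Common ground of c = \<Theta>(1) and c tending to infinity for p = o(1). What is kept of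
  the maximality of \<open>i\<close> is that \<open>c\<close> stays above a positive
  constant.\<close>

locale sparse_regime =
  fixes p d c :: "nat \<Rightarrow> real" and i :: "nat \<Rightarrow> nat" and c0 :: real
  assumes p: "\<And>n. 0 \<le> p n \<and> p n \<le> 1" and d: "\<And>n. d n = p n * (real n - 1)"
    and d_large: "(\<lambda>n. ln (real n) ^ 3) \<in> o(d)"
    and c: "\<And>n. c n = d n ^ (i n + 1) / real n"
    and p_small: "p \<longlonglongrightarrow> 0"
    and i_small: "(\<lambda>n. d n ^ i n / real n) \<longlonglongrightarrow> 0"
    and c0: "0 < c0" "\<forall>\<^sub>F n in sequentially. c0 \<le> c n"
begin

definition y where "y = (\<lambda>n. d n ^ i n / real n)"
definition \<delta> where "\<delta> = (\<lambda>n. 32 * sqrt (ln (real n) / d n) + 32 * d n ^ i n / real n)"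
text \<open>Relative error in the exponent c. It comes from (1 + \<delta>) (1 + 2 y) (1 + 4 y),
  where (1 + 2 y) (1 + 4 y) \<le> 1 + 14 y and the product with 1 + \<delta> at most doubles the
  14.\<close>

definition \<eta> where "\<eta> = (\<lambda>n. \<delta> n + 28 * y n)"

text \<open>
  Where \<open>c > 2 ln (1/y)\<close>, the term \<open>exp (- c) \<le> y\<^sup>2\<close> is negligible, so that the errors in
  the exponent have to be controlled only up to this truncation.
\<close>

definition cc where "cc = (\<lambda>n. min (c n) (2 * ln (1 / y n)))"

definition D where "D = (\<lambda>n. 2 * (1 - 3 * \<delta> n) * d n ^ i n + (real n - 8 * d n ^ i n) *
      (2 * (1 - exp (- ((1 - 3 * \<delta> n) * d n ^ i n * p n))) *
        exp (- ((1 + \<delta> n) * d n ^ i n * (p n * (1 + 2 * p n))))))"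

text \<open>Total multiplicative loss against the target mean. The divisor \<open>1 + y n\<close>
  pays for y + exp (- c) \<le> y (1 + y) beyond the truncation.\<close>

definition \<theta> where "\<theta> = (\<lambda>n. (1 - 8 * y n) * (1 - 3 * \<delta> n) * exp (- (cc n * \<eta> n)) / (1 + y n))"

text \<open>The product is sqrt (ln^3 n / d).\<close>

lemma ln_sqrt: "(\<lambda>n. ln (real n) * sqrt (ln (real n) / d n)) \<longlonglongrightarrow> 0"
proof -
  have "(\<lambda>n. ln (real n) ^ 3 / d n) \<longlonglongrightarrow> 0" by (rule smalloD_tendsto[OF d_large])
  then have "(\<lambda>n. sqrt (ln (real n) ^ 3 / d n)) \<longlonglongrightarrow> sqrt 0" by (rule tendsto_real_sqrt)
  then have "(\<lambda>n. sqrt (ln (real n) ^ 3 / d n)) \<longlonglongrightarrow> 0" by simp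
  then show ?thesis
  proof (rule Lim_transform_eventually)
    show "\<forall>\<^sub>F n in sequentially. sqrt (ln (real n) ^ 3 / d n) = ln (real n) * sqrt (ln (real n) / d n)"
      using eventually_ge_at_top[of 1]
    proof eventually_elim
      case (elim n)
      have "sqrt (ln (real n) ^ 3 / d n) = sqrt ((ln (real n))\<^sup>2 * (ln (real n) / d n))"
        by (simp add: power3_eq_cube power2_eq_square)
      also have "\<dots> = ln (real n) * sqrt (ln (real n) / d n)"
        using elim by (subst real_sqrt_mult) simp
      finally show ?case .
    qed
  qed
qed

lemma d_nonneg: "1 \<le> n \<Longrightarrow> 0 \<le> d n"
  using p[of n] by (simp add: d)

lemma \<delta>_tendsto: "\<delta> \<longlonglongrightarrow> 0"
proof -
  have "(\<lambda>n. sqrt (ln (real n) / d n)) \<longlonglongrightarrow> 0"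
  proof (rule tendsto_sandwich[where f = "\<lambda>_. 0"])
    have "\<forall>\<^sub>F n in sequentially. 1 \<le> ln (real n)"
      using ln_real_at_top by (simp add: filterlim_at_top)
    then show "\<forall>\<^sub>F n in sequentially. sqrt (ln (real n) / d n) \<le> ln (real n) * sqrt (ln (real n) / d n)"
      using eventually_ge_at_top[of 1]
    proof eventually_elim
      case (elim n)
      have "0 \<le> sqrt (ln (real n) / d n)" using elim d_nonneg[of n] by simp
      then have "1 * sqrt (ln (real n) / d n) \<le> ln (real n) * sqrt (ln (real n) / d n)"
        using elim by (intro mult_right_mono) auto
      then show ?case by simp
    qed
    show "\<forall>\<^sub>F n in sequentially. 0 \<le> sqrt (ln (real n) / d n)"
      using eventually_ge_at_top[of 1] by eventually_elim (use d_nonneg in simp)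
  qed (use ln_sqrt in auto)
  then have "(\<lambda>n. 32 * sqrt (ln (real n) / d n) + 32 * (d n ^ i n / real n)) \<longlonglongrightarrow> 32 * 0 + 32 * 0"
    by (intro tendsto_intros i_small)
  then show ?thesis by (simp add: \<delta>_def)
qed

lemma y_tendsto: "y \<longlonglongrightarrow> 0" using i_small by (simp add: y_def)

definition basic where "basic n \<longleftrightarrow> 2 \<le> n \<and> 4 \<le> d n \<and> p n \<le> 1 / 2 \<and> 0 < y n \<and> y n \<le> 1 / 32 \<and>
   0 \<le> \<delta> n \<and> \<delta> n \<le> 1 / 32 \<and> 1 / real n \<le> y n \<and> p n \<le> 2 * y n \<and> i n \<le> n \<and> d n \<le> real n * y n \<and> c0 \<le> c n"

lemma basic: "\<forall>\<^sub>F n in sequentially. basic n"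
proof -
  have e1: "\<forall>\<^sub>F n in sequentially. 4 \<le> d n"
    using pn_large(3)[OF p d d_large] by (simp add: filterlim_at_top)
  have e2: "\<forall>\<^sub>F n in sequentially. p n < min (1 / 2) c0"
    by (rule order_tendstoD[OF p_small]) (use c0 in auto)
  have e3: "\<forall>\<^sub>F n in sequentially. y n < 1 / 32"
    by (rule order_tendstoD[OF y_tendsto]) auto
  have e4: "\<forall>\<^sub>F n in sequentially. \<delta> n < 1 / 32"
    by (rule order_tendstoD[OF \<delta>_tendsto]) auto
  show ?thesis
    using e1 e2 e3 e4 c0(2) eventually_ge_at_top[of 2]
  proof eventually_elim
    case (elim n)
    have n: "0 < real n" using elim by simp
    \<comment> \<open>If \<open>i n = 0\<close>, then c \<le> p < c0, a contradiction. From
      \<open>i n\<close> >= 1 follows d \<le> d^i = n y, and with it p \<le> 2 y, which absorbs the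
      corrections in p into \<eta>.\<close>
    have "i n \<noteq> 0"
    proof
      assume "i n = 0"
      then have "c n = p n * ((real n - 1) / real n)" using n by (simp add: c d)
      also have "\<dots> \<le> p n * 1" using n p[of n] by (intro mult_left_mono) auto
      finally show False using elim by simp
    qed
    then have d_le: "d n \<le> d n ^ i n" using elim self_le_power[of "d n" "i n"] by simp
    have one: "1 \<le> d n ^ i n" using elim by simp
    have y1: "1 / real n \<le> y n" using one n by (simp add: y_def divide_right_mono)
    have d_le': "d n \<le> real n * y n" using d_le n by (simp add: y_def)
    have "p n * real n \<le> 2 * d n"
      using mult_left_mono[of 2 "real n" "p n"] elim p[of n] by (simp add: d algebra_simps)
    then have "p n * real n \<le> (2 * y n) * real n" using d_le' by (simp add: mult_ac)
    then have p_le: "p n \<le> 2 * y n" using n by simp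
    have "real (i n) \<le> 2 ^ i n" by (metis less_imp_le of_nat_less_two_power)
    also have "\<dots> \<le> d n ^ i n" using elim by (intro power_mono) auto
    also have "\<dots> \<le> real n" using elim(3) n by (simp add: y_def field_simps)
    finally have "i n \<le> n" by simp
    moreover have "0 < y n" using y1 n by (meson less_le_trans zero_less_divide_1_iff)
    moreover have "0 \<le> \<delta> n" using elim by (simp add: \<delta>_def)
    ultimately show ?case using elim y1 p_le d_le' by (simp add: basic_def)
  qed
qed

text \<open>The truncation gives cc \<le> 2 ln (1/y), which is at most 2 ln n because 1/n \<le> y.
  The first bound, with x ln (1/x) -> 0, handles the part 60 y of \<eta> (60 = 32 + 28); the second,
  with \<open>ln_sqrt\<close>, handles the square root.\<close>

lemma cc_\<eta>: "(\<lambda>n. cc n * \<eta> n) \<longlonglongrightarrow> 0"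
proof (rule tendsto_sandwich[where f = "\<lambda>_. 0"])
  have y_right: "filterlim y (at_right 0) sequentially"
    unfolding filterlim_at using y_tendsto basic by (auto simp: basic_def elim: eventually_mono)
  have "((\<lambda>x :: real. x * ln (1 / x)) \<longlongrightarrow> 0) (at_right 0)" by real_asymp
  then have "(\<lambda>n. y n * ln (1 / y n)) \<longlonglongrightarrow> 0" using y_right by (rule filterlim_compose)
  then have "(\<lambda>n. 64 * (ln (real n) * sqrt (ln (real n) / d n)) + 120 * (y n * ln (1 / y n))) \<longlonglongrightarrow> 64 * 0 + 120 * 0"
    by (intro tendsto_intros ln_sqrt)
  then show "(\<lambda>n. 64 * (ln (real n) * sqrt (ln (real n) / d n)) + 120 * (y n * ln (1 / y n))) \<longlonglongrightarrow> 0"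
    by simp
  show "\<forall>\<^sub>F n in sequentially. cc n * \<eta> n \<le> 64 * (ln (real n) * sqrt (ln (real n) / d n)) + 120 * (y n * ln (1 / y n))"
    using basic
  proof eventually_elim
    case (elim n)
    then have b: "2 \<le> n" "4 \<le> d n" "0 < y n" "y n \<le> 1 / 32" "0 \<le> \<delta> n" "1 / real n \<le> y n" by (auto simp: basic_def)
    have \<eta>: "\<eta> n = 32 * sqrt (ln (real n) / d n) + 60 * y n" by (simp add: \<eta>_def \<delta>_def y_def)
    have sq: "0 \<le> sqrt (ln (real n) / d n)" using b by simp
    have "1 / y n \<le> real n" using b by (simp add: field_simps)
    then have ln_y: "ln (1 / y n) \<le> ln (real n)" using b by (subst ln_le_cancel_iff) auto
    have "cc n * \<eta> n \<le> (2 * ln (1 / y n)) * \<eta> n"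
      by (intro mult_right_mono) (use b in \<open>auto simp: cc_def \<eta>_def\<close>)
    also have "\<dots> = 64 * (ln (1 / y n) * sqrt (ln (real n) / d n)) + 120 * (y n * ln (1 / y n))"
      by (simp add: \<eta> algebra_simps)
    also have "\<dots> \<le> 64 * (ln (real n) * sqrt (ln (real n) / d n)) + 120 * (y n * ln (1 / y n))"
      using mult_right_mono[OF ln_y sq] by simp
    finally show ?case .
  qed
  show "\<forall>\<^sub>F n in sequentially. 0 \<le> cc n * \<eta> n"
    using basic
  proof eventually_elim
    case (elim n)
    then have "0 < y n" "y n \<le> 1 / 32" "0 \<le> \<delta> n" "c0 \<le> c n" by (auto simp: basic_def)
    then show ?case using c0 by (auto simp: cc_def \<eta>_def)
  qed
qed simp

lemma \<theta>_tendsto: "\<theta> \<longlonglongrightarrow> 1"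
proof -
  have "(\<lambda>n. (1 - 8 * y n) * (1 - 3 * \<delta> n) * exp (- (cc n * \<eta> n)) / (1 + y n)) \<longlonglongrightarrow>
      (1 - 8 * 0) * (1 - 3 * 0) * exp (- 0) / (1 + 0)"
    by (intro tendsto_intros y_tendsto \<delta>_tendsto cc_\<eta>) simp
  then show ?thesis by (simp add: \<theta>_def)
qed

text \<open>Expresses the mean through c, using d^i = n y and c = p (n - 1) y. The factor 1 - exp (-
  x) needs a lower bound on the exponent, where concavity pulls out 1 - 3 \<delta>; the factor exp
  (- x) needs an upper bound, c (1 + \<eta>).\<close>

lemma D_lower:
  assumes "basic n"
  shows "real n * (2 * (1 - 3 * \<delta> n) * y n + (1 - 8 * y n) * (1 - 3 * \<delta> n) * exp (- (c n * \<eta> n)) *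
      (2 * (1 - exp (- c n)) * exp (- c n))) \<le> D n"
proof -
  have b: "2 \<le> n" "4 \<le> d n" "p n \<le> 1 / 2" "0 < y n" "y n \<le> 1 / 32" "0 \<le> \<delta> n" "\<delta> n \<le> 1 / 32"
    "1 / real n \<le> y n" "p n \<le> 2 * y n" "c0 \<le> c n" using assms by (auto simp: basic_def)
  have n: "0 < real n" using b by simp
  have cpos: "0 \<le> c n" using b c0 by simp
  have dy: "d n ^ i n = real n * y n" using n by (simp add: y_def)
  have cd: "c n = p n * (real n - 1) * y n" using n by (simp add: c d y_def)
  have P: "c n \<le> d n ^ i n * p n" unfolding cd dy using b p[of n] by (simp add: algebra_simps)
  have Q: "(1 + \<delta> n) * d n ^ i n * (p n * (1 + 2 * p n)) \<le> c n * (1 + \<eta> n)"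
  proof -
    have "real n \<le> (real n - 1) * (1 + 2 / real n)" using b n by (simp add: field_simps)
    also have "\<dots> \<le> (real n - 1) * (1 + 2 * y n)" using b by (intro mult_left_mono) auto
    finally have n_le: "real n \<le> (real n - 1) * (1 + 2 * y n)" .
    have "(1 + \<delta> n) * d n ^ i n * (p n * (1 + 2 * p n)) = p n * y n * (1 + \<delta> n) * (real n * (1 + 2 * p n))"
      by (simp add: dy)
    also have "\<dots> \<le> p n * y n * (1 + \<delta> n) * (((real n - 1) * (1 + 2 * y n)) * (1 + 4 * y n))"
      using b p[of n] by (intro mult_left_mono mult_mono n_le) auto
    also have "\<dots> = c n * ((1 + \<delta> n) * ((1 + 2 * y n) * (1 + 4 * y n)))" by (simp add: cd)
    also have "\<dots> \<le> c n * (1 + \<eta> n)"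
    proof (rule mult_left_mono[OF _ cpos])
      have "(1 + 2 * y n) * (1 + 4 * y n) = 1 + 6 * y n + 8 * (y n * y n)" by (simp add: algebra_simps)
      also have "\<dots> \<le> 1 + 14 * y n" using mult_left_le[of "y n" "y n"] b by simp
      finally have "(1 + \<delta> n) * ((1 + 2 * y n) * (1 + 4 * y n)) \<le> (1 + \<delta> n) * (1 + 14 * y n)"
        using b by (intro mult_left_mono) auto
      also have "\<dots> = 1 + \<delta> n + 14 * y n + \<delta> n * (14 * y n)" by (simp add: algebra_simps)
      also have "\<dots> \<le> 1 + \<delta> n + 14 * y n + 1 * (14 * y n)" using b by (intro add_left_mono mult_right_mono) auto
      finally show "(1 + \<delta> n) * ((1 + 2 * y n) * (1 + 4 * y n)) \<le> 1 + \<eta> n" by (simp add: \<eta>_def)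
    qed
    finally show ?thesis .
  qed
  have "(1 - 3 * \<delta> n) * (1 - exp (- c n)) \<le> 1 - exp (- ((1 - 3 * \<delta> n) * c n))"
    using b by (intro one_minus_exp_concave) auto
  also have "\<dots> \<le> 1 - exp (- ((1 - 3 * \<delta> n) * d n ^ i n * p n))"
    using P b by (simp add: mult.assoc mult_left_mono)
  finally have A: "(1 - 3 * \<delta> n) * (1 - exp (- c n)) \<le> 1 - exp (- ((1 - 3 * \<delta> n) * d n ^ i n * p n))" .
  have B: "exp (- (c n * \<eta> n)) * exp (- c n) \<le> exp (- ((1 + \<delta> n) * d n ^ i n * (p n * (1 + 2 * p n))))"
    using Q by (simp add: exp_add[symmetric] algebra_simps)
  have "((1 - 3 * \<delta> n) * (1 - exp (- c n))) * (exp (- (c n * \<eta> n)) * exp (- c n)) \<le>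
    (1 - exp (- ((1 - 3 * \<delta> n) * d n ^ i n * p n))) * exp (- ((1 + \<delta> n) * d n ^ i n * (p n * (1 + 2 * p n))))"
    using b cpos p[of n] by (intro mult_mono A B) auto
  then have "(real n * (1 - 8 * y n)) * (2 * (((1 - 3 * \<delta> n) * (1 - exp (- c n))) * (exp (- (c n * \<eta> n)) * exp (- c n)))) \<le>
     (real n * (1 - 8 * y n)) * (2 * ((1 - exp (- ((1 - 3 * \<delta> n) * d n ^ i n * p n))) *
        exp (- ((1 + \<delta> n) * d n ^ i n * (p n * (1 + 2 * p n))))))"
    using b by (intro mult_left_mono) auto
  then show ?thesis by (simp add: D_def dy algebra_simps)
qed

lemma D_ge_y:
  assumes "basic n"
  shows "real n * (2 * (1 - 3 * \<delta> n) * y n) \<le> D n"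
proof -
  have "0 \<le> (1 - 8 * y n) * (1 - 3 * \<delta> n) * exp (- (c n * \<eta> n)) * (2 * (1 - exp (- c n)) * exp (- c n))"
    using assms c0 by (intro mult_nonneg_nonneg) (auto simp: basic_def)
  then have "real n * (2 * (1 - 3 * \<delta> n) * y n) \<le> real n * (2 * (1 - 3 * \<delta> n) * y n +
     (1 - 8 * y n) * (1 - 3 * \<delta> n) * exp (- (c n * \<eta> n)) * (2 * (1 - exp (- c n)) * exp (- c n)))"
    by (intro mult_left_mono) auto
  then show ?thesis using D_lower[OF assms] by linarith
qed

text \<open>Below the truncation \<open>cc n = c n\<close>; the contribution of the layers
  themselves is dropped, leaving the proportion 1 - q.\<close>

lemma D_ge_bounded:
  assumes "basic n" "c n \<le> 2 * ln (1 / y n)"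
  shows "\<theta> n * (real n * (2 * (1 - exp (- c n)) * exp (- c n))) \<le> D n"
proof -
  have b: "0 < y n" "y n \<le> 1 / 32" "0 \<le> \<delta> n" "\<delta> n \<le> 1 / 32" "c0 \<le> c n" using assms by (auto simp: basic_def)
  let ?t = "(1 - 8 * y n) * (1 - 3 * \<delta> n) * exp (- (c n * \<eta> n))"
  let ?z = "2 * (1 - exp (- c n)) * exp (- c n)"
  have z: "0 \<le> ?z" using b c0 by simp
  have "\<theta> n = ?t / (1 + y n)" using assms(2) by (simp add: \<theta>_def cc_def min_absorb1)
  also have "\<dots> \<le> ?t / 1" using b by (intro divide_left_mono mult_nonneg_nonneg) auto
  finally have "\<theta> n * (real n * ?z) \<le> ?t * (real n * ?z)" using z by (intro mult_right_mono) auto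
  also have "\<dots> \<le> real n * (2 * (1 - 3 * \<delta> n) * y n + ?t * ?z)"
    using b by (simp add: algebra_simps mult_left_mono)
  finally show ?thesis using D_lower[OF assms(1)] by linarith
qed

text \<open>Below the truncation both contributions are kept and share the smaller coefficient.
  Above it exp (- c) \<le> y^2, so the layers alone suffice, whatever the error in the
  exponent.\<close>

lemma D_ge_unbounded:
  assumes "basic n"
  shows "(\<theta> n * (1 - exp (- c n))) * (real n * (2 * (y n + exp (- c n)))) \<le> D n"
proof -
  have b: "0 < y n" "y n \<le> 1 / 32" "0 \<le> \<delta> n" "\<delta> n \<le> 1 / 32" "c0 \<le> c n" using assms by (auto simp: basic_def)
  have a: "0 \<le> exp (- c n)" "exp (- c n) \<le> 1" using b c0 by auto
  have \<eta>0: "0 \<le> \<eta> n" using b by (simp add: \<eta>_def)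
  show ?thesis
  proof (cases "c n \<le> 2 * ln (1 / y n)")
    case True
    let ?t = "(1 - 8 * y n) * (1 - 3 * \<delta> n) * exp (- (c n * \<eta> n))"
    have "\<theta> n = ?t / (1 + y n)" using True by (simp add: \<theta>_def cc_def min_absorb1)
    also have "\<dots> \<le> ?t / 1" using b by (intro divide_left_mono mult_nonneg_nonneg) auto
    finally have \<theta>: "\<theta> n * (1 - exp (- c n)) \<le> ?t * (1 - exp (- c n))" using a by (intro mult_right_mono) auto
    have t1: "?t * (1 - exp (- c n)) \<le> (1 - 3 * \<delta> n)"
    proof -
      have "0 \<le> c n * \<eta> n" using b c0 \<eta>0 by simp
      then have "(1 - 8 * y n) * (1 - 3 * \<delta> n) * exp (- (c n * \<eta> n)) * (1 - exp (- c n)) \<le> (1 * (1 - 3 * \<delta> n) * 1) * 1"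
        using a b by (intro mult_mono mult_nonneg_nonneg) auto
      then show ?thesis by simp
    qed
    have "(\<theta> n * (1 - exp (- c n))) * (real n * (2 * (y n + exp (- c n)))) \<le>
        (?t * (1 - exp (- c n))) * (real n * (2 * (y n + exp (- c n))))"
      by (rule mult_right_mono[OF \<theta>]) (use b a in auto)
    also have "\<dots> = (?t * (1 - exp (- c n))) * (real n * (2 * y n)) +
        real n * (?t * (2 * (1 - exp (- c n)) * exp (- c n)))" by (simp add: algebra_simps)
    also have "\<dots> \<le> (1 - 3 * \<delta> n) * (real n * (2 * y n)) +
        real n * (?t * (2 * (1 - exp (- c n)) * exp (- c n)))"
      using b by (intro add_right_mono mult_right_mono t1) auto
    also have "\<dots> \<le> D n" using D_lower[OF assms] by (simp add: algebra_simps)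
    finally show ?thesis .
  next
    case False
    then have "exp (- c n) \<le> exp (- (2 * ln (1 / y n)))" by simp
    also have "- (2 * ln (1 / y n)) = 2 * ln (y n)" using b by (simp add: ln_div)
    also have "exp (2 * ln (y n)) = (y n)\<^sup>2" using b by (simp add: exp_of_nat_mult[of 2, simplified])
    finally have le: "y n + exp (- c n) \<le> y n * (1 + y n)" by (simp add: algebra_simps power2_eq_square)
    have cc0: "0 \<le> cc n" using b c0 by (auto simp: cc_def)
    have "(1 - 8 * y n) * (1 - 3 * \<delta> n) * exp (- (cc n * \<eta> n)) * (1 - exp (- c n)) \<le> (1 * (1 - 3 * \<delta> n) * 1) * 1"
      using a b cc0 \<eta>0 by (intro mult_mono mult_nonneg_nonneg) auto
    then have "(1 - 8 * y n) * (1 - 3 * \<delta> n) * exp (- (cc n * \<eta> n)) * (1 - exp (- c n)) / (1 + y n) \<le> (1 - 3 * \<delta> n) / (1 + y n)"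
      using b by (intro divide_right_mono) auto
    then have \<theta>: "\<theta> n * (1 - exp (- c n)) \<le> (1 - 3 * \<delta> n) / (1 + y n)" by (simp add: \<theta>_def)
    have "(\<theta> n * (1 - exp (- c n))) * (real n * (2 * (y n + exp (- c n)))) \<le>
       ((1 - 3 * \<delta> n) / (1 + y n)) * (real n * (2 * (y n * (1 + y n))))"
      using \<theta> le b a by (intro mult_mono mult_left_mono) auto
    also have "\<dots> = real n * (2 * (1 - 3 * \<delta> n) * y n)" using b by (simp add: field_simps)
    also have "\<dots> \<le> D n" by (rule D_ge_y[OF assms])
    finally show ?thesis .
  qed
qed

lemma pair_bound: "\<forall>\<^sub>F n in sequentially. \<forall>\<kappa>\<in>{0..1}. \<forall>u\<in>{1..n}. \<forall>v\<in>{1..n}. u \<noteq> v \<longrightarrow>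
      measure_pmf.prob (gnp n (p n)) {E. real (card (separating {1..n} E (i n) u v)) < (1 - \<kappa>) * D n}
      \<le> 6 * real (i n) / real n ^ 4 + exp (- (\<kappa>\<^sup>2 * D n / 2))"
  using basic
proof eventually_elim
  case (elim n)
  show ?case
  proof (intro ballI impI)
    fix \<kappa> :: real and u v :: nat
    assume "\<kappa> \<in> {0..1}" "u \<in> {1..n}" "v \<in> {1..n}" "u \<noteq> v"
    then show "measure_pmf.prob (gnp n (p n)) {E. real (card (separating {1..n} E (i n) u v)) < (1 - \<kappa>) * D n}
      \<le> 6 * real (i n) / real n ^ 4 + exp (- (\<kappa>\<^sup>2 * D n / 2))"
      using prob_few_separating_sparse[of "\<delta> n" "{1..n}" "d n" "i n" "p n" u v \<kappa> "D n"] p[of n] elim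
      by (simp add: gnp_eq_random_subset basic_def \<delta>_def d D_def)
  qed
qed

lemma D_large: "(\<lambda>n. ln (real n)) \<in> o(D)"
proof (rule ln_smallo_of_ge[OF pn_large(1)[OF p d d_large], of 1])
  show "\<forall>\<^sub>F n in sequentially. 0 \<le> d n \<and> d n \<le> 1 * D n"
    using basic
  proof eventually_elim
    case (elim n)
    have "1 * (real n * y n) \<le> (2 * (1 - 3 * \<delta> n)) * (real n * y n)"
      using elim by (intro mult_right_mono) (auto simp: basic_def)
    then have "real n * y n \<le> D n" using D_ge_y[OF elim] by (simp add: mult_ac)
    then show ?case using elim by (simp add: basic_def)
  qed
qed

lemma D_nonneg: "\<forall>\<^sub>F n in sequentially. 0 \<le> D n"
  using basic
proof eventually_elim
  case (elim n)
  have "0 \<le> real n * (2 * (1 - 3 * \<delta> n) * y n)" using elim by (simp add: basic_def)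
  then show ?case using D_ge_y[OF elim] by linarith
qed

lemma metric_dim_sparse:
  assumes D_ge: "\<And>\<kappa>. 0 < \<kappa> \<Longrightarrow> \<forall>\<^sub>F n in sequentially. (1 - \<kappa>) * (real n * B n) \<le> D n"
    and B: "\<forall>\<^sub>F n in sequentially. 0 \<le> B n"
    and B_L: "\<forall>\<^sub>F n in sequentially. \<forall>\<kappa>\<in>{0..1/2}. 1 - (1 - \<kappa>) * B n \<le> exp (- ((1 - 2 * \<kappa>) * L n))"
    and L: "\<forall>\<^sub>F n in sequentially. 0 < L n \<and> L n \<le> 2"
  shows "aas_metric_dim_le p (\<lambda>n. 2 * ln (real n) / L n)"
  by (rule aas_metric_dim_le_of_separating[OF p pair_bound D_large D_nonneg D_ge B B_L L])
     (use basic pn_large(2)[OF p d d_large] in \<open>auto simp: basic_def elim: eventually_mono\<close>)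

lemma metric_dim_bounded:
  assumes C: "\<forall>\<^sub>F n in sequentially. c n \<le> C"
    and q: "\<And>n. q n = (exp (- c n))\<^sup>2 + (1 - exp (- c n))\<^sup>2"
  shows "\<forall>\<^sub>F n in sequentially. 1 / 2 \<le> q n \<and> q n < 1"
    and "\<exists>b>0. \<forall>\<^sub>F n in sequentially. b \<le> 1 - q n"
    and "aas_metric_dim_le p (\<lambda>n. 2 * ln (real n) / ln (1 / q n))"
proof -
  define b where "b = 2 * exp (- C) * (1 - exp (- c0))"
  have b: "0 < b" using c0 by (simp add: b_def)
  have q_eq: "1 - q n = 2 * (1 - exp (- c n)) * exp (- c n)" for n
    using collision_prob_bounds(2)[of "exp (- c n)"] by (simp add: q)
  have bq: "\<forall>\<^sub>F n in sequentially. b \<le> 1 - q n"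
    using C c0(2)
  proof eventually_elim
    case (elim n)
    have "exp (- C) * (1 - exp (- c0)) \<le> exp (- c n) * (1 - exp (- c n))"
      using elim c0 by (intro mult_mono) auto
    then show ?case by (simp add: q_eq b_def algebra_simps)
  qed
  then show "\<exists>b>0. \<forall>\<^sub>F n in sequentially. b \<le> 1 - q n" using b by blast
  show q1: "\<forall>\<^sub>F n in sequentially. 1 / 2 \<le> q n \<and> q n < 1"
    using bq by eventually_elim (use b collision_prob_bounds(1) q in auto)
  \<comment> \<open>Since c \<le> C and y tends to 0, the truncation is eventually inactive.\<close>
  have "\<forall>\<^sub>F n in sequentially. y n < exp (- C / 2)"
    by (rule order_tendstoD[OF y_tendsto]) simp
  then have cy: "\<forall>\<^sub>F n in sequentially. c n \<le> 2 * ln (1 / y n)"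
    using C basic
  proof eventually_elim
    case (elim n)
    have "0 < y n" using elim by (simp add: basic_def)
    then have "ln (y n) \<le> ln (exp (- C / 2))" using elim by (subst ln_le_cancel_iff) auto
    then show ?case using elim \<open>0 < y n\<close> by (simp add: ln_div)
  qed
  show "aas_metric_dim_le p (\<lambda>n. 2 * ln (real n) / ln (1 / q n))"
  proof (rule metric_dim_sparse[where B = "\<lambda>n. 1 - q n"])
    fix \<kappa> :: real assume "0 < \<kappa>"
    have "\<forall>\<^sub>F n in sequentially. 1 - \<kappa> < \<theta> n"
      by (rule order_tendstoD[OF \<theta>_tendsto]) (use \<open>0 < \<kappa>\<close> in simp)
    then show "\<forall>\<^sub>F n in sequentially. (1 - \<kappa>) * (real n * (1 - q n)) \<le> D n"
      using basic cy q1
    proof eventually_elim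
      case (elim n)
      have "(1 - \<kappa>) * (real n * (1 - q n)) \<le> \<theta> n * (real n * (1 - q n))"
        using elim by (intro mult_right_mono) auto
      also have "\<dots> \<le> D n" using D_ge_bounded[OF elim(2,3)] by (simp add: q_eq)
      finally show ?case .
    qed
  next
    show "\<forall>\<^sub>F n in sequentially. 0 \<le> 1 - q n" using q1 by eventually_elim simp
    show "\<forall>\<^sub>F n in sequentially. \<forall>\<kappa>\<in>{0..1/2}.
        1 - (1 - \<kappa>) * (1 - q n) \<le> exp (- ((1 - 2 * \<kappa>) * ln (1 / q n)))"
      using q1 by eventually_elim (intro ballI collision_prob_exp_bound, auto)
    show "\<forall>\<^sub>F n in sequentially. 0 < ln (1 / q n) \<and> ln (1 / q n) \<le> 2"
      using q1 by eventually_elim (intro conjI ln_inverse_collision_prob, auto)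
  qed
qed

text \<open>The proportion 2 (y + exp (- c)) tends to 0 and serves as its own rate by 1 - x \<le>
  exp (- x). Its factor 2 cancels the 2 of \<open>2 * ln n\<close>.\<close>

lemma metric_dim_unbounded:
  assumes c: "filterlim c at_top sequentially"
  shows "(\<lambda>n. d n ^ i n / real n + exp (- c n)) \<longlonglongrightarrow> 0"
    and "\<forall>\<^sub>F n in sequentially. 0 < d n ^ i n / real n"
    and "aas_metric_dim_le p (\<lambda>n. inverse (d n ^ i n / real n + exp (- c n)) * ln (real n))"
proof -
  have a0: "(\<lambda>n. exp (- c n)) \<longlonglongrightarrow> 0"
    using c by (intro filterlim_compose[OF exp_at_bot]) (simp add: filterlim_uminus_at_bot)
  show x0: "(\<lambda>n. d n ^ i n / real n + exp (- c n)) \<longlonglongrightarrow> 0"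
    using tendsto_add[OF y_tendsto a0] by (simp add: y_def)
  show y0: "\<forall>\<^sub>F n in sequentially. 0 < d n ^ i n / real n"
    using basic by eventually_elim (simp add: basic_def y_def)
  have "aas_metric_dim_le p (\<lambda>n. 2 * ln (real n) / (2 * (y n + exp (- c n))))"
  proof (rule metric_dim_sparse[where B = "\<lambda>n. 2 * (y n + exp (- c n))"])
    fix \<kappa> :: real assume "0 < \<kappa>"
    have "(\<lambda>n. \<theta> n * (1 - exp (- c n))) \<longlonglongrightarrow> 1 * (1 - 0)"
      by (intro tendsto_intros \<theta>_tendsto a0)
    then have "\<forall>\<^sub>F n in sequentially. 1 - \<kappa> < \<theta> n * (1 - exp (- c n))"
      by (rule order_tendstoD) (use \<open>0 < \<kappa>\<close> in simp)
    then show "\<forall>\<^sub>F n in sequentially. (1 - \<kappa>) * (real n * (2 * (y n + exp (- c n)))) \<le> D n"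
      using basic
    proof eventually_elim
      case (elim n)
      have "0 < y n" using elim by (simp add: basic_def)
      then have "(1 - \<kappa>) * (real n * (2 * (y n + exp (- c n)))) \<le>
          (\<theta> n * (1 - exp (- c n))) * (real n * (2 * (y n + exp (- c n))))"
        using elim by (intro mult_right_mono) auto
      also have "\<dots> \<le> D n" by (rule D_ge_unbounded[OF elim(2)])
      finally show ?case .
    qed
  next
    show "\<forall>\<^sub>F n in sequentially. 0 \<le> 2 * (y n + exp (- c n))"
      using y0 by eventually_elim (simp add: y_def)
    show "\<forall>\<^sub>F n in sequentially. \<forall>\<kappa>\<in>{0..1/2}. 1 - (1 - \<kappa>) * (2 * (y n + exp (- c n)))
        \<le> exp (- ((1 - 2 * \<kappa>) * (2 * (y n + exp (- c n)))))"
      using basic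
    proof eventually_elim
      case (elim n)
      have nn: "0 \<le> 2 * (y n + exp (- c n))" using elim by (simp add: basic_def)
      show ?case
      proof
        fix \<kappa> :: real assume "\<kappa> \<in> {0..1/2}"
        then have "(1 - 2 * \<kappa>) * (2 * (y n + exp (- c n))) \<le> (1 - \<kappa>) * (2 * (y n + exp (- c n)))"
          using nn by (intro mult_right_mono) auto
        then show "1 - (1 - \<kappa>) * (2 * (y n + exp (- c n))) \<le> exp (- ((1 - 2 * \<kappa>) * (2 * (y n + exp (- c n)))))"
          using exp_ge_add_one_self[of "- ((1 - 2 * \<kappa>) * (2 * (y n + exp (- c n))))"] by linarith
      qed
    qed
    have "\<forall>\<^sub>F n in sequentially. d n ^ i n / real n + exp (- c n) < 1"
      by (rule order_tendstoD[OF x0]) simp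
    then show "\<forall>\<^sub>F n in sequentially. 0 < 2 * (y n + exp (- c n)) \<and> 2 * (y n + exp (- c n)) \<le> 2"
      using y0 by eventually_elim (auto simp: y_def add_pos_pos)
  qed
  also have "(\<lambda>n. 2 * ln (real n) / (2 * (y n + exp (- c n)))) =
      (\<lambda>n. inverse (d n ^ i n / real n + exp (- c n)) * ln (real n))"
    by (rule ext, subst mult_divide_mult_cancel_left) (simp_all add: y_def divide_inverse mult.commute)
  finally show "aas_metric_dim_le p (\<lambda>n. inverse (d n ^ i n / real n + exp (- c n)) * ln (real n))" .
qed

end

text \<open>If p tends to 1, so does q, and the bound in (i) is of larger order than ln n. Hence
  \<Omega> is asserted in general and \<Theta> when 1 - p is bounded away from 0.\<close>

theorem theorem3p1:
  fixes p d c q :: "nat \<Rightarrow> real" and i :: "nat \<Rightarrow> nat"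
  assumes p_prob: "\<And>n. 0 \<le> p n \<and> p n \<le> 1"
    and d_eq: "\<And>n. d n = p n * (real n - 1)"
    and d_large: "(\<lambda>n. ln (real n) ^ 3) \<in> o(d)"
    and d_not_too_large: "(\<lambda>n. ln (real n)) \<in> o(\<lambda>n. real n - d n)"
    and i_largest: "largest_exponent d i"
    and c_eq: "\<And>n. c n = d n ^ (i n + 1) / real n"
    and p_cases: "p \<in> o(\<lambda>_. 1) \<or> p \<in> \<Theta>(\<lambda>_. 1)"
    and q_sparse: "\<And>n. p \<in> o(\<lambda>_. 1) \<Longrightarrow> q n = (exp (- c n))\<^sup>2 + (1 - exp (- c n))\<^sup>2"
    and q_dense: "\<And>n. p \<in> \<Theta>(\<lambda>_. 1) \<Longrightarrow> q n = (p n)\<^sup>2 + (1 - p n)\<^sup>2"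
  shows
    "(c \<in> \<Theta>(\<lambda>_. 1) \<longrightarrow>
        aas_metric_dim_le p (\<lambda>n. 2 * ln (real n) / ln (1 / q n)) \<and>
        (\<lambda>n. 2 * ln (real n) / ln (1 / q n)) \<in> \<Omega>(\<lambda>n. ln (real n)) \<and>
        ((\<lambda>n. 1 - p n) \<in> \<Omega>(\<lambda>_. 1) \<longrightarrow>
           (\<lambda>n. 2 * ln (real n) / ln (1 / q n)) \<in> \<Theta>(\<lambda>n. ln (real n)))) \<and>
     (filterlim c at_top sequentially \<longrightarrow>
        aas_metric_dim_le p (\<lambda>n. inverse (d n ^ i n / real n + exp (- c n)) * ln (real n)) \<and>
        (\<lambda>n. ln (real n)) \<in>
          o(\<lambda>n. inverse (d n ^ i n / real n + exp (- c n)) * ln (real n)) \<and>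
        ((\<lambda>n. d n ^ i n / real n) \<in> o(\<lambda>n. exp (- c n)) \<longrightarrow>
           aas_metric_dim_le p (\<lambda>n. exp (c n) * ln (real n)) \<and>
           (\<lambda>n. exp (c n) * ln (real n)) \<sim>[sequentially]
             (\<lambda>n. 2 * ln (real n) / ln (1 / q n))) \<and>
        ((\<lambda>n. exp (- c n)) \<in> o(\<lambda>n. d n ^ i n / real n) \<longrightarrow>
           aas_metric_dim_le p (\<lambda>n. real n * ln (real n) / d n ^ i n)))"
proof -
  have d_nonneg: "\<forall>\<^sub>F n in sequentially. 0 \<le> d n"
    using eventually_ge_at_top[of 1] by eventually_elim (use p_prob in \<open>simp add: d_eq\<close>)
  have i_small: "(\<lambda>n. d n ^ i n / real n) \<longlonglongrightarrow> 0"
    using i_largest by (auto simp: largest_exponent_def dest: smalloD_tendsto)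
  have sparse: "sparse_regime p d c i c0"
    if "p \<in> o(\<lambda>_. 1)" "0 < c0" "\<forall>\<^sub>F n in sequentially. c0 \<le> c n" for c0
    using smalloD_tendsto[OF that(1)] that(2,3) p_prob d_eq d_large c_eq i_small
    by unfold_locales auto
  show ?thesis
  proof (intro conjI impI)
    assume theta: "c \<in> \<Theta>(\<lambda>_. 1)"
    let ?f = "\<lambda>n. 2 * ln (real n) / ln (1 / q n)"
    have "aas_metric_dim_le p ?f \<and> ?f \<in> \<Omega>(\<lambda>n. ln (real n)) \<and>
        ((\<lambda>n. 1 - p n) \<in> \<Omega>(\<lambda>_. 1) \<longrightarrow> ?f \<in> \<Theta>(\<lambda>n. ln (real n)))"
      using p_cases
    proof
      assume small: "p \<in> o(\<lambda>_. 1)"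
      obtain c0 where c0: "0 < c0" "\<forall>\<^sub>F n in sequentially. c0 \<le> c n"
      proof -
        have "c \<in> \<Omega>(\<lambda>_. 1)" using theta by blast
        then obtain b where b: "0 < b" "\<forall>\<^sub>F n in sequentially. b * norm (1 :: real) \<le> norm (c n)"
          by (auto elim: landau_omega.bigE)
        have "\<forall>\<^sub>F n in sequentially. b \<le> c n"
          using b(2) d_nonneg by eventually_elim (simp add: c_eq)
        then show ?thesis using that b(1) by blast
      qed
      obtain C where C: "\<forall>\<^sub>F n in sequentially. c n \<le> C"
      proof -
        have "c \<in> O(\<lambda>_. 1)" using theta by blast
        then obtain C where "\<forall>\<^sub>F n in sequentially. norm (c n) \<le> C * norm (1 :: real)"
          by (auto elim: landau_o.bigE)
        then have "\<forall>\<^sub>F n in sequentially. c n \<le> C" by eventually_elim simp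
        then show ?thesis using that by blast
      qed
      interpret sparse_regime p d c i c0 by (rule sparse[OF small c0])
      note bounded = metric_dim_bounded[OF C q_sparse[OF small]]
      obtain b where "0 < b" "\<forall>\<^sub>F n in sequentially. b \<le> 1 - q n" using bounded(2) by blast
      then show ?thesis using bounded(3) log_bound_theta[OF bounded(1)] by blast
    next
      assume dense: "p \<in> \<Theta>(\<lambda>_. 1)"
      note q = q_dense[OF dense]
      note dim = metric_dim_dense[OF p_prob d_eq d_large d_not_too_large dense q]
      have "?f \<in> \<Theta>(\<lambda>n. ln (real n))" if gap: "(\<lambda>n. 1 - p n) \<in> \<Omega>(\<lambda>_. 1)"
      proof -
        have "p \<in> \<Omega>(\<lambda>_. 1)" using dense by blast
        then obtain a where a: "0 < a" "\<forall>\<^sub>F n in sequentially. a * norm (1 :: real) \<le> norm (p n)"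
          by (auto elim: landau_omega.bigE)
        obtain b where b: "0 < b" "\<forall>\<^sub>F n in sequentially. b * norm (1 :: real) \<le> norm (1 - p n)"
          using gap by (auto elim: landau_omega.bigE)
        have "\<forall>\<^sub>F n in sequentially. 2 * a * b \<le> 1 - q n"
          using a(2) b(2)
        proof eventually_elim
          case (elim n)
          have "a * b \<le> p n * (1 - p n)"
            using elim a b p_prob[of n] by (intro mult_mono) auto
          then show ?case using collision_prob_bounds(2)[of "p n"] by (simp add: q)
        qed
        then show ?thesis using log_bound_theta(2)[OF dim(1), of "2 * a * b"] a b by simp
      qed
      then show ?thesis using dim(2) log_bound_theta(1)[OF dim(1)] by blast
    qed
    then show "aas_metric_dim_le p ?f" "?f \<in> \<Omega>(\<lambda>n. ln (real n))"
      "(\<lambda>n. 1 - p n) \<in> \<Omega>(\<lambda>_. 1) \<Longrightarrow> ?f \<in> \<Theta>(\<lambda>n. ln (real n))"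
      by blast+
  next
    assume c_top: "filterlim c at_top sequentially"
    \<comment> \<open>An unbounded c excludes dense p: if p >= a > 0, then i = 0 would give c \<le>
      1, and i >= 1 would give d^i / n >= a/2, against d^i = o(n).\<close>
    have small: "p \<in> o(\<lambda>_. 1)"
      using p_cases
    proof
      assume "p \<in> \<Theta>(\<lambda>_. 1)"
      then have "p \<in> \<Omega>(\<lambda>_. 1)" by blast
      then obtain a where a: "0 < a" "\<forall>\<^sub>F n in sequentially. a * norm (1 :: real) \<le> norm (p n)"
        by (auto elim: landau_omega.bigE)
      have "\<forall>\<^sub>F n in sequentially. 2 \<le> c n" using c_top by (simp add: filterlim_at_top)
      moreover have "\<forall>\<^sub>F n in sequentially. d n ^ i n / real n < a / 2"
        by (rule order_tendstoD[OF i_small]) (use a in simp)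
      moreover have "\<forall>\<^sub>F n in sequentially. 1 \<le> d n"
        using pn_large(3)[OF p_prob d_eq d_large] by (simp add: filterlim_at_top)
      ultimately have "\<forall>\<^sub>F n in sequentially. False"
        using a(2) eventually_ge_at_top[of 2]
      proof eventually_elim
        case (elim n)
        have pa: "a \<le> p n" using elim p_prob[of n] by simp
        have n: "0 < real n" using elim by simp
        show False
        proof (cases "i n = 0")
          case True
          have "d n \<le> 1 * (real n - 1)" unfolding d_eq using p_prob[of n] elim by (intro mult_right_mono) auto
          then have "c n \<le> 1" using True n by (simp add: c_eq)
          then show False using elim by simp
        next
          case False
          have "a * (real n / 2) \<le> p n * (real n - 1)"
            using pa a elim by (intro mult_mono) auto
          also have "\<dots> \<le> d n ^ i n" using False elim self_le_power[of "d n" "i n"] by (simp add: d_eq)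
          finally have "a / 2 \<le> d n ^ i n / real n" using n by (simp add: field_simps)
          then show False using elim by simp
        qed
      qed
      then show ?thesis by simp
    qed
    have "\<forall>\<^sub>F n in sequentially. 1 \<le> c n" using c_top by (simp add: filterlim_at_top)
    then interpret sparse_regime p d c i 1 by (intro sparse small) auto
    let ?y = "\<lambda>n. d n ^ i n / real n"
    let ?x = "\<lambda>n. ?y n + exp (- c n)"
    note unbounded = metric_dim_unbounded[OF c_top]
    show dim: "aas_metric_dim_le p (\<lambda>n. inverse (?x n) * ln (real n))" by (rule unbounded(3))
    have x0: "\<forall>\<^sub>F n in sequentially. 0 < ?x n"
      using unbounded(2) by eventually_elim (simp add: add_pos_pos)
    have ln0: "\<forall>\<^sub>F n in sequentially. 0 < ln (real n)"
      using eventually_gt_at_top[of 1] by eventually_elim simp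
    show "(\<lambda>n. ln (real n)) \<in> o(\<lambda>n. inverse (?x n) * ln (real n))"
    proof (rule smalloI_tendsto)
      show "(\<lambda>n. ln (real n) / (inverse (?x n) * ln (real n))) \<longlonglongrightarrow> 0"
      proof (rule Lim_transform_eventually[OF unbounded(1)])
        show "\<forall>\<^sub>F n in sequentially. ?x n = ln (real n) / (inverse (?x n) * ln (real n))"
          using x0 ln0 by eventually_elim (simp add: field_simps)
      qed
      show "\<forall>\<^sub>F n in sequentially. inverse (?x n) * ln (real n) \<noteq> 0"
        using x0 ln0 by eventually_elim simp
    qed
    {
      assume y_small: "?y \<in> o(\<lambda>n. exp (- c n))"
      show "aas_metric_dim_le p (\<lambda>n. exp (c n) * ln (real n))"
      proof (rule aas_metric_dim_le_cong_asymp[OF dim])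
        have "(\<lambda>n. 1 / (1 + ?y n / exp (- c n))) \<longlonglongrightarrow> 1 / (1 + 0)"
          by (intro tendsto_intros smalloD_tendsto[OF y_small]) simp
        then have "(\<lambda>n. 1 / (1 + ?y n / exp (- c n))) \<longlonglongrightarrow> 1" by simp
        then show "(\<lambda>n. inverse (?x n) * ln (real n) / (exp (c n) * ln (real n))) \<longlonglongrightarrow> 1"
        proof (rule Lim_transform_eventually)
          show "\<forall>\<^sub>F n in sequentially. 1 / (1 + ?y n / exp (- c n)) =
              inverse (?x n) * ln (real n) / (exp (c n) * ln (real n))"
            using x0 ln0
          proof eventually_elim
            case (elim n)
            have "1 + ?y n / exp (- c n) = ?x n * exp (c n)"
              by (simp add: exp_minus field_simps)
            then show ?case using elim by (simp add: divide_inverse)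
          qed
        qed
        show "\<forall>\<^sub>F n in sequentially. exp (c n) * ln (real n) \<noteq> 0"
          using ln0 by eventually_elim simp
      qed
      show "(\<lambda>n. exp (c n) * ln (real n)) \<sim>[sequentially] (\<lambda>n. 2 * ln (real n) / ln (1 / q n))"
      proof (rule asymp_equivI')
        \<comment> \<open>With a = exp (- c), q = 1 - 2 a + 2 a^2, so ln (1/q) is asymptotic to 2
          a.\<close>
        have "((\<lambda>a :: real. ln (1 / (a\<^sup>2 + (1 - a)\<^sup>2)) / (2 * a)) \<longlongrightarrow> 1) (at_right 0)"
          by real_asymp
        moreover have "filterlim (\<lambda>n. exp (- c n)) (at_right 0) sequentially"
        proof -
          have "(\<lambda>n. exp (- c n)) \<longlonglongrightarrow> 0"
            using c_top by (intro filterlim_compose[OF exp_at_bot]) (simp add: filterlim_uminus_at_bot)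
          then show ?thesis by (simp add: filterlim_at)
        qed
        ultimately have "(\<lambda>n. ln (1 / q n) / (2 * exp (- c n))) \<longlonglongrightarrow> 1"
          unfolding q_sparse[OF small] by (rule filterlim_compose)
        then show "(\<lambda>n. exp (c n) * ln (real n) / (2 * ln (real n) / ln (1 / q n))) \<longlonglongrightarrow> 1"
        proof (rule Lim_transform_eventually)
          show "\<forall>\<^sub>F n in sequentially. ln (1 / q n) / (2 * exp (- c n)) =
              exp (c n) * ln (real n) / (2 * ln (real n) / ln (1 / q n))"
            using ln0 by eventually_elim (simp add: exp_minus field_simps)
        qed
      qed
    next
      assume a_small: "(\<lambda>n. exp (- c n)) \<in> o(?y)"
      show "aas_metric_dim_le p (\<lambda>n. real n * ln (real n) / d n ^ i n)"
      proof (rule aas_metric_dim_le_cong_asymp[OF dim])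
        have "(\<lambda>n. 1 / (1 + exp (- c n) / ?y n)) \<longlonglongrightarrow> 1 / (1 + 0)"
          by (intro tendsto_intros smalloD_tendsto[OF a_small]) simp
        then have "(\<lambda>n. 1 / (1 + exp (- c n) / ?y n)) \<longlonglongrightarrow> 1" by simp
        then show "(\<lambda>n. inverse (?x n) * ln (real n) / (real n * ln (real n) / d n ^ i n)) \<longlonglongrightarrow> 1"
        proof (rule Lim_transform_eventually)
          show "\<forall>\<^sub>F n in sequentially. 1 / (1 + exp (- c n) / ?y n) =
              inverse (?x n) * ln (real n) / (real n * ln (real n) / d n ^ i n)"
            using x0 ln0 unbounded(2)
          proof eventually_elim
            case (elim n)
            have "1 + e / z = (z + e) / z" if "0 < z" for e z :: real
              using that by (simp add: add_divide_distrib)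
            then have "1 + exp (- c n) / ?y n = ?x n / ?y n" using elim(3) by blast
            moreover have "real n * ln (real n) / d n ^ i n = ln (real n) / ?y n" by simp
            ultimately show ?case using elim by (simp only:) (simp add: divide_inverse)
          qed
        qed
        show "\<forall>\<^sub>F n in sequentially. real n * ln (real n) / d n ^ i n \<noteq> 0"
          using ln0 unbounded(2)
        proof eventually_elim
          case (elim n)
          have "real n * ln (real n) / d n ^ i n = ln (real n) / ?y n" by simp
          also have "\<dots> \<noteq> 0" using elim by (metis divide_eq_0_iff less_irrefl)
          finally show ?case .
        qed
      qed
    }
  qed
qed


end
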